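(* Let $\mathbf{k}$ be a field, $X=\{x_1,\dots,x_n\}$, and let $\prec$ be the degree-lexicographic order on $\langle X\rangle$ with $x_1\prec\cdots\prec x_n$. Let $\mathcal F=\mathbf{k}\langle X\rangle/(\Re^{!})$ be a quadratic graded algebra which has precisely $\binom n2+n$ defining relations $$\Re^{!}=\Re\cup\Re_1,\qquad \Re_1=\{x_jx_j\}_{1\le j\le n},\qquad \Re=\{x_jx_i-c_{ij}x_{i'}x_{j'}\}_{1\le i<j\le n},$$ where the set $\Re$ is such that (a) $\Re$ are relations of skew-polynomial type with respect to $\prec$; and (b) $\Re$ is a Gröbner basis (with respect to $\prec$) of the two-sided ideal $(\Re)$ of $\mathbf{k}\langle X\rangle$. (In other words, $\mathbf{k}\langle X\rangle/(\Re)$ is a binomial skew polynomial ring.) Then: (1) $\Re^{!}$ is a Gröbner basis of the ideal $(\Re^{!})$ in $\mathbf{k}\langle X\rangle$, and the set of monomials $$\mathcal N^{!}=\{x_1^{\varepsilon_1}x_2^{\varepsilon_2}\cdots x_n^{\varepsilon_n}\mid 0\le\varepsilon_i\le 1\text{ for all }1\le i\le n\}$$ is a $\mathbf{k}$-basis of $\mathcal F$. (2) $\mathcal F$ is Koszul. (3) $\mathcal F$ is a Frobenius algebra of dimension $n$. More precisely, $\mathcal F=\bigoplus_{i\ge 0}\mathcal F_i$ is graded by length, where $\mathcal F_0=\mathbf{k}$; $\mathcal F_i=\mathrm{Span}_{\mathbf{k}}\{u\in\mathcal N^{!}\mid |u|=i\}$ for $1\le i\le n$; $\mathcal F_n=\mathrm{Span}_{\mathbf{k}}(W)$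 with $W=x_1x_2\cdots x_n$; and $\mathcal F_{n+j}=0$ for $j\ge1$. (4) Furthermore, $\mathcal F$ is a quantum grassmann algebra: $\dim_{\mathbf{k}}\mathcal F_i=\binom ni$ for $1\le i\le n$.
   Context: $\langle X\rangle$ is the free monoid (unitary free semigroup) on $X$, $\mathbf{k}\langle X\rangle$ the free associative unital algebra, $|u|$ the length of a word $u$, and $\mathbf{k}^{\times}=\mathbf{k}\setminus\{0\}$. Relations of skew-polynomial type: a set $\Re=\{x_jx_i-c_{ij}x_{i'}x_{j'}\}_{1\le i<j\le n}$ of precisely $\binom n2$ relations such that: (a) $c_{ij}\in\mathbf{k}^\times$; (b) for every pair $1\le i<j\le n$ the relation $x_jx_i-c_{ij}x_{i'}x_{j'}\in\Re$ satisfies $j>i'$ and $i'\le j'$; (c) every ordered monomial $x_ix_j$ with $1\le i<j\le n$ occurs in the right-hand side (i.e. as $x_{i'}x_{j'}$) of some relation in $\Re$. If in addition $\Re$ is the reduced Gröbner basis of $(\Re)$ with respect to $\prec$, the algebra $\mathbf{k}\langle X\rangle/(\Re)$ is called a binomial skew polynomial ring. Frobenius algebra: a graded algebra $A=\bigoplus_{i\ge0}A_i$ is a Frobenius algebra of dimension $d$ if (a) $\dim A_d=1$ and $A_i=0$ for $i>d$; and (b) for all $j\ge0$ the multiplication map $A_j\otimes A_{d-j}\to A_d$ is a perfect duality (nondegenerate pairing). It is a quantum grassmann algebra if in addition $\dim_{\mathbf{k}}A_i=\binom di$ for $1\le i\le d$. *)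

theory Defs
  imports
    "HOL-Algebra.QuotRing"
    "HOL-Algebra.Module"
    "HOL-Algebra.Algebraic_Closure_Type"
    "HOL-Library.Poly_Mapping"
    "HOL-Library.Sublist"
    "HOL-Library.FuncSet"
begin

definition lin_span :: "('k, 'm) ring_scheme \<Rightarrow> ('k, 'a, 'n) module_scheme \<Rightarrow> 'a set \<Rightarrow> 'a set"
  where "lin_span K M S =
    {(\<Oplus>\<^bsub>M\<^esub>v\<in>T. a v \<odot>\<^bsub>M\<^esub> v) | a T. finite T \<and> T \<subseteq> S \<and> a \<in> T \<rightarrow> carrier K}"

definition lin_independent :: "('k, 'm) ring_scheme \<Rightarrow> ('k, 'a, 'n) module_scheme \<Rightarrow> 'a set \<Rightarrow> bool"
  where "lin_independent K M S \<longleftrightarrow>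
    (\<forall>a T. finite T \<and> T \<subseteq> S \<and> a \<in> T \<rightarrow> carrier K \<and> (\<Oplus>\<^bsub>M\<^esub>v\<in>T. a v \<odot>\<^bsub>M\<^esub> v) = \<zero>\<^bsub>M\<^esub>
      \<longrightarrow> (\<forall>v\<in>T. a v = \<zero>\<^bsub>K\<^esub>))"

definition is_basis :: "('k, 'm) ring_scheme \<Rightarrow> ('k, 'a, 'n) module_scheme \<Rightarrow> 'a set \<Rightarrow> 'a set \<Rightarrow> bool"
  where "is_basis K M B V \<longleftrightarrow>
    B \<subseteq> carrier M \<and> lin_independent K M B \<and> lin_span K M B = V"

text \<open>A relation rather than a function, so that no value is attached to an
  infinite-dimensional space.\<close>

definition has_dim :: "('k, 'm) ring_scheme \<Rightarrow> ('k, 'a, 'n) module_scheme \<Rightarrow> 'a set \<Rightarrow> nat \<Rightarrow> bool"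
  where "has_dim K M V d \<longleftrightarrow> (\<exists>B. finite B \<and> card B = d \<and> is_basis K M B V)"

text \<open>The library locale \<^locale>\<open>algebra\<close> is restricted to commutative algebras.\<close>

locale assoc_algebra = module K A + field K + ring A
  for K :: "('k, 'm) ring_scheme" (structure)
  and A :: "('k, 'a, 'n) module_scheme" (structure) +
  assumes smult_mult_left:
    "\<lbrakk>c \<in> carrier K; x \<in> carrier A; y \<in> carrier A\<rbrakk>
      \<Longrightarrow> (c \<odot>\<^bsub>A\<^esub> x) \<otimes>\<^bsub>A\<^esub> y = c \<odot>\<^bsub>A\<^esub> (x \<otimes>\<^bsub>A\<^esub> y)"
  and smult_mult_right:
    "\<lbrakk>c \<in> carrier K; x \<in> carrier A; y \<in> carrier A\<rbrakk>
      \<Longrightarrow> x \<otimes>\<^bsub>A\<^esub> (c \<odot>\<^bsub>A\<^esub> y) = c \<odot>\<^bsub>A\<^esub> (x \<otimes>\<^bsub>A\<^esub> y)"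

locale graded_algebra = assoc_algebra K A
  for K :: "('k, 'm) ring_scheme" (structure)
  and A :: "('k, 'a, 'n) module_scheme" (structure)
  and G :: "nat \<Rightarrow> 'a set" +
  assumes grade_subspace: "submodule (G i) K A"
  and one_grade: "\<one>\<^bsub>A\<^esub> \<in> G 0"
  and mult_grade: "\<lbrakk>x \<in> G i; y \<in> G j\<rbrakk> \<Longrightarrow> x \<otimes>\<^bsub>A\<^esub> y \<in> G (i + j)"
  and direct_sum: "x \<in> carrier A \<Longrightarrow>
    \<exists>!h. (\<forall>i. h i \<in> G i) \<and> finite {i. h i \<noteq> \<zero>\<^bsub>A\<^esub>} \<and>
         x = (\<Oplus>\<^bsub>A\<^esub>i\<in>{i. h i \<noteq> \<zero>\<^bsub>A\<^esub>}. h i)"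

text \<open>The degree zero part is a copy of the ground field.\<close>

definition connected_grading ::
    "('k, 'm) ring_scheme \<Rightarrow> ('k, 'a, 'n) module_scheme \<Rightarrow> (nat \<Rightarrow> 'a set) \<Rightarrow> bool"
  where "connected_grading K A G \<longleftrightarrow> bij_betw (\<lambda>c. c \<odot>\<^bsub>A\<^esub> \<one>\<^bsub>A\<^esub>) (carrier K) (G 0)"

text \<open>A pairing of two finite-dimensional spaces, with values in a line, is a perfect duality
  iff both of its kernels vanish; finite-dimensionality is part of perfectness.\<close>

definition perfect_pairing ::
    "('k, 'm) ring_scheme \<Rightarrow> ('k, 'a, 'n) module_scheme \<Rightarrow> 'a set \<Rightarrow> 'a set \<Rightarrow> bool"
  where "perfect_pairing K A V W \<longleftrightarrow>
    (\<exists>d. has_dim K A V d) \<and> (\<exists>d. has_dim K A W d) \<and>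
    (\<forall>x\<in>V. (\<forall>y\<in>W. x \<otimes>\<^bsub>A\<^esub> y = \<zero>\<^bsub>A\<^esub>) \<longrightarrow> x = \<zero>\<^bsub>A\<^esub>) \<and>
    (\<forall>y\<in>W. (\<forall>x\<in>V. x \<otimes>\<^bsub>A\<^esub> y = \<zero>\<^bsub>A\<^esub>) \<longrightarrow> y = \<zero>\<^bsub>A\<^esub>)"

text \<open>For \<open>j > d\<close> the spaces \<open>A\<^sub>j\<close> and \<open>A\<^sub>d\<^sub>-\<^sub>j\<close> are both zero, so only \<open>j \<le> d\<close> matters for
  the duality.\<close>

definition frobenius_algebra ::
    "('k, 'm) ring_scheme \<Rightarrow> ('k, 'a, 'n) module_scheme \<Rightarrow> (nat \<Rightarrow> 'a set) \<Rightarrow> nat \<Rightarrow> bool"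
  where "frobenius_algebra K A G d \<longleftrightarrow>
    graded_algebra K A G \<and>
    has_dim K A (G d) 1 \<and> (\<forall>i>d. G i = {\<zero>\<^bsub>A\<^esub>}) \<and>
    (\<forall>j\<le>d. perfect_pairing K A (G j) (G (d - j)))"

definition quantum_grassmann_algebra ::
    "('k, 'm) ring_scheme \<Rightarrow> ('k, 'a, 'n) module_scheme \<Rightarrow> (nat \<Rightarrow> 'a set) \<Rightarrow> nat \<Rightarrow> bool"
  where "quantum_grassmann_algebra K A G d \<longleftrightarrow>
    frobenius_algebra K A G d \<and> (\<forall>i\<in>{1..d}. has_dim K A (G i) (d choose i))"

text \<open>The free left module of rank \<open>b\<close>, and the left linear map from rank \<open>m\<close> to rank \<open>n\<close>
  given by right multiplication of row vectors by a matrix.\<close>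

definition free_left_module :: "('a, 'n) ring_scheme \<Rightarrow> nat \<Rightarrow> (nat \<Rightarrow> 'a) set"
  where "free_left_module A b = {..<b} \<rightarrow>\<^sub>E carrier A"

definition row_times_matrix ::
    "('a, 'n) ring_scheme \<Rightarrow> nat \<Rightarrow> nat \<Rightarrow> (nat \<Rightarrow> nat \<Rightarrow> 'a) \<Rightarrow> (nat \<Rightarrow> 'a) \<Rightarrow> (nat \<Rightarrow> 'a)"
  where "row_times_matrix A m n D v = (\<lambda>s\<in>{..<n}. \<Oplus>\<^bsub>A\<^esub>r\<in>{..<m}. v r \<otimes>\<^bsub>A\<^esub> D r s)"

definition augmentation_ideal ::
    "('k, 'm) ring_scheme \<Rightarrow> ('k, 'a, 'n) module_scheme \<Rightarrow> (nat \<Rightarrow> 'a set) \<Rightarrow> 'a set"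
  where "augmentation_ideal K A G = lin_span K A (\<Union>i\<in>{1..}. G i)"

text \<open>A connected graded algebra \<open>A\<close> is Koszul if its trivial module \<open>k = A/A\<^sub>+\<close> has a linear
  free resolution, i.e. an exact sequence of graded left modules
    \<open>\<dots> \<rightarrow> A(-2)\<^bsup>b 2\<^esup> \<rightarrow> A(-1)\<^bsup>b 1\<^esup> \<rightarrow> A \<rightarrow> k \<rightarrow> 0\<close>.
  The degree-preserving maps \<open>A(-i-1)\<^bsup>m\<^esup> \<rightarrow> A(-i)\<^bsup>n\<^esup>\<close> are exactly the right
  multiplications by \<open>m \<times> n\<close> matrices \<open>D i\<close> with entries in \<open>A\<^sub>1\<close>, and the kernel of
  \<open>A \<rightarrow> k\<close> is \<open>A\<^sub>+\<close>. Finite ranks are no restriction for algebras generated by finitely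
  many elements of degree one.\<close>

definition koszul ::
    "('k, 'm) ring_scheme \<Rightarrow> ('k, 'a, 'n) module_scheme \<Rightarrow> (nat \<Rightarrow> 'a set) \<Rightarrow> bool"
  where "koszul K A G \<longleftrightarrow>
    graded_algebra K A G \<and> connected_grading K A G \<and>
    (\<exists>(b :: nat \<Rightarrow> nat) D.
      b 0 = 1 \<and>
      (\<forall>i. \<forall>r<b (Suc i). \<forall>s<b i. D i r s \<in> G 1) \<and>
      row_times_matrix A (b 1) (b 0) (D 0) ` free_left_module A (b 1)
        = {v \<in> free_left_module A (b 0). v 0 \<in> augmentation_ideal K A G} \<and>
      (\<forall>i. row_times_matrix A (b (i + 2)) (b (i + 1)) (D (i + 1)) ` free_left_module A (b (i + 2))
        = {v \<in> free_left_module A (b (i + 1)).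
            row_times_matrix A (b (i + 1)) (b i) (D i) v = (\<lambda>s\<in>{..<b i}. \<zero>\<^bsub>A\<^esub>)}))"

text \<open>Lists under concatenation are the free monoid; with this instance, the convolution
  product makes \<open>'x list \<Rightarrow>\<^sub>0 'k\<close> the free associative unital algebra on \<open>'x\<close>.\<close>

instantiation list :: (type) monoid_add
begin
definition zero_list :: "'a list" where "zero_list = []"
definition plus_list :: "'a list \<Rightarrow> 'a list \<Rightarrow> 'a list" where "plus_list u v = u @ v"
instance by standard (simp_all add: zero_list_def plus_list_def)
end

type_synonym ('x, 'k) free_algebra = "'x list \<Rightarrow>\<^sub>0 'k"

abbreviation free_ring :: "('x, 'k::field) free_algebra ring"
  where "free_ring \<equiv> ring_of_type_algebra"

abbreviation ground_field :: "'k::field ring"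
  where "ground_field \<equiv> ring_of_type_algebra"

abbreviation word_monomial :: "'x list \<Rightarrow> ('x, 'k::field) free_algebra"
  where "word_monomial u \<equiv> Poly_Mapping.single u 1"

definition relation_ideal :: "('x, 'k::field) free_algebra set \<Rightarrow> ('x, 'k) free_algebra set"
  where "relation_ideal R = Idl\<^bsub>free_ring\<^esub> R"

definition residue_class ::
    "('x, 'k::field) free_algebra set \<Rightarrow> ('x, 'k) free_algebra \<Rightarrow> ('x, 'k) free_algebra set"
  where "residue_class R f = relation_ideal R +>\<^bsub>free_ring\<^esub> f"

text \<open>The quotient ring by the ideal generated by \<open>R\<close>, with \<open>c \<odot> [f] = [c f]\<close>.\<close>

definition presented_algebra ::
    "('x, 'k::field) free_algebra set \<Rightarrow> ('k, ('x, 'k) free_algebra set) module"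
  where "presented_algebra R = ring.extend (free_ring Quot relation_ideal R)
    (module.fields (\<lambda>c C. \<Union>f\<in>C. residue_class R (Poly_Mapping.single [] c * f)))"

definition length_grading ::
    "('x, 'k::field) free_algebra set \<Rightarrow> nat \<Rightarrow> ('x, 'k) free_algebra set set"
  where "length_grading R m = residue_class R ` {f. \<forall>u\<in>Poly_Mapping.keys f. length u = m}"

definition deglex_less :: "'x::linorder list \<Rightarrow> 'x list \<Rightarrow> bool"
  where "deglex_less u v \<longleftrightarrow> (u, v) \<in> lenlex {(x, y). x < y}"

text \<open>Meaningful for nonzero \<open>f\<close> only.\<close>

definition lead_word :: "('x::linorder, 'k::field) free_algebra \<Rightarrow> 'x list"
  where "lead_word f = (THE u. u \<in> Poly_Mapping.keys f \<and>
    (\<forall>v\<in>Poly_Mapping.keys f. v \<noteq> u \<longrightarrow> deglex_less v u))"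

text \<open>Here \<^const>\<open>sublist\<close> is the contiguous subword relation, i.e. divisibility in the free
  monoid.\<close>

definition groebner_basis ::
    "('x::linorder, 'k::field) free_algebra set \<Rightarrow> ('x, 'k) free_algebra set \<Rightarrow> bool"
  where "groebner_basis R I \<longleftrightarrow> R \<subseteq> I \<and>
    (\<forall>f\<in>I. f \<noteq> 0 \<longrightarrow> (\<exists>g\<in>R. g \<noteq> 0 \<and> sublist (lead_word g) (lead_word f)))"

text \<open>The relation attached to \<open>i < j\<close> is \<open>x\<^sub>j x\<^sub>i - c\<^sub>i\<^sub>j x\<^sub>i\<^sub>' x\<^sub>j\<^sub>'\<close> with \<open>i' = p i j\<close> and
  \<open>j' = q i j\<close>. Different pairs give different words \<open>x\<^sub>j x\<^sub>i\<close>, none of which equals a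
  word \<open>x\<^sub>i\<^sub>' x\<^sub>j\<^sub>'\<close> with \<open>i' \<le> j'\<close>, so these are exactly \<open>n choose 2\<close> relations.\<close>

definition skew_polynomial_type :: "('x::{finite,linorder}, 'k::field) free_algebra set \<Rightarrow> bool"
  where "skew_polynomial_type R \<longleftrightarrow> (\<exists>c p q.
    R = {word_monomial [j, i] - Poly_Mapping.single [p i j, q i j] (c i j) | i j. i < j} \<and>
    (\<forall>i j. i < j \<longrightarrow> c i j \<noteq> 0) \<and>
    (\<forall>i j. i < j \<longrightarrow> p i j < j \<and> p i j \<le> q i j) \<and>
    (\<forall>i j. i < j \<longrightarrow> (\<exists>k l. k < l \<and> p k l = i \<and> q k l = j)))"

text \<open>The words \<open>x\<^sub>1\<^bsup>\<epsilon> 1\<^esup> \<dots> x\<^sub>n\<^bsup>\<epsilon> n\<^esup>\<close> with all exponents at most one.\<close>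

definition grassmann_words :: "'x::{finite,linorder} list set"
  where "grassmann_words =
    {concat (map (\<lambda>x. replicate (\<epsilon> x) x) (sorted_list_of_set UNIV)) | \<epsilon> :: 'x \<Rightarrow> nat. \<forall>x. \<epsilon> x \<le> 1}"

end

theory Submission
  imports Defs "HOL-Library.Multiset"
begin

text \<open>Call a word a descent or an ascent if it consists of two letters in decreasing or increasing
order. Each relation of skew-polynomial type matches a descent \<open>y x\<close> with an ascent \<open>a b\<close>, \<open>a <
y\<close>, up to a nonzero scalar. As every ascent occurs on a right-hand side, a count makes this
matching a bijection. It thus defines an involution \<open>r\<close> on pairs of letters that exchanges
descents and ascents and fixes the squares \<open>x x\<close>. Modulo the ideal of the relations two words
are proportional if they are joined by swaps, that is by applications of \<open>r\<close> to adjacent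
letters, and the Groebner property says that each swap class contains exactly one sorted word,
its normal form. In the dual algebra a word vanishes as soon as its class contains a word with
two equal adjacent letters; the other words are called square-free. Hence all of the theorem
except Koszulness comes down to two facts about \<open>r\<close>: a word is square-free exactly when its
normal form has no repeated letter (\<open>squarefree_iff_distinct_nf\<close>), and swap classes admit
cancellation on both sides (\<open>left_cancel\<close>, \<open>right_cancel\<close>).

These facts rest on a braid structure of \<open>r\<close>. Write \<open>L y x\<close> for the first and \<open>R x y\<close> for the
second letter of \<open>r (y, x)\<close>. A count modulo two over words of length three shows that the class
of a strictly ascending word of length three contains no square. With this, an induction on
letters from the top gives the cyclic condition \<open>R a (L a b) = b\<close> (\<open>cyclic_condition\<close>). It makes
each \<open>L y\<close> a permutation and lets a suitable power of a letter pass through any letter, from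
which the braid relation \<open>L y (L x c) = L a (L b c)\<close> for \<open>r (y, x) = (a, b)\<close> follows
(\<open>left_action_braided\<close>). Therefore the multiset \<open>T\<close> with \<open>T (x w) = {x} + L x (T w)\<close> is an
invariant of swap classes. By counting it is a complete invariant with all multisets as values,
a class is square-free exactly when its multiset is a set, and cancellation from the left holds
since \<open>L x\<close> is injective. Reversal of words gives the versions on the right.

The strictly ascending words are thus a basis of the dual algebra, and sending a word to the
scalar multiple of its normal form, or to zero if it is not square-free, is reduction modulo the
dual ideal (\<open>dual_ideal_iff\<close>). For the Frobenius property, a square-free word shorter than the
number \<open>n\<close> of letters can be extended by a letter on either side, and cancellation prevents
different basis words from being sent to the same word; hence a nonzero homogeneous element can
be multiplied up to a nonzero element of degree \<open>n\<close>.

Koszulness is shown by a resolution whose term in position \<open>i\<close> is free on the nonincreasing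
words of length \<open>i\<close>. A basis of this term over the field consists of the words \<open>u c\<close> with \<open>u\<close>
strictly ascending and \<open>c\<close> nonincreasing of length \<open>i\<close>. The differential moves the first letter
of \<open>c\<close> to \<open>u\<close>, up to smaller words. Each nonempty word of the form \<open>u c\<close> belongs, according to
the order of the last letter of \<open>u\<close> and the first letter of \<open>c\<close>, to exactly one of two kinds:
one is the leading word of an image, the other one has a nonzero leading term under the
differential. So the differentials can be constructed, and exactness proved, by induction on
leading words (\<open>triangular_preimage\<close>, \<open>next_matrix\<close>, \<open>linear_resolution\<close>).\<close>

abbreviation keys :: "('a \<Rightarrow>\<^sub>0 'b::zero) \<Rightarrow> 'a set"
  where "keys \<equiv> Poly_Mapping.keys"

abbreviation lookup :: "('a \<Rightarrow>\<^sub>0 'b::zero) \<Rightarrow> 'a \<Rightarrow> 'b"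
  where "lookup \<equiv> Poly_Mapping.lookup"

abbreviation single :: "'a \<Rightarrow> 'b::zero \<Rightarrow> 'a \<Rightarrow>\<^sub>0 'b"
  where "single \<equiv> Poly_Mapping.single"

section \<open>Swaps of adjacent letters\<close>

definition swap_step :: "('x \<times> 'x \<Rightarrow> 'x \<times> 'x) \<Rightarrow> 'x list \<Rightarrow> 'x list \<Rightarrow> bool"
  where "swap_step r u v \<longleftrightarrow>
    (\<exists>p x y q. u = p @ x # y # q \<and> v = p @ fst (r (x, y)) # snd (r (x, y)) # q)"

abbreviation swap_equiv :: "('x \<times> 'x \<Rightarrow> 'x \<times> 'x) \<Rightarrow> 'x list \<Rightarrow> 'x list \<Rightarrow> bool"
  where "swap_equiv r \<equiv> (swap_step r)\<^sup>*\<^sup>*"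

lemma swap_equiv_swap:
  "swap_equiv r (p @ x # y # q) (p @ fst (r (x, y)) # snd (r (x, y)) # q)"
  unfolding swap_step_def by (rule r_into_rtranclp) blast

lemma swap_equiv_context:
  assumes "swap_equiv r u v" shows "swap_equiv r (p @ u @ q) (p @ v @ q)"
  using assms
proof (induction rule: rtranclp_induct)
  case (step v w)
  then obtain p' x y q' where "v = p' @ x # y # q'" "w = p' @ fst (r (x, y)) # snd (r (x, y)) # q'"
    unfolding swap_step_def by blast
  then have "swap_step r (p @ v @ q) (p @ w @ q)"
    unfolding swap_step_def by (intro exI[of _ "p @ p'"] exI[of _ x] exI[of _ y] exI[of _ "q' @ q"]) simp
  with step.IH show ?case by simp
qed simp

lemma swap_equiv_Cons: "swap_equiv r u v \<Longrightarrow> swap_equiv r (x # u) (x # v)"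
  using swap_equiv_context[of r u v "[x]" "[]"] by simp

lemma swap_equiv_append: "swap_equiv r u v \<Longrightarrow> swap_equiv r (u @ q) (v @ q)"
  using swap_equiv_context[of r u v "[]" q] by simp

lemma swap_equiv_prepend: "swap_equiv r u v \<Longrightarrow> swap_equiv r (p @ u) (p @ v)"
  using swap_equiv_context[of r u v p "[]"] by simp

lemma swap_equiv_length: "swap_equiv r u v \<Longrightarrow> length v = length u"
  by (induction rule: rtranclp_induct) (auto simp: swap_step_def)

lemma swap_equiv_head: "swap_equiv r (x # y # q) (fst (r (x, y)) # snd (r (x, y)) # q)"
  using swap_equiv_swap[of r "[]"] by simp

text \<open>Letters are compared through a rank function \<open>f\<close>, so that the order can be turned around by
negating it.\<close>

lemma not_sorted_descent:
  assumes "\<not> sorted (map f w)"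
  shows "\<exists>p a b q. w = p @ a # b # q \<and> f b < (f a :: int)"
  using assms
proof (induction w)
  case (Cons x w)
  show ?case
  proof (cases "sorted (map f w)")
    case False
    then obtain p a b q where "w = p @ a # b # q \<and> f b < f a" using Cons.IH by blast
    then show ?thesis by (intro exI[of _ "x # p"]) auto
  next
    case True
    with Cons.prems obtain z where z: "z \<in> set w" "f z < f x" by auto
    then obtain b q where w: "w = b # q" by (cases w) auto
    with True z have "f b < f x" by auto
    with w show ?thesis by (intro exI[of _ "[]"]) auto
  qed
qed simp

lemma sorted_repeat_adjacent:
  assumes "sorted (map f w)" "\<not> distinct w" "inj (f :: _ \<Rightarrow> int)"
  shows "\<exists>p a q. w = p @ a # a # q"
  using assms
proof (induction w)
  case (Cons x w)
  show ?case
  proof (cases "distinct w")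
    case False
    with Cons obtain p a q where "w = p @ a # a # q" by auto
    then show ?thesis by (intro exI[of _ "x # p"]) auto
  next
    case True
    with Cons.prems have x: "x \<in> set w" by auto
    then obtain b q where w: "w = b # q" by (cases w) auto
    with Cons.prems x have "f b \<le> f x" "f x \<le> f b" by (auto split: if_splits)
    then have "f b = f x" by simp
    with Cons.prems(3) have "b = x" by (simp add: inj_eq)
    with w show ?thesis by (intro exI[of _ "[]"]) auto
  qed
qed simp

lemma lenlex_first_difference:
  "(a, b) \<in> R \<Longrightarrow> length u = length v \<Longrightarrow> (p @ a # u, p @ b # v) \<in> lenlex R"
  unfolding lenlex_conv lex_conv by fastforce

text \<open>The orbits of a fixed-point free involution are pairs.\<close>

lemma even_card_free_involution:
  assumes "finite A" "\<And>x. x \<in> A \<Longrightarrow> f x \<in> A" "\<And>x. x \<in> A \<Longrightarrow> f (f x) = x" "\<And>x. x \<in> A \<Longrightarrow> f x \<noteq> x"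
  shows "even (card A)"
  using assms
proof (induction A rule: finite_psubset_induct)
  case (psubset A)
  show ?case
  proof (cases "A = {}")
    case False
    then obtain x where x: "x \<in> A" by auto
    let ?B = "A - {x, f x}"
    have "even (card ?B)"
    proof (rule psubset.IH)
      show "?B \<subset> A" using x by auto
      fix y assume y: "y \<in> ?B"
      then show "f (f y) = y" "f y \<noteq> y" using psubset.prems by auto
      have "f y \<noteq> x" "f y \<noteq> f x" using y x psubset.prems(2) by auto metis+
      then show "f y \<in> ?B" using y psubset.prems by auto
    qed
    moreover have "card A = card ?B + 2"
    proof -
      have "card {x, f x} = 2" using psubset.prems(3)[OF x] by auto
      moreover have "{x, f x} \<subseteq> A" using x psubset.prems(1) by auto
      ultimately show ?thesis
        using card_Diff_subset[of "{x, f x}" A] card_mono[of A "{x, f x}"] psubset.hyps by auto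
    qed
    ultimately show ?thesis by simp
  qed simp
qed

text \<open>An injective self-map of a finite set has no preperiodic points that are not periodic.\<close>

lemma periodic_point:
  assumes "finite A" "f ` A \<subseteq> A" "inj_on f A" "x \<in> A"
  shows "\<exists>N>0. (f ^^ N) x = x"
proof -
  have inA: "(f ^^ k) x \<in> A" for k by (induction k) (use assms in auto)
  have "\<not> inj (\<lambda>k. (f ^^ k) x)"
  proof
    assume "inj (\<lambda>k. (f ^^ k) x)"
    moreover have "finite (range (\<lambda>k. (f ^^ k) x))"
      by (rule finite_subset[OF _ assms(1)]) (use inA in auto)
    ultimately show False using finite_imageD infinite_UNIV_nat by blast
  qed
  then obtain i j where "i < j" "(f ^^ i) x = (f ^^ j) x"
    unfolding inj_def by (metis linorder_neqE_nat)
  then obtain N where N: "N > 0" "(f ^^ i) x = (f ^^ (i + N)) x"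
    by (metis less_imp_add_positive)
  have "(f ^^ (i + N)) x = (f ^^ i) x \<Longrightarrow> (f ^^ N) x = x"
  proof (induction i)
    case (Suc i)
    then have "f ((f ^^ (i + N)) x) = f ((f ^^ i) x)" by simp
    then have "(f ^^ (i + N)) x = (f ^^ i) x" using assms(3) inA by (meson inj_onD)
    then show ?case by (rule Suc.IH)
  qed simp
  with N show ?thesis by metis
qed

text \<open>The product of the individual periods is a common period.\<close>

lemma common_period:
  assumes "finite Z" "\<And>f x. (f, x) \<in> Z \<Longrightarrow> \<exists>N>0. (f ^^ N) x = x"
  shows "\<exists>N>0. \<forall>(f, x) \<in> Z. (f ^^ N) x = x"
proof -
  have "\<forall>z\<in>Z. \<exists>N. N > 0 \<and> (fst z ^^ N) (snd z) = snd z"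
    using assms(2) by auto
  then obtain P where P: "\<And>z. z \<in> Z \<Longrightarrow> P z > 0 \<and> (fst z ^^ P z) (snd z) = snd z"
    using bchoice[of Z "\<lambda>z N. N > 0 \<and> (fst z ^^ N) (snd z) = snd z"] by auto
  have mult: "(f ^^ (N * k)) x = x" if "(f ^^ N) x = x" for f :: "'a \<Rightarrow> 'a" and N k x
    by (induction k) (auto simp: that funpow_add)
  have "(fst z ^^ prod P Z) (snd z) = snd z" if "z \<in> Z" for z
    using dvd_prodI[OF assms(1) that, of P] P[OF that] mult by (auto elim!: dvdE)
  moreover have "prod P Z > 0" using P assms(1) by (simp add: prod_pos)
  ultimately show ?thesis by (intro exI[of _ "prod P Z"]) auto
qed

section \<open>Ascending and nonincreasing normal forms\<close>

text \<open>The combinatorial content of relations of skew-polynomial type. The order of the letters enters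
only through the rank, and the axioms are invariant under \<open>rk \<mapsto> - rk\<close>: ascents and descents then
trade places. This duality is used throughout to get a second statement from the first one.\<close>

locale oriented_swap =
  fixes rk :: "'x::finite \<Rightarrow> int" and r :: "'x \<times> 'x \<Rightarrow> 'x \<times> 'x"
  assumes inj_rk: "inj rk"
    and swap_same: "r (x, x) = (x, x)"
    and swap_swap: "r (r z) = z"
    and swap_desc: "rk x < rk y \<Longrightarrow>
      rk (fst (r (y, x))) < rk (snd (r (y, x))) \<and> rk (fst (r (y, x))) < rk y"
    and swap_asc: "rk x < rk y \<Longrightarrow>
      rk (snd (r (x, y))) < rk (fst (r (x, y))) \<and> rk x < rk (fst (r (x, y)))"
begin

lemma rk_eq [simp]: "rk x = rk y \<longleftrightarrow> x = y"
  using inj_rk by (simp add: inj_eq)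

lemma rk_neq: "x \<noteq> y \<Longrightarrow> rk x < rk y \<or> rk y < rk x"
  using rk_eq[of x y] by linarith

lemma swap_fst_neq: "x \<noteq> y \<Longrightarrow> fst (r (x, y)) \<noteq> x"
  using rk_neq[of x y] swap_desc[of y x] swap_asc[of x y] by auto

lemma swap_equiv_sym: "swap_equiv r u v \<Longrightarrow> swap_equiv r v u"
proof (induction rule: rtranclp_induct)
  case (step v w)
  then obtain p x y q where "v = p @ x # y # q" "w = p @ fst (r (x, y)) # snd (r (x, y)) # q"
    unfolding swap_step_def by blast
  moreover have "r (fst (r (x, y)), snd (r (x, y))) = (x, y)" by (simp add: swap_swap)
  ultimately have "swap_equiv r w v" using swap_equiv_swap[of r p "fst (r (x, y))" "snd (r (x, y))" q] by simp
  with step.IH show ?case by simp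
qed simp

lemma wf_letters: "wf {(x, y). rk x < rk y}"
  by (rule finite_acyclic_wf) (auto intro!: acyclicI_order[of _ "\<lambda>x. - rk x"])

text \<open>Replacing a descent by the matching ascent makes a word smaller, and words are well-ordered.\<close>

lemma sorted_form_exists:
  "\<exists>v. swap_equiv r w v \<and> sorted (map rk v) \<and> (v = w \<or> (v, w) \<in> lenlex {(x, y). rk x < rk y})"
proof (induction w rule: wf_induct_rule[OF wf_lenlex[OF wf_letters]])
  case (1 w)
  show ?case
  proof (cases "sorted (map rk w)")
    case False
    then obtain p a b q where w: "w = p @ a # b # q" "rk b < rk a" using not_sorted_descent by blast
    let ?w = "p @ fst (r (a, b)) # snd (r (a, b)) # q"
    have less: "(?w, w) \<in> lenlex {(x, y). rk x < rk y}"
      unfolding w by (rule lenlex_first_difference) (use swap_desc[OF w(2)] in auto)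
    have eq: "swap_equiv r w ?w" unfolding w by (rule swap_equiv_swap)
    from 1[OF less] obtain v where v: "swap_equiv r ?w v" "sorted (map rk v)"
      "v = ?w \<or> (v, ?w) \<in> lenlex {(x, y). rk x < rk y}" by blast
    have "trans (lenlex {(x, y). rk x < rk y})" by (rule lenlex_transI) (auto intro: transI)
    with v(3) less have "(v, w) \<in> lenlex {(x, y). rk x < rk y}" by (auto dest: transD)
    with eq v show ?thesis by (metis rtranclp_trans)
  qed auto
qed

lemma dual_oriented: "oriented_swap (\<lambda>x. - rk x) r"
  by unfold_locales
    (use inj_rk swap_same swap_swap swap_desc swap_asc in \<open>auto simp: inj_def\<close>)

end

text \<open>Uniqueness of sorted words in a class is what the Groebner property contributes.\<close>

locale normal_swap = oriented_swap +
  assumes sorted_unique: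
    "swap_equiv r u v \<Longrightarrow> sorted (map rk u) \<Longrightarrow> sorted (map rk v) \<Longrightarrow> u = v"
begin

definition nf :: "'a list \<Rightarrow> 'a list"
  where "nf w = (THE v. swap_equiv r w v \<and> sorted (map rk v))"

lemma nf_props: "swap_equiv r w (nf w)" "sorted (map rk (nf w))"
proof -
  have "\<exists>!v. swap_equiv r w v \<and> sorted (map rk v)"
    using sorted_form_exists[of w] sorted_unique by (metis rtranclp_trans swap_equiv_sym)
  then have "swap_equiv r w (nf w) \<and> sorted (map rk (nf w))" unfolding nf_def by (rule theI')
  then show "swap_equiv r w (nf w)" "sorted (map rk (nf w))" by auto
qed

lemma nf_eqI: "swap_equiv r w v \<Longrightarrow> sorted (map rk v) \<Longrightarrow> nf w = v"
  using nf_props[of w] sorted_unique by (metis rtranclp_trans swap_equiv_sym)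

lemma nf_eq_iff: "nf u = nf v \<longleftrightarrow> swap_equiv r u v"
  by (metis nf_eqI nf_props rtranclp_trans swap_equiv_sym)

lemma nf_sorted: "sorted (map rk w) \<Longrightarrow> nf w = w"
  by (rule nf_eqI) auto

lemma length_nf [simp]: "length (nf w) = length w"
  using swap_equiv_length nf_props(1) by blast

lemma nf_le: "nf w = w \<or> (nf w, w) \<in> lenlex {(x, y). rk x < rk y}"
  using sorted_form_exists[of w] nf_eqI by blast

lemma finite_words: "finite {w :: 'a list. length w = d \<and> P w}"
  by (rule finite_subset[OF _ finite_lists_length_eq[of UNIV d]]) auto

text \<open>By the dual of \<open>sorted_form_exists\<close> each class contains a nonincreasing word, so taking normal
forms maps the nonincreasing words of a given length onto the sorted ones. Reversal shows that
there are equally many of both, hence the map is injective.\<close>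

lemma nonincreasing_unique:
  assumes "swap_equiv r u v" "sorted (map (\<lambda>x. - rk x) u)" "sorted (map (\<lambda>x. - rk x) v)"
  shows "u = v"
proof -
  interpret dual: oriented_swap "\<lambda>x. - rk x" r by (rule dual_oriented)
  let ?S = "{w. length w = length u \<and> sorted (map rk w)}"
  let ?B = "{w. length w = length u \<and> sorted (map (\<lambda>x. - rk x) w)}"
  have B: "?B = rev ` ?S"
  proof -
    have rev: "sorted (map (\<lambda>x. - rk x) w) \<longleftrightarrow> sorted (map rk (rev w))" for w
      by (simp add: sorted_map sorted_wrt_rev del: map_map)
    show ?thesis
    proof (rule equalityI; rule subsetI)
      fix w assume "w \<in> ?B"
      then show "w \<in> rev ` ?S" by (intro image_eqI[of _ _ "rev w"]) (auto simp: rev)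
    qed (auto simp: rev)
  qed
  have "nf ` ?B = ?S"
  proof (rule equalityI; rule subsetI)
    fix w assume w: "w \<in> ?S"
    obtain v where v: "swap_equiv r w v" "sorted (map (\<lambda>x. - rk x) v)"
      using dual.sorted_form_exists[of w] by blast
    then have "nf v = w" using w by (intro nf_eqI) (auto intro: swap_equiv_sym)
    then show "w \<in> nf ` ?B" using v w swap_equiv_length[OF v(1)] by force
  qed (auto simp: nf_props)
  then have "card (nf ` ?B) = card ?B" unfolding B by (simp add: card_image)
  then have "inj_on nf ?B" using finite_words by (intro eq_card_imp_inj_on) auto
  moreover have "nf u = nf v" using assms(1) by (simp add: nf_eq_iff)
  ultimately show ?thesis using assms swap_equiv_length[OF assms(1)] by (auto dest: inj_onD)
qed

text \<open>All that holds for the given order of the letters also holds for the opposite order.\<close>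

lemma dual_normal: "normal_swap (\<lambda>x. - rk x) r"
  using dual_oriented nonincreasing_unique by (simp add: normal_swap_def normal_swap_axioms_def)

text \<open>The nonincreasing word is the normal form for the opposite order and so is the smallest of its
class with respect to that order.\<close>

lemma nonincreasing_head_le:
  assumes "swap_equiv r (x # w) (y # v)" "sorted (map (\<lambda>x. - rk x) (y # v))"
  shows "rk x \<le> rk y"
proof -
  interpret dual: normal_swap "\<lambda>x. - rk x" r by (rule dual_normal)
  have nf: "dual.nf (x # w) = y # v" by (rule dual.nf_eqI[OF assms])
  then have "length w = length v" using dual.length_nf[of "x # w"] by simp
  with nf dual.nf_le[of "x # w"] show ?thesis
    by (auto simp: lenlex_conv)
qed

section \<open>Parity of classes of words of length three\<close>

text \<open>Swapping the first two letters is an involution on a class whose fixed points are the words \<open>x x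
z\<close>; swapping the last two has the fixed points \<open>x z z\<close>. So in each class the total number \<open>m\<close> of
both kinds of fixed points (with \<open>x x x\<close> counted twice) is even. Over all classes \<open>m\<close> adds up to
\<open>2 n\<close>, where \<open>n\<close> is the number of pairs of letters. There are \<open>n\<close> classes whose sorted word
contains a square, each with \<open>m \<ge> 1\<close> and therefore \<open>m \<ge> 2\<close>. They use up the total, and nothing
is left for the class of a strictly ascending word.\<close>

lemma ascending_triple_class_squarefree:
  assumes lt: "rk a < rk b" "rk b < rk c" and eq: "swap_equiv r w [a, b, c]"
  shows "w \<noteq> [x, x, y]" "w \<noteq> [x, y, y]"
proof -
  let ?T = "{w :: 'a list. length w = 3 \<and> True}"
  let ?S = "{w :: 'a list. length w = 3 \<and> sorted (map rk w)}"
  define n where "n = card (UNIV :: ('a \<times> 'a) set)"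
  define Sq_left where "Sq_left = range (\<lambda>(x, z :: 'a). [x, x, z])"
  define Sq_right where "Sq_right = range (\<lambda>(x :: 'a, z). [x, z, z])"
  define C where "C v = {w \<in> ?T. nf w = v}" for v
  define m where "m v = card (C v \<inter> Sq_left) + card (C v \<inter> Sq_right)" for v
  have fin: "finite ?T" "finite ?S" by (rule finite_words)+
  have three: "\<exists>x y z. w = [x, y, z]" if "length w = 3" for w :: "'a list"
    using that by (auto simp: numeral_eq_Suc length_Suc_conv)
  have ne: "fst (r (x, y)) \<noteq> x" "fst (r (x, y)) \<noteq> snd (r (x, y))" if "x \<noteq> y" for x y
    using rk_neq[OF that] swap_desc[of y x] swap_asc[of x y] by auto
  have even_part: "even (card (C v - F))"
    if f: "\<And>x y z. [x, y, z] \<notin> F \<Longrightarrow> f [x, y, z] \<in> ?T - F \<and> swap_equiv r [x, y, z] (f [x, y, z]) \<and>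
      f (f [x, y, z]) = [x, y, z] \<and> f [x, y, z] \<noteq> [x, y, z]" for F f v
  proof -
    have "f w \<in> C v - F \<and> f (f w) = w \<and> f w \<noteq> w" if w: "w \<in> C v - F" for w
    proof -
      obtain x y z where xyz: "w = [x, y, z]" using three w unfolding C_def by blast
      have "nf (f w) = nf w" using f[of x y z] w by (simp add: xyz nf_eq_iff swap_equiv_sym)
      then show ?thesis using f[of x y z] w by (simp add: C_def xyz)
    qed
    moreover have "finite (C v - F)" unfolding C_def using fin by auto
    ultimately show ?thesis by (intro even_card_free_involution[of _ f]) blast+
  qed
  have mem: "[x, y, z] \<in> Sq_left \<longleftrightarrow> x = y" "[x, y, z] \<in> Sq_right \<longleftrightarrow> y = z" for x y z
    by (auto simp: Sq_left_def Sq_right_def)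
  have "even (card (C v - Sq_left))" for v
    using swap_equiv_head
    by (intro even_part[where f = "\<lambda>w. [fst (r (w ! 0, w ! 1)), snd (r (w ! 0, w ! 1)), w ! 2]"])
      (auto simp: mem ne ne(2)[symmetric] swap_swap)
  moreover have "even (card (C v - Sq_right))" for v
    using swap_equiv_Cons[OF swap_equiv_head]
    by (intro even_part[where f = "\<lambda>w. [w ! 0, fst (r (w ! 1, w ! 2)), snd (r (w ! 1, w ! 2))]"])
      (auto simp: mem ne ne(2)[symmetric] swap_swap)
  moreover have "card (C v) = card (C v \<inter> F) + card (C v - F)" for v F
    using fin unfolding C_def by (simp add: card_Int_Diff)
  ultimately have even: "even (m v)" for v unfolding m_def
    by (metis even_add)
  have cardF: "card Sq_left = n" "card Sq_right = n" unfolding Sq_left_def Sq_right_def n_def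
    by (rule card_image, force simp: inj_on_def)+
  have fib: "(\<Sum>v\<in>?S. card (C v \<inter> F)) = card F" if F: "F \<subseteq> ?T" for F
  proof -
    have "(\<Sum>v\<in>?S. \<Sum>w\<in>{w \<in> F. nf w = v}. 1) = (\<Sum>w\<in>F. 1 :: nat)"
      using F fin by (intro sum.group) (auto simp: nf_props intro: finite_subset)
    moreover have "{w \<in> F. nf w = v} = C v \<inter> F" for v using F unfolding C_def by auto
    ultimately show ?thesis by simp
  qed
  have FT: "Sq_left \<subseteq> ?T" "Sq_right \<subseteq> ?T" unfolding Sq_left_def Sq_right_def by auto
  have total: "sum m ?S = 2 * n"
    unfolding m_def sum.distrib using fib[OF FT(1)] fib[OF FT(2)] cardF by simp
  \<comment> \<open>The sorted words with a square, indexed by the pair of the doubled and the remaining letter.\<close>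
  define Q where "Q = range (\<lambda>(x, z :: 'a). if rk x \<le> rk z then [x, x, z] else [z, x, x])"
  have "inj (\<lambda>(x, z :: 'a). if rk x \<le> rk z then [x, x, z] else [z, x, x])"
    by (auto simp: inj_on_def split: if_splits)
  then have cardQ: "card Q = n" unfolding Q_def n_def by (rule card_image)
  have QS: "Q \<subseteq> ?S" unfolding Q_def by auto
  have QF: "v \<in> Sq_left \<or> v \<in> Sq_right" if "v \<in> Q" for v using that unfolding Q_def Sq_left_def Sq_right_def
    by (auto simp: image_iff split: if_splits)
  have "2 \<le> m v" if v: "v \<in> Q" for v
  proof -
    have "v \<in> C v" using QS v unfolding C_def by (auto simp: nf_sorted)
    then have "C v \<inter> Sq_left \<noteq> {} \<or> C v \<inter> Sq_right \<noteq> {}" using QF[OF v] by auto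
    moreover have "finite (C v)" unfolding C_def using fin by auto
    ultimately have "m v > 0" unfolding m_def by (auto simp: card_gt_0_iff)
    with even[of v] show ?thesis by presburger
  qed
  then have "2 * n \<le> sum m Q" using sum_mono[of Q "\<lambda>_. 2" m] cardQ by simp
  moreover have abc: "[a, b, c] \<in> ?S - Q" using lt unfolding Q_def by (auto split: if_splits)
  then have "sum m Q + m [a, b, c] \<le> sum m ?S"
  proof -
    have "sum m Q + m [a, b, c] = sum m (insert [a, b, c] Q)"
      using abc fin QS by (subst sum.insert) (auto intro: finite_subset)
    also have "\<dots> \<le> sum m ?S" using abc QS fin by (intro sum_mono2) auto
    finally show ?thesis .
  qed
  ultimately have zero: "m [a, b, c] = 0" using total by linarith
  have w: "length w = 3" using swap_equiv_length[OF eq] by simp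
  have "nf w = [a, b, c]" by (rule nf_eqI[OF eq]) (use lt in auto)
  then have wC: "w \<in> C [a, b, c]" using w unfolding C_def by simp
  have "finite (C v)" for v unfolding C_def using fin by auto
  with zero have "C [a, b, c] \<inter> Sq_left = {}" "C [a, b, c] \<inter> Sq_right = {}" unfolding m_def by auto
  moreover have "[x, x, y] \<in> Sq_left" "[x, y, y] \<in> Sq_right" unfolding Sq_left_def Sq_right_def by (auto simp: image_iff)
  ultimately show "w \<noteq> [x, x, y]" "w \<noteq> [x, y, y]" using wC by blast+
qed

end

section \<open>The cyclic condition and the braid relation\<close>

context normal_swap
begin

text \<open>Otherwise \<open>y x x\<close> would be joined to the strictly ascending word \<open>a b x\<close>, where \<open>r (y, x) = (a,
b)\<close>.\<close>

lemma swap_desc_le: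
  assumes "rk x < rk y" shows "rk x \<le> rk (snd (r (y, x)))"
proof (rule ccontr)
  assume "\<not> ?thesis"
  then have lt: "rk (fst (r (y, x))) < rk (snd (r (y, x)))" "rk (snd (r (y, x))) < rk x"
    using swap_desc[OF assms] by auto
  show False
    using ascending_triple_class_squarefree(2)[OF lt swap_equiv_head, of y x] by simp
qed

text \<open>The two sets below are the fibres of the second letter over descents \<open>y x\<close> with fixed \<open>y\<close>, and
of the first letter over ascents \<open>a c\<close> with fixed \<open>c\<close>. As \<open>r\<close> exchanges descents and ascents, it
puts them in bijection.\<close>

definition descents_to :: "'a \<Rightarrow> 'a \<Rightarrow> 'a set"
  where "descents_to y c = {x. rk x < rk y \<and> snd (r (y, x)) = c}"

definition ascents_to :: "'a \<Rightarrow> 'a \<Rightarrow> 'a set"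
  where "ascents_to y c = {a. rk a < rk c \<and> fst (r (a, c)) = y}"

lemma swap_back: "r (fst (r z), snd (r z)) = z"
  by (simp add: swap_swap)

lemma bij_descents_ascents: "bij_betw (\<lambda>x. fst (r (y, x))) (descents_to y c) (ascents_to y c)"
proof (rule bij_betw_byWitness[where f' = "\<lambda>a. snd (r (a, c))"])
  show "\<forall>x\<in>descents_to y c. snd (r (fst (r (y, x)), c)) = x"
    unfolding descents_to_def using swap_back by fastforce
  show "\<forall>a\<in>ascents_to y c. fst (r (y, snd (r (a, c)))) = a"
    unfolding ascents_to_def using swap_back by fastforce
  show "(\<lambda>x. fst (r (y, x))) ` descents_to y c \<subseteq> ascents_to y c"
    unfolding descents_to_def ascents_to_def using swap_desc swap_back by fastforce
  show "(\<lambda>a. snd (r (a, c))) ` ascents_to y c \<subseteq> descents_to y c"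
    unfolding descents_to_def ascents_to_def using swap_asc swap_back by fastforce
qed

text \<open>The cyclic condition for \<open>c\<close> is an inclusion of the fibres, and they have the same size. On the
common fibre \<open>z \<mapsto> fst (r (y, z))\<close> is then a permutation.\<close>

lemma fibres_eq:
  assumes "\<And>a. rk a < rk c \<Longrightarrow> snd (r (fst (r (a, c)), a)) = c"
  shows "ascents_to y c = descents_to y c"
proof (rule card_subset_eq)
  show "ascents_to y c \<subseteq> descents_to y c"
    unfolding ascents_to_def descents_to_def using assms swap_asc by auto
  show "card (ascents_to y c) = card (descents_to y c)"
    using bij_betw_same_card[OF bij_descents_ascents] by simp
qed simp

lemma fibre_period:
  assumes "ascents_to y c = descents_to y c" "x \<in> descents_to y c"
  shows "\<exists>N>0. ((\<lambda>z. fst (r (y, z))) ^^ N) x = x"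
  using bij_descents_ascents[of y c] assms
  by (intro periodic_point[of "descents_to y c"]) (auto simp: bij_betw_def)

text \<open>As long as the second letter produced by the swap stays equal to \<open>c\<close>, the letters \<open>y\<close> pass
through \<open>x\<close> one by one and all turn into \<open>c\<close>.\<close>

lemma power_passes:
  assumes "x \<in> A" "\<And>z. z \<in> A \<Longrightarrow> f z \<in> A \<and> r (y, z) = (f z, c)"
  shows "swap_equiv r (replicate k y @ [x]) ((f ^^ k) x # replicate k c)"
proof (induction k)
  case (Suc k)
  have "(f ^^ k) x \<in> A" by (induction k) (use assms in auto)
  then have "swap_equiv r (y # (f ^^ k) x # replicate k c) ((f ^^ Suc k) x # replicate (Suc k) c)"
    using swap_equiv_head[of r y "(f ^^ k) x" "replicate k c"] assms(2) by simp
  with swap_equiv_Cons[OF Suc, of y] show ?case by (auto intro: rtranclp_trans)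
qed simp

lemma fibre_passes:
  assumes "ascents_to y c = descents_to y c" "x \<in> descents_to y c"
  shows "swap_equiv r (replicate k y @ [x]) (((\<lambda>z. fst (r (y, z))) ^^ k) x # replicate k c)"
proof (rule power_passes[OF assms(2)])
  fix z assume z: "z \<in> descents_to y c"
  then have "fst (r (y, z)) \<in> descents_to y c"
    using bij_descents_ascents[of y c] assms(1) by (auto simp: bij_betw_def)
  moreover have "r (y, z) = (fst (r (y, z)), c)"
    using z unfolding descents_to_def by (simp add: prod_eq_iff)
  ultimately show "fst (r (y, z)) \<in> descents_to y c \<and> r (y, z) = (fst (r (y, z)), c)" by blast
qed

lemma replicate_rotate:
  "replicate (Suc k) x @ w = replicate k x @ x # w"
  by (simp add: replicate_app_Cons_same)

text \<open>Downward induction on the rank of \<open>b\<close>. Let \<open>r (a, b) = (y, x)\<close> and let \<open>b'\<close> be the second letter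
of \<open>r (y, a)\<close>. If \<open>b' < b\<close>, then \<open>y y x\<close> is joined to \<open>y a b\<close> and to a strictly ascending word,
against parity. If \<open>b' > b\<close>, the induction hypothesis gives powers of letters that pass through
other letters without changing them, and so two words \<open>y^(N+1) x\<close> and \<open>y t^N x\<close> of the same
class. Uniqueness of nonincreasing words leaves only \<open>t = y\<close>, which is impossible.\<close>

lemma cyclic_condition_ascent:
  "rk a < rk b \<Longrightarrow> snd (r (fst (r (a, b)), a)) = b"
proof (induction b arbitrary: a rule: measure_induct_rule[where f = "\<lambda>b. nat (Max (range rk) - rk b)"])
  case (less b a)
  have IH: "snd (r (fst (r (a, c)), a)) = c" if "rk b < rk c" "rk a < rk c" for a c
  proof (rule less.IH[OF _ that(2)])
    have "rk c \<le> Max (range rk)" by simp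
    with that(1) show "nat (Max (range rk) - rk c) < nat (Max (range rk) - rk b)" by linarith
  qed
  have DE: "ascents_to y c = descents_to y c" if "rk b < rk c" for y c
    using IH[OF that] by (rule fibres_eq)
  define y where "y = fst (r (a, b))"
  define x where "x = snd (r (a, b))"
  define b' where "b' = snd (r (y, a))"
  have yx: "rk x < rk y" "rk a < rk y" using swap_asc[OF less.prems] unfolding x_def y_def by auto
  have ryx: "r (y, x) = (a, b)" unfolding x_def y_def by (rule swap_back)
  have yxab: "swap_equiv r (y # x # q) (a # b # q)" for q
    using swap_equiv_head[of r y x q] ryx by simp
  have "b' = b"
  proof (rule ccontr)
    assume "b' \<noteq> b"
    then consider "rk b' < rk b" | "rk b < rk b'" using rk_neq by blast
    then show False
    proof cases
      \<comment> \<open>The words \<open>y y x\<close>, \<open>y a b\<close> and the strictly ascending \<open>L y a, b', b\<close> are in one class.\<close>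
      case 1
      have lt: "rk (fst (r (y, a))) < rk b'" using swap_desc[OF yx(2)] unfolding b'_def by simp
      have "swap_equiv r [y, y, x] [y, a, b]" using swap_equiv_Cons[OF yxab[of "[]"]] .
      also have "swap_equiv r [y, a, b] [fst (r (y, a)), b', b]"
        unfolding b'_def by (rule swap_equiv_head)
      finally show False
        using ascending_triple_class_squarefree(1)[OF lt 1] by blast
    next
      case 2
      \<comment> \<open>By the induction hypothesis \<open>L b\<close> permutes the letters above \<open>b\<close>, so \<open>b' = L b g\<close> for such
        a letter \<open>g\<close>.\<close>
      let ?L = "\<lambda>y z. fst (r (y, z))"
      have aE: "a \<in> descents_to y b'" using yx unfolding descents_to_def b'_def by simp
      have "?L b ` {c. rk b < rk c} \<subseteq> {c. rk b < rk c}" using swap_asc by auto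
      moreover have "inj_on (?L b) {c. rk b < rk c}"
        by (rule inj_on_inverseI[of _ "\<lambda>y. snd (r (y, b))"]) (use IH in auto)
      ultimately have "?L b ` {c. rk b < rk c} = {c. rk b < rk c}"
        by (intro endo_inj_surj) auto
      with 2 have "b' \<in> ?L b ` {c. rk b < rk c}" by simp
      then obtain g where g: "rk b < rk g" "fst (r (b, g)) = b'" by auto
      then have bE: "b \<in> descents_to b' g" using DE[OF g(1), of b'] unfolding ascents_to_def by auto
      have "rk x \<le> rk b" using swap_desc_le[OF yx(1)] ryx by simp
      then have xg: "rk x < rk g" using g by simp
      define t where "t = fst (r (x, g))"
      have "x \<in> ascents_to t g" using xg unfolding ascents_to_def t_def by simp
      then have xE: "x \<in> descents_to t g" using DE[OF g(1), of t] by simp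
      let ?Z = "{(?L y, a), (?L b', b), (?L t, x)}"
      have "\<exists>N>0. \<forall>(f, z) \<in> ?Z. (f ^^ N) z = z"
        by (rule common_period)
          (use fibre_period[OF DE aE] fibre_period[OF DE bE] fibre_period[OF DE xE] 2 g in auto)
      then obtain N where N: "N > 0" "(?L y ^^ N) a = a" "(?L b' ^^ N) b = b" "(?L t ^^ N) x = x"
        by auto
      have pass: "swap_equiv r (replicate N y @ [a]) (a # replicate N b')"
        "swap_equiv r (replicate N b' @ [b]) (b # replicate N g)"
        "swap_equiv r (replicate N t @ [x]) (x # replicate N g)"
        using fibre_passes[OF DE aE, of N] fibre_passes[OF DE bE, of N] fibre_passes[OF DE xE, of N] N 2 g
        by auto
      \<comment> \<open>In turn \<open>y^(N+1) x = y^N a b = a b'^N b = a b g^N = y x g^N = y t^N x\<close> up to swaps.\<close>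
      have "swap_equiv r (replicate (Suc N) y @ [x]) (replicate N y @ [a, b])"
        unfolding replicate_rotate using swap_equiv_prepend[OF yxab[of "[]"]] by simp
      also have "swap_equiv r (replicate N y @ [a, b]) (a # replicate N b' @ [b])"
        using swap_equiv_append[OF pass(1), of "[b]"] by simp
      also have "swap_equiv r (a # replicate N b' @ [b]) (a # b # replicate N g)"
        using swap_equiv_Cons[OF pass(2)] .
      also have "swap_equiv r (a # b # replicate N g) (y # x # replicate N g)"
        using swap_equiv_sym[OF yxab] .
      also have "swap_equiv r (y # x # replicate N g) (y # replicate N t @ [x])"
        using swap_equiv_Cons[OF swap_equiv_sym[OF pass(3)]] .
      finally have eq: "swap_equiv r (replicate (Suc N) y @ [x]) (y # replicate N t @ [x])" .
      have dec: "sorted (map (\<lambda>x. - rk x) (replicate (Suc N) y @ [x]))"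
        using yx by (auto simp: sorted_append)
      have xt: "rk x < rk t" using swap_asc[OF xg] unfolding t_def by simp
      obtain M where M: "N = Suc M" using N by (cases N) auto
      consider "t = y" | "rk t < rk y" | "rk y < rk t" using rk_neq by blast
      then show False
      proof cases
        assume "t = y"
        then show False using xE ryx g unfolding descents_to_def by simp
      next
        assume ty: "rk t < rk y"
        have "sorted (map (\<lambda>x. - rk x) (y # replicate N t @ [x]))"
          using ty xt yx by (auto simp: sorted_append)
        from nonincreasing_unique[OF eq dec this] have "replicate N y = replicate N t" by simp
        then show False using M ty by simp
      next
        \<comment> \<open>One more swap produces a word that begins with a letter above \<open>y\<close>, the first letter of
          the nonincreasing word.\<close>
        assume yt: "rk y < rk t"
        have "swap_equiv r (replicate (Suc N) y @ [x])
            (fst (r (y, t)) # snd (r (y, t)) # replicate M t @ [x])"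
          using eq swap_equiv_head[of r y t "replicate M t @ [x]"] unfolding M by (auto intro: rtranclp_trans)
        then have "rk (fst (r (y, t))) \<le> rk y"
          using dec by (intro nonincreasing_head_le[OF swap_equiv_sym]) auto
        then show False using swap_asc[OF yt] by simp
      qed
    qed
  qed
  then show ?case unfolding b'_def y_def .
qed

end

context normal_swap
begin

text \<open>The case of a descent is the case of an ascent for the opposite order.\<close>

theorem cyclic_condition: "snd (r (fst (r (a, b)), a)) = b"
proof -
  interpret dual: normal_swap "\<lambda>x. - rk x" r by (rule dual_normal)
  consider "a = b" | "rk a < rk b" | "rk b < rk a" using rk_neq by blast
  then show ?thesis
    using cyclic_condition_ascent dual.cyclic_condition_ascent by cases (auto simp: swap_same)
qed

text \<open>The cyclic condition exhibits \<open>z \<mapsto> snd (r (z, y))\<close> as a left inverse.\<close>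

lemma bij_left_action: "bij (\<lambda>x. fst (r (y, x)))"
proof -
  have "inj (\<lambda>x. fst (r (y, x)))"
    by (rule inj_on_inverseI[of _ "\<lambda>z. snd (r (z, y))"]) (simp add: cyclic_condition)
  then show ?thesis by (simp add: bij_def finite_UNIV_inj_surj)
qed

lemma left_action_of_right_action: "fst (r (y, snd (r (z, y)))) = z"
proof -
  obtain x where x: "z = fst (r (y, x))" using bij_is_surj[OF bij_left_action[of y]] by (auto simp: surj_def)
  then show ?thesis by (simp add: cyclic_condition)
qed

text \<open>Hence a power of \<open>y\<close> that passes through \<open>x\<close> becomes a power of a single letter.\<close>

lemma right_letter_invariant: "snd (r (y, fst (r (y, x)))) = snd (r (y, x))"
proof -
  have "fst (r (fst (r (y, x)), snd (r (y, x)))) = y" by (simp add: swap_swap)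
  then show ?thesis using cyclic_condition[of "fst (r (y, x))" "snd (r (y, x))"] by simp
qed

lemma left_action_less_iff: "rk (fst (r (y, x))) < rk y \<longleftrightarrow> rk x < rk y"
  using swap_desc[of x y] swap_asc[of y x] rk_neq[of x y] swap_same[of y] by fastforce

lemma right_action_less_iff: "rk (snd (r (p, y))) < rk y \<longleftrightarrow> rk p < rk y"
  using left_action_less_iff[of y "snd (r (p, y))"] by (simp add: left_action_of_right_action)

lemma left_action_period: "\<exists>N>0. \<forall>y x. ((\<lambda>z. fst (r (y, z))) ^^ N) x = x"
proof -
  let ?Z = "range (\<lambda>(y, x :: 'a). (\<lambda>z. fst (r (y, z)), x))"
  have "\<exists>N>0. \<forall>(f, x) \<in> ?Z. (f ^^ N) x = x"
  proof (rule common_period)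
    fix f :: "'a \<Rightarrow> 'a" and x assume "(f, x) \<in> ?Z"
    then obtain y where f: "f = (\<lambda>z. fst (r (y, z)))" by auto
    show "\<exists>N>0. (f ^^ N) x = x"
      using bij_left_action[of y] unfolding f by (intro periodic_point[of UNIV]) (auto simp: bij_def)
  qed simp
  then show ?thesis by auto
qed

text \<open>A common exponent at which the permutations given by the left actions all become trivial.\<close>

definition period :: nat
  where "period = (SOME N. N > 0 \<and> (\<forall>y x. ((\<lambda>z. fst (r (y, z))) ^^ N) x = x))"

lemma period: "period > 0" "((\<lambda>z. fst (r (y, z))) ^^ period) x = x"
proof -
  have "period > 0 \<and> (\<forall>y x. ((\<lambda>z. fst (r (y, z))) ^^ period) x = x)"
    unfolding period_def using left_action_period by (rule someI_ex)
  then show "period > 0" "((\<lambda>z. fst (r (y, z))) ^^ period) x = x" by auto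
qed

abbreviation pow :: "'a \<Rightarrow> 'a list"
  where "pow y \<equiv> replicate period y"

text \<open>A letter is not changed when the period-th power of another letter passes through it.\<close>

lemma pow_passes_right: "swap_equiv r (pow y @ [x]) (x # pow (snd (r (y, x))))"
proof -
  let ?f = "\<lambda>z. fst (r (y, z))" and ?A = "{z. snd (r (y, z)) = snd (r (y, x))}"
  have "swap_equiv r (pow y @ [x]) ((?f ^^ period) x # pow (snd (r (y, x))))"
    by (rule power_passes[of x ?A ?f y]) (auto simp: right_letter_invariant prod_eq_iff)
  then show ?thesis using period(2) by simp
qed

lemma pow_passes_left: "swap_equiv r (x # pow c) (pow (fst (r (x, c))) @ [x])"
  using swap_equiv_sym[OF pow_passes_right[of "fst (r (x, c))" x]] by (simp add: cyclic_condition)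

text \<open>Moving the power of \<open>p\<close> to the right as far as the order of the letters demands yields the
nonincreasing word of the class of \<open>p^N y x\<close>. This word determines \<open>p\<close>.\<close>

lemma pow_pair_cancel:
  assumes yx: "rk x < rk y" and eq: "swap_equiv r (pow p @ [y, x]) (pow q @ [y, x])"
  shows "p = q"
proof -
  let ?R = "\<lambda>p y. snd (r (p, y))"
  \<comment> \<open>The nonincreasing word of the class, according to the final position of the power.\<close>
  define \<phi> where "\<phi> p = (if rk y \<le> rk p then pow p @ [y, x]
    else if rk x \<le> rk (?R p y) then y # pow (?R p y) @ [x] else y # x # pow (?R (?R p y) x))" for p
  obtain M where M: "period = Suc M" using period(1) by (cases period) auto
  have R_inj: "?R p y = ?R q y \<longleftrightarrow> p = q" for p q y
    by (metis left_action_of_right_action)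
  have \<phi>: "swap_equiv r (pow p @ [y, x]) (\<phi> p) \<and> sorted (map (\<lambda>x. - rk x) (\<phi> p))" for p
  proof (cases "rk y \<le> rk p")
    case False
    have 1: "swap_equiv r (pow p @ [y, x]) (y # pow (?R p y) @ [x])"
      using swap_equiv_append[OF pow_passes_right[of p y], of "[x]"] by simp
    have 2: "rk (?R p y) < rk y" using False by (simp add: right_action_less_iff)
    show ?thesis
    proof (cases "rk x \<le> rk (?R p y)")
      case True
      then show ?thesis using False 1 2 yx unfolding \<phi>_def by (auto simp: sorted_append)
    next
      case F: False
      have "swap_equiv r (y # pow (?R p y) @ [x]) (y # x # pow (?R (?R p y) x))"
        using swap_equiv_Cons[OF pow_passes_right] .
      with 1 have "swap_equiv r (pow p @ [y, x]) (y # x # pow (?R (?R p y) x))" by (rule rtranclp_trans)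
      moreover have "rk (?R (?R p y) x) < rk x" using F by (simp add: right_action_less_iff)
      ultimately show ?thesis using False F yx unfolding \<phi>_def by (auto simp: sorted_append)
    qed
  qed (use yx in \<open>auto simp: \<phi>_def sorted_append\<close>)
  have "swap_equiv r (\<phi> p) (\<phi> q)"
    using \<phi>[of p] \<phi>[of q] eq by (meson rtranclp_trans swap_equiv_sym)
  then have same: "\<phi> p = \<phi> q" using \<phi> nonincreasing_unique by blast
  have last: "last (pow z) = z" for z unfolding M by (induction M) auto
  have less: "rk p < rk y \<Longrightarrow> rk (?R p y) < rk y" for p y by (simp add: right_action_less_iff)
  have case1: "\<phi> p = pow p @ [y, x]" if "rk y \<le> rk p" for p using that by (simp add: \<phi>_def)
  have case2: "\<phi> p = y # pow (?R p y) @ [x]" if "\<not> rk y \<le> rk p" "rk x \<le> rk (?R p y)" for p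
    using that by (simp add: \<phi>_def)
  have case3: "\<phi> p = y # x # pow (?R (?R p y) x)" if "\<not> rk y \<le> rk p" "\<not> rk x \<le> rk (?R p y)" for p
    using that by (simp add: \<phi>_def)
  have 12: "pow p @ [y, x] \<noteq> y # pow q @ [x]" if "rk q < rk y" for p q
  proof
    assume eq: "pow p @ [y, x] = y # pow q @ [x]"
    then have "p = y" by (simp add: M)
    with eq have "replicate M y @ y # [x] = pow q @ [x]" by (simp add: M)
    then show False using that unfolding replicate_app_Cons_same by (simp add: M)
  qed
  have ne: "pow q \<noteq> []" for q using period(1) by simp
  have 13: "pow p @ [y, x] \<noteq> y # x # pow q" if "rk q < rk x" for p q
  proof
    assume "pow p @ [y, x] = y # x # pow q"
    then have "last (pow p @ [y, x]) = last (y # x # pow q)" by (rule arg_cong)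
    then show False using that ne[of q] last[of q] by simp
  qed
  have 23: "y # pow p @ [x] \<noteq> y # x # pow q" if "rk q < rk x" for p q
  proof
    assume "y # pow p @ [x] = y # x # pow q"
    then have "last (y # pow p @ [x]) = last (y # x # pow q)" by (rule arg_cong)
    then show False using that ne[of q] last[of q] by simp
  qed
  show ?thesis
  proof (cases "rk y \<le> rk p")
    case p: True
    show ?thesis
    proof (cases "rk y \<le> rk q")
      case True
      with p same show ?thesis by (simp add: case1 M)
    next
      case False
      with p same 12 13 less[of q y] less[of "?R q y" x] show ?thesis
        by (cases "rk x \<le> rk (?R q y)") (simp_all add: case1 case2 case3)
    qed
  next
    case p: False
    show ?thesis
    proof (cases "rk y \<le> rk q")
      case True
      with p same[symmetric] 12 13 less[of p y] less[of "?R p y" x] show ?thesis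
        by (cases "rk x \<le> rk (?R p y)") (simp_all add: case1 case2 case3)
    next
      case q: False
      note less = less[of "?R p y" x] less[of "?R q y" x]
      show ?thesis
      proof (cases "rk x \<le> rk (?R p y)"; cases "rk x \<le> rk (?R q y)")
        assume "rk x \<le> rk (?R p y)" "rk x \<le> rk (?R q y)"
        with p q same show ?thesis by (simp add: case2 M R_inj)
      next
        assume "\<not> rk x \<le> rk (?R p y)" "\<not> rk x \<le> rk (?R q y)"
        with p q same show ?thesis by (simp add: case3 M R_inj)
      next
        assume "rk x \<le> rk (?R p y)" "\<not> rk x \<le> rk (?R q y)"
        with p q same 23 less show ?thesis by (simp add: case2 case3)
      next
        assume "\<not> rk x \<le> rk (?R p y)" "rk x \<le> rk (?R q y)"
        with p q same[symmetric] 23 less show ?thesis by (simp add: case2 case3)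
      qed
    qed
  qed
qed

text \<open>For a descent \<open>y x\<close> with \<open>r (y, x) = (a, b)\<close>, let \<open>c^N\<close> pass to the left through \<open>y x\<close> and
through \<open>a b\<close>, which belong to the same class. It becomes the power of the letter on the left
hand side and of the letter on the right hand side, respectively, and \<open>pow_pair_cancel\<close>
identifies the two.\<close>

theorem left_action_braided:
  "fst (r (y, fst (r (x, c)))) = fst (r (fst (r (y, x)), fst (r (snd (r (y, x)), c))))"
proof -
  let ?L = "\<lambda>y z. fst (r (y, z))"
  have desc: "?L y (?L x c) = ?L (fst (r (y, x))) (?L (snd (r (y, x))) c)" if yx: "rk x < rk y" for y x
  proof (rule pow_pair_cancel[OF yx])
    let ?a = "fst (r (y, x))" and ?b = "snd (r (y, x))"
    have two: "swap_equiv r (pow (?L u (?L v c)) @ [u, v]) (u # v # pow c)" for u v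
    proof -
      have "swap_equiv r (u # v # pow c) (u # pow (?L v c) @ [v])"
        using swap_equiv_Cons[OF pow_passes_left] .
      also have "swap_equiv r (u # pow (?L v c) @ [v]) (pow (?L u (?L v c)) @ [u, v])"
        using swap_equiv_append[OF pow_passes_left[of u "?L v c"], of "[v]"] by simp
      finally show ?thesis by (rule swap_equiv_sym)
    qed
    have "swap_equiv r (pow (?L y (?L x c)) @ [y, x]) (y # x # pow c)" by (rule two)
    also have "swap_equiv r (y # x # pow c) (?a # ?b # pow c)" by (rule swap_equiv_head)
    also have "swap_equiv r (?a # ?b # pow c) (pow (?L ?a (?L ?b c)) @ [?a, ?b])"
      by (rule swap_equiv_sym[OF two])
    also have "swap_equiv r (pow (?L ?a (?L ?b c)) @ [?a, ?b]) (pow (?L ?a (?L ?b c)) @ [y, x])"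
      by (rule swap_equiv_sym, rule swap_equiv_prepend, rule swap_equiv_head)
    finally show "swap_equiv r (pow (?L y (?L x c)) @ [y, x]) (pow (?L ?a (?L ?b c)) @ [y, x])" .
  qed
  consider "x = y" | "rk x < rk y" | "rk y < rk x" using rk_neq by blast
  then show ?thesis
  proof cases
    case 1
    then show ?thesis by (simp add: swap_same)
  next
    case 2
    then show ?thesis by (rule desc)
  next
    case 3
    have "rk (snd (r (y, x))) < rk (fst (r (y, x)))" using swap_asc[OF 3] by simp
    from desc[OF this] show ?thesis by (simp add: swap_swap)
  qed
qed

end

section \<open>Square-free words and cancellation\<close>

text \<open>The swap read from right to left. It satisfies the same axioms as \<open>r\<close> and turns statements about
the left into statements about the right.\<close>

definition rev_swap :: "('x \<times> 'x \<Rightarrow> 'x \<times> 'x) \<Rightarrow> 'x \<times> 'x \<Rightarrow> 'x \<times> 'x"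
  where "rev_swap r z = prod.swap (r (prod.swap z))"

lemma rev_swap_rev_swap [simp]: "rev_swap (rev_swap r) = r"
  by (simp add: fun_eq_iff rev_swap_def)

lemma swap_equiv_rev:
  assumes "swap_equiv r u v" shows "swap_equiv (rev_swap r) (rev u) (rev v)"
  using assms
proof (induction rule: rtranclp_induct)
  case (step v w)
  then obtain p x y q where "v = p @ x # y # q" "w = p @ fst (r (x, y)) # snd (r (x, y)) # q"
    unfolding swap_step_def by blast
  then have "swap_equiv (rev_swap r) (rev v) (rev w)"
    using swap_equiv_swap[of "rev_swap r" "rev q" y x "rev p"] by (simp add: rev_swap_def)
  with step.IH show ?case by (rule rtranclp_trans)
qed simp

text \<open>Each letter of a word is counted after being moved to the front through the letters before it.\<close>

primrec twisted_content :: "('x \<times> 'x \<Rightarrow> 'x \<times> 'x) \<Rightarrow> 'x list \<Rightarrow> 'x multiset"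
  where "twisted_content r [] = {#}"
  | "twisted_content r (x # w) = add_mset x (image_mset (\<lambda>z. fst (r (x, z))) (twisted_content r w))"

definition squarefree_word :: "('x \<times> 'x \<Rightarrow> 'x \<times> 'x) \<Rightarrow> 'x list \<Rightarrow> bool"
  where "squarefree_word r w \<longleftrightarrow> (\<nexists>p x q. swap_equiv r w (p @ x # x # q))"

lemma squarefree_word_infix: "squarefree_word r (p @ w @ q) \<Longrightarrow> squarefree_word r w"
  unfolding squarefree_word_def
  by (metis append.assoc append_Cons swap_equiv_context)

context normal_swap
begin

lemma rev_normal: "normal_swap rk (rev_swap r)"
proof unfold_locales
  show "inj rk" by (rule inj_rk)
  fix x y :: 'a and z :: "'a \<times> 'a"
  show "rev_swap r (x, x) = (x, x)" "rev_swap r (rev_swap r z) = z"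
    by (simp_all add: rev_swap_def swap_same swap_swap)
  assume xy: "rk x < rk y"
  show "rk (fst (rev_swap r (y, x))) < rk (snd (rev_swap r (y, x))) \<and>
      rk (fst (rev_swap r (y, x))) < rk y"
    using swap_asc[OF xy] right_action_less_iff[of x y] xy by (simp add: rev_swap_def)
  have "snd (r (y, x)) \<noteq> x"
    using left_action_of_right_action[of x y] xy by (auto simp: swap_same)
  moreover have "\<not> rk (snd (r (y, x))) < rk x" using right_action_less_iff[of y x] xy by simp
  ultimately have "rk x < rk (snd (r (y, x)))" using rk_neq by blast
  then show "rk (snd (rev_swap r (x, y))) < rk (fst (rev_swap r (x, y))) \<and>
      rk x < rk (fst (rev_swap r (x, y)))"
    using swap_desc[OF xy] by (simp add: rev_swap_def)
next
  fix u v assume uv: "swap_equiv (rev_swap r) u v" "sorted (map rk u)" "sorted (map rk v)"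
  have "rev u = rev v"
    using swap_equiv_rev[OF uv(1)] uv(2,3)
    by (intro nonincreasing_unique) (simp_all add: sorted_map sorted_wrt_rev)
  then show "u = v" by simp
qed

lemma size_twisted_content [simp]: "size (twisted_content r w) = length w"
  by (induction w) auto

text \<open>The braid relation says precisely that a swap at the front of a word does not change how later
letters are moved.\<close>

lemma twisted_content_equiv: "swap_equiv r u v \<Longrightarrow> twisted_content r u = twisted_content r v"
proof (induction rule: rtranclp_induct)
  case (step v w)
  then obtain p x y q where vw: "v = p @ x # y # q" "w = p @ fst (r (x, y)) # snd (r (x, y)) # q"
    unfolding swap_step_def by blast
  have "twisted_content r (p @ x # y # q) = twisted_content r (p @ fst (r (x, y)) # snd (r (x, y)) # q)"
  proof (induction p)
    case Nil
    have "(\<lambda>c. fst (r (x, fst (r (y, c))))) =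
        (\<lambda>c. fst (r (fst (r (x, y)), fst (r (snd (r (x, y)), c)))))"
      using left_action_braided by (simp add: fun_eq_iff)
    then show ?case by (simp add: multiset.map_comp comp_def swap_swap)
  qed simp
  with step.IH vw show ?case by simp
qed simp

text \<open>Any element of the multiset can be chosen as first letter, since the left action of that letter
is invertible.\<close>

lemma twisted_content_surj: "\<exists>w. twisted_content r w = M"
proof (induction "size M" arbitrary: M)
  case 0
  then show ?case by (intro exI[of _ "[]"]) auto
next
  case (Suc n)
  then obtain x M' where M: "M = add_mset x M'" by (metis size_eq_Suc_imp_eq_union)
  let ?g = "inv_into UNIV (\<lambda>z. fst (r (x, z)))"
  have "n = size (image_mset ?g M')" using Suc.hyps(2) M by simp
  from Suc.hyps(1)[OF this] obtain w where w: "twisted_content r w = image_mset ?g M'" by blast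
  have "(\<lambda>z. fst (r (x, ?g z))) = id"
    using surj_f_inv_f[OF bij_is_surj[OF bij_left_action[of x]]] by auto
  then have "twisted_content r (x # w) = M" by (simp add: w M multiset.map_comp comp_def)
  then show ?case ..
qed

lemma mset_inj_sorted:
  assumes "sorted (map rk u)" "sorted (map rk v)" "mset u = mset v" shows "u = v"
proof -
  have "mset (map rk u) = mset (map rk v)" using assms(3) by simp
  then have "map rk u = map rk v" using assms(1,2) by (metis properties_for_sort)
  then show ?thesis using inj_rk by (simp add: inj_map_eq_map)
qed

lemma mset_surj_sorted: "\<exists>v. sorted (map rk v) \<and> mset v = M"
proof -
  obtain w where "mset w = M" using ex_mset by blast
  then show ?thesis by (intro exI[of _ "sort_key rk w"]) simp
qed

text \<open>On the sorted words of a given length the twisted content and the ordinary content are both maps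
onto the multisets of that size. The ordinary content is injective there; comparing finite
cardinalities, so is the twisted content.\<close>

lemma twisted_content_inj:
  assumes "twisted_content r u = twisted_content r v" shows "swap_equiv r u v"
proof -
  define S where "S = {w. length w = length u \<and> sorted (map rk w)}"
  have fin: "finite S" unfolding S_def by (rule finite_words)
  have "twisted_content r ` S = {M. size M = length u}"
  proof (rule equalityI; rule subsetI)
    fix M :: "'a multiset" assume M: "M \<in> {M. size M = length u}"
    obtain w where w: "twisted_content r w = M" using twisted_content_surj by blast
    then have "length w = length u" using M size_twisted_content[of w] by simp
    then have "nf w \<in> S" using nf_props unfolding S_def by simp
    moreover have "twisted_content r (nf w) = M"
      using w twisted_content_equiv[OF nf_props(1)[of w]] by simp
    ultimately show "M \<in> twisted_content r ` S" by auto
  qed (auto simp: S_def)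
  moreover have "mset ` S = {M. size M = length u}"
  proof (rule equalityI; rule subsetI)
    fix M :: "'a multiset" assume M: "M \<in> {M. size M = length u}"
    obtain w where "sorted (map rk w)" "mset w = M" using mset_surj_sorted by blast
    then show "M \<in> mset ` S" using M unfolding S_def by (auto simp flip: size_mset)
  qed (auto simp: S_def)
  moreover have "card (mset ` S) = card S"
    by (rule card_image) (auto simp: S_def inj_on_def intro: mset_inj_sorted)
  ultimately have inj: "inj_on (twisted_content r) S" using fin by (intro eq_card_imp_inj_on) simp_all
  have "length v = length u" using arg_cong[OF assms, of size] by simp
  then have "nf u \<in> S" "nf v \<in> S" using nf_props unfolding S_def by auto
  moreover have "twisted_content r (nf u) = twisted_content r (nf v)"
    using assms twisted_content_equiv nf_props(1) by metis
  ultimately have "nf u = nf v" using inj by (auto dest: inj_onD)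
  then show ?thesis by (simp add: nf_eq_iff)
qed

lemma inj_left: "inj (\<lambda>z. fst (r (x, z)))"
  using bij_left_action by (rule bij_is_inj)

text \<open>Left actions are injective, so the content of \<open>x w\<close> determines that of \<open>w\<close>.\<close>

lemma left_cancel: "swap_equiv r (x # u) (x # v) \<Longrightarrow> swap_equiv r u v"
  using twisted_content_equiv[of "x # u" "x # v"] inj_left[of x]
  by (intro twisted_content_inj) (auto dest: multiset.inj_map injD)

text \<open>This recursion for multiplicities uses that \<open>x\<close> is fixed by its own left action.\<close>

lemma count_twisted_Cons:
  "count (twisted_content r (x # w)) (fst (r (x, z))) =
    count (twisted_content r w) z + (if z = x then 1 else 0)"
proof -
  have "x = fst (r (x, z)) \<longleftrightarrow> z = x"
    using swap_same[of x] injD[OF inj_left[of x], of z x] by auto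
  moreover have count: "count (image_mset (\<lambda>z. fst (r (x, z))) M) (fst (r (x, z))) = count M z" for M
    by (induction M) (use inj_left in \<open>auto dest: injD\<close>)
  ultimately show ?thesis by (simp only: twisted_content.simps count_add_mset) simp
qed

lemma left_action_cases: "\<exists>z. y = fst (r (x, z))"
  using bij_is_surj[OF bij_left_action[of x]] by (auto simp: surj_def)

text \<open>A square \<open>x x\<close> contributes the letter \<open>x\<close> twice, and left actions preserve multiplicities.\<close>

lemma square_content: "\<exists>z. 2 \<le> count (twisted_content r (p @ x # x # q)) z"
proof (induction p)
  case Nil
  have "count (twisted_content r (x # x # q)) (fst (r (x, fst (r (x, x))))) \<ge> 2"
    unfolding count_twisted_Cons by (simp add: swap_same)
  then show ?case by (metis append_Nil)
next
  case (Cons y p)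
  then obtain z where "2 \<le> count (twisted_content r (p @ x # x # q)) z" by blast
  then have "2 \<le> count (twisted_content r (y # p @ x # x # q)) (fst (r (y, z)))"
    unfolding count_twisted_Cons by simp
  then show ?case by (metis append_Cons)
qed

lemma distinct_iff_count: "distinct v \<longleftrightarrow> (\<forall>x. count (mset v) x \<le> 1)"
proof
  assume "distinct v"
  then show "\<forall>x. count (mset v) x \<le> 1" by (simp add: distinct_count_atmost_1)
next
  assume a: "\<forall>x. count (mset v) x \<le> 1"
  have "count (mset v) x = (if x \<in> set v then 1 else 0)" for x
    using a[rule_format, of x] count_greater_zero_iff[of "mset v" x]
    by (auto simp: count_eq_zero_iff simp del: count_mset_gt_0 count_greater_zero_iff)
  then show "distinct v" by (simp add: distinct_count_atmost_1)
qed

text \<open>If the content has no multiplicities, then the word has no repeated letter, by \<open>square_content\<close>.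
The converse is again a count: the two conditions single out equally many sorted words of each
length, namely as many as there are sets of letters of that size.\<close>

lemma content_le_1_iff_sorted:
  assumes "sorted (map rk v)"
  shows "(\<forall>x. count (twisted_content r v) x \<le> 1) \<longleftrightarrow> distinct v"
proof -
  define S where "S = {w. length w = length v \<and> sorted (map rk w)}"
  define Q where "Q = {M :: 'a multiset. size M = length v \<and> (\<forall>x. count M x \<le> 1)}"
  define A where "A = {w \<in> S. distinct w}"
  define B where "B = {w \<in> S. \<forall>x. count (twisted_content r w) x \<le> 1}"
  have fin: "finite S" unfolding S_def by (rule finite_words)
  have "B \<subseteq> A"
  proof
    fix w assume w: "w \<in> B"
    show "w \<in> A"
    proof (rule ccontr)
      assume "w \<notin> A"
      then have "\<not> distinct w" "sorted (map rk w)" using w unfolding A_def B_def S_def by auto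
      then obtain p a q where "w = p @ a # a # q" using sorted_repeat_adjacent[OF _ _ inj_rk] by blast
      with square_content[of p a q] obtain z where "2 \<le> count (twisted_content r w) z" by auto
      moreover have "count (twisted_content r w) z \<le> 1" using w unfolding B_def by blast
      ultimately show False by linarith
    qed
  qed
  have "mset ` A = Q"
  proof (rule equalityI; rule subsetI)
    fix M assume M: "M \<in> Q"
    obtain w where "sorted (map rk w)" "mset w = M" using mset_surj_sorted by blast
    then show "M \<in> mset ` A" using M unfolding A_def S_def Q_def
      by (auto simp: distinct_iff_count simp flip: size_mset)
  qed (auto simp: A_def S_def Q_def distinct_iff_count)
  moreover have "twisted_content r ` B = Q"
  proof (rule equalityI; rule subsetI)
    fix M assume M: "M \<in> Q"
    obtain w where w: "twisted_content r w = M" using twisted_content_surj by blast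
    then have nf: "twisted_content r (nf w) = M" using twisted_content_equiv[OF nf_props(1)[of w]] by simp
    then have "length (nf w) = length v" using M size_twisted_content[of "nf w"] unfolding Q_def by simp
    then have "nf w \<in> B" using M nf nf_props unfolding B_def S_def Q_def by simp
    then show "M \<in> twisted_content r ` B" using nf by auto
  qed (auto simp: B_def S_def Q_def)
  moreover have "inj_on mset A" by (auto simp: A_def S_def inj_on_def intro: mset_inj_sorted)
  moreover have "inj_on (twisted_content r) B"
  proof (rule inj_onI)
    fix u w assume "u \<in> B" "w \<in> B" "twisted_content r u = twisted_content r w"
    then show "u = w" unfolding B_def S_def by (auto dest!: twisted_content_inj intro: sorted_unique)
  qed
  ultimately have "card A = card B" by (metis card_image)
  with \<open>B \<subseteq> A\<close> fin have "B = A" by (intro card_subset_eq) (auto simp: A_def)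
  moreover have "v \<in> S" using assms unfolding S_def by simp
  ultimately show ?thesis unfolding A_def B_def by blast
qed

theorem squarefree_iff_content: "squarefree_word r w \<longleftrightarrow> (\<forall>x. count (twisted_content r w) x \<le> 1)"
proof
  assume "\<forall>x. count (twisted_content r w) x \<le> 1"
  then show "squarefree_word r w"
    unfolding squarefree_word_def using square_content twisted_content_equiv
    by (metis Suc_1 not_less_eq_eq)
next
  assume sq: "squarefree_word r w"
  have "distinct (nf w)"
  proof (rule ccontr)
    assume "\<not> distinct (nf w)"
    then obtain p a q where "nf w = p @ a # a # q"
      using sorted_repeat_adjacent[OF nf_props(2) _ inj_rk] by blast
    then show False using sq nf_props(1)[of w] unfolding squarefree_word_def by metis
  qed
  then show "\<forall>x. count (twisted_content r w) x \<le> 1"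
    using content_le_1_iff_sorted[OF nf_props(2)[of w]] twisted_content_equiv[OF nf_props(1)[of w]] by simp
qed

lemma squarefree_equiv: "swap_equiv r u v \<Longrightarrow> squarefree_word r u \<longleftrightarrow> squarefree_word r v"
  unfolding squarefree_word_def by (metis rtranclp_trans swap_equiv_sym)

theorem squarefree_iff_distinct_nf: "squarefree_word r w \<longleftrightarrow> distinct (nf w)"
  using squarefree_equiv[OF nf_props(1)[of w]] content_le_1_iff_sorted[OF nf_props(2)[of w]]
  by (simp add: squarefree_iff_content)

text \<open>A letter outside the twisted content can be put in front without creating a multiplicity.\<close>

lemma squarefree_extend_left:
  assumes "squarefree_word r u" "length u < card (UNIV :: 'a set)"
  shows "\<exists>x. squarefree_word r (x # u)"
proof -
  let ?T = "twisted_content r u"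
  have "card (set_mset ?T) \<le> length u"
    using size_multiset_overloaded_eq[of ?T] size_twisted_content[of u]
    by (metis size_mset_set mset_set_set_mset_msubset size_mset_mono)
  then have "set_mset ?T \<noteq> UNIV" using assms(2) by auto
  then obtain x where x: "x \<notin># ?T" by auto
  have "count (twisted_content r (x # u)) y \<le> 1" for y
  proof -
    obtain z where "y = fst (r (x, z))" using left_action_cases by blast
    then show ?thesis using x assms(1)
      by (auto simp: count_twisted_Cons squarefree_iff_content count_eq_zero_iff simp del: twisted_content.simps)
  qed
  then show ?thesis unfolding squarefree_iff_content by blast
qed

lemma squarefree_rev: "squarefree_word (rev_swap r) (rev w) \<longleftrightarrow> squarefree_word r w"
proof -
  have "squarefree_word r w" if "squarefree_word (rev_swap r) (rev w)" for r :: "'a \<times> 'a \<Rightarrow> 'a \<times> 'a" and w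
    unfolding squarefree_word_def
  proof (intro notI, elim exE)
    fix p x q assume "swap_equiv r w (p @ x # x # q)"
    from swap_equiv_rev[OF this] show False using that unfolding squarefree_word_def by auto
  qed
  from this[of r w] this[of "rev_swap r" "rev w"] show ?thesis by auto
qed

lemma squarefree_extend_right:
  assumes "squarefree_word r u" "length u < card (UNIV :: 'a set)"
  shows "\<exists>x. squarefree_word r (u @ [x])"
proof -
  interpret op: normal_swap rk "rev_swap r" by (rule rev_normal)
  obtain x where "squarefree_word (rev_swap r) (x # rev u)"
    using op.squarefree_extend_left[of "rev u"] assms squarefree_rev[of u] by auto
  then show ?thesis using squarefree_rev[of "u @ [x]"] by auto
qed

lemma right_cancel:
  assumes "swap_equiv r (u @ [x]) (v @ [x])" shows "swap_equiv r u v"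
proof -
  interpret op: normal_swap rk "rev_swap r" by (rule rev_normal)
  have "swap_equiv (rev_swap r) (x # rev u) (x # rev v)" using swap_equiv_rev[OF assms] by simp
  then have "swap_equiv (rev_swap r) (rev u) (rev v)" by (rule op.left_cancel)
  from swap_equiv_rev[OF this] show ?thesis by simp
qed

end

section \<open>Free algebras and their quotients\<close>

abbreviation scale :: "'k::field \<Rightarrow> ('x, 'k) free_algebra \<Rightarrow> ('x, 'k) free_algebra"
  where "scale c f \<equiv> single [] c * f"

lemma lookup_scale [simp]: "lookup (scale c f) u = c * lookup f u"
  using mult_map_scale_conv_mult[of c f, symmetric]
  by (simp add: zero_list_def Poly_Mapping.map.rep_eq when_def)

lemma single_mult_single: "single u a * single v b = single (u @ v) (a * b)"
  by (simp add: mult_single plus_list_def)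

lemma scale_single [simp]: "scale c (single u a) = single u (c * a)"
  by (simp add: single_mult_single)

lemma scale_one [simp]: "scale 1 f = f"
  by (rule poly_mapping_eqI) simp

lemma scale_scale [simp]: "scale c (scale d f) = scale (c * d) f"
  by (rule poly_mapping_eqI) simp

lemma scale_sum: "scale c (sum f A) = (\<Sum>a\<in>A. scale c (f a))"
  by (rule sum_distrib_left)

lemma scale_add_left: "scale (c + d) f = scale c f + scale d f"
  by (rule poly_mapping_eqI) (simp add: lookup_add distrib_right)

lemma keys_scale: "keys (scale c f) \<subseteq> keys f"
  by (auto simp: in_keys_iff)

lemma sum_monomials:
  assumes "finite S" "keys f \<subseteq> S"
  shows "f = (\<Sum>u\<in>S. single u (lookup f u))"
proof (rule poly_mapping_eqI)
  fix v
  have "(\<Sum>u\<in>S. lookup (single u (lookup f u)) v) =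
      (\<Sum>u\<in>S. if u = v then lookup f v else 0)"
    by (rule sum.cong) (auto simp: lookup_single when_def)
  also have "\<dots> = lookup f v" using assms by (auto simp: in_keys_iff)
  finally show "lookup f v =
      lookup (\<Sum>u\<in>S. single u (lookup f u)) v"
    by (simp add: lookup_sum)
qed

lemma scale_central: "f * scale c g = scale c (f * g)"
proof -
  have "f * single [] c = single [] c * f"
    by (subst (1 2) sum_monomials[of "keys f" f])
      (simp_all add: sum_distrib_left sum_distrib_right single_mult_single mult.commute)
  then show ?thesis by (metis mult.assoc)
qed

definition lin_ext :: "('x list \<Rightarrow> ('y, 'k::field) free_algebra) \<Rightarrow> ('x, 'k) free_algebra \<Rightarrow> ('y, 'k) free_algebra"
  where "lin_ext \<phi> f = (\<Sum>u\<in>keys f. scale (lookup f u) (\<phi> u))"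

lemma lin_ext_superset:
  assumes "finite S" "keys f \<subseteq> S"
  shows "lin_ext \<phi> f = (\<Sum>u\<in>S. scale (lookup f u) (\<phi> u))"
  unfolding lin_ext_def using assms by (intro sum.mono_neutral_left) (auto simp: in_keys_iff)

lemma lin_ext_add: "lin_ext \<phi> (f + g) = lin_ext \<phi> f + lin_ext \<phi> g"
proof -
  let ?S = "keys f \<union> keys g"
  have "keys (f + g) \<subseteq> ?S" by (rule keys_add)
  then show ?thesis
    using lin_ext_superset[of ?S "f + g" \<phi>] lin_ext_superset[of ?S f \<phi>] lin_ext_superset[of ?S g \<phi>]
    by (simp add: lookup_add scale_add_left sum.distrib)
qed

lemma lin_ext_zero [simp]: "lin_ext \<phi> 0 = 0"
  by (simp add: lin_ext_def)

lemma lin_ext_single [simp]: "lin_ext \<phi> (single u c) = scale c (\<phi> u)"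
  by (simp add: lin_ext_def)

lemma lin_ext_scale: "lin_ext \<phi> (scale c f) = scale c (lin_ext \<phi> f)"
  using lin_ext_superset[of "keys f" "scale c f" \<phi>]
  by (simp add: keys_scale lin_ext_def scale_sum)

lemma lin_ext_uminus: "lin_ext \<phi> (- f) = - lin_ext \<phi> f"
  using lin_ext_add[of \<phi> f "- f"] by (simp add: eq_neg_iff_add_eq_0 add.commute)

lemma lin_ext_diff: "lin_ext \<phi> (f - g) = lin_ext \<phi> f - lin_ext \<phi> g"
  using lin_ext_add[of \<phi> f "- g"] by (simp add: lin_ext_uminus)

lemma lin_ext_sum: "lin_ext \<phi> (sum f A) = (\<Sum>a\<in>A. lin_ext \<phi> (f a))"
  by (induction A rule: infinite_finite_induct) (simp_all add: lin_ext_add)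

lemma lin_ext_cong: "(\<And>u. u \<in> keys f \<Longrightarrow> \<phi> u = \<psi> u) \<Longrightarrow> lin_ext \<phi> f = lin_ext \<psi> f"
  unfolding lin_ext_def by (rule sum.cong) auto

lemma lin_ext_lin_ext: "lin_ext \<psi> (lin_ext \<phi> f) = lin_ext (\<lambda>u. lin_ext \<psi> (\<phi> u)) f"
  unfolding lin_ext_def[of \<phi>] lin_ext_sum lin_ext_scale by (simp add: lin_ext_def)

lemma lin_ext_id: "lin_ext word_monomial f = f"
  using sum_monomials[of "keys f" f] by (simp add: lin_ext_def)

lemma lookup_lin_ext:
  "lookup (lin_ext \<phi> f) v =
    (\<Sum>u\<in>keys f. lookup f u * lookup (\<phi> u) v)"
  by (simp add: lin_ext_def lookup_sum)

lemma keys_lin_ext: "keys (lin_ext \<phi> f) \<subseteq> (\<Union>u\<in>keys f. keys (\<phi> u))"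
proof
  fix v assume "v \<in> keys (lin_ext \<phi> f)"
  then have "(\<Sum>u\<in>keys f. lookup f u * lookup (\<phi> u) v) \<noteq> 0"
    by (simp add: in_keys_iff lookup_lin_ext)
  then obtain u where "u \<in> keys f" "lookup f u * lookup (\<phi> u) v \<noteq> 0"
    by (meson sum.neutral)
  then show "v \<in> (\<Union>u\<in>keys f. keys (\<phi> u))" by (auto simp: in_keys_iff)
qed

lemma mult_lin_ext: "f * g = lin_ext (\<lambda>u. word_monomial u * g) f"
proof -
  have "f * g = lin_ext word_monomial f * g" by (simp add: lin_ext_id)
  then show ?thesis by (simp add: lin_ext_def sum_distrib_right flip: mult.assoc)
qed

lemma keys_mult_words: "keys (f * g) \<subseteq> {u @ v | u v. u \<in> keys f \<and> v \<in> keys g}"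
  using keys_mult[of f g] by (auto simp: plus_list_def)

lemma ring_free_ring: "ring (free_ring :: ('x, 'k::field) free_algebra ring)"
proof -
  have "\<exists>y. x + y = 0" for x :: "('x, 'k) free_algebra"
    using add.right_inverse by blast
  then show ?thesis
    unfolding ring_of_type_algebra_def using add.right_inverse
    by unfold_locales (auto simp: algebra_simps Units_def)
qed

lemma free_ring_simps [simp]:
  "carrier free_ring = UNIV" "monoid.mult free_ring = (*)" "ring.add free_ring = (+)"
  "ring.zero free_ring = 0" "monoid.one free_ring = 1"
  by (simp_all add: ring_of_type_algebra_def)

lemma ground_field_simps [simp]:
  "carrier (ground_field :: 'k::field ring) = UNIV" "monoid.mult (ground_field :: 'k ring) = (*)"
  "ring.add (ground_field :: 'k ring) = (+)"
  "ring.zero (ground_field :: 'k ring) = 0" "monoid.one (ground_field :: 'k ring) = 1"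
  by (simp_all add: ring_of_type_algebra_def)

lemma a_inv_free_ring [simp]: "a_inv free_ring (f :: ('x, 'k::field) free_algebra) = - f"
proof -
  interpret ring "free_ring :: ('x, 'k) free_algebra ring" by (rule ring_free_ring)
  have "f \<oplus>\<^bsub>free_ring\<^esub> - f = \<zero>\<^bsub>free_ring\<^esub>" by simp
  then show ?thesis using minus_equality[of "- f" f] by simp
qed

lemma ideal_relation_ideal: "ideal (relation_ideal R) (free_ring :: ('x, 'k::field) free_algebra ring)"
proof -
  interpret ring "free_ring :: ('x, 'k) free_algebra ring" by (rule ring_free_ring)
  show ?thesis unfolding relation_ideal_def by (rule genideal_ideal) simp
qed

lemma relation_ideal_mult_left: "f \<in> relation_ideal R \<Longrightarrow> h * f \<in> relation_ideal R"
  using ideal.I_l_closed[OF ideal_relation_ideal, of f R h] by simp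

lemma relation_ideal_mult_right: "f \<in> relation_ideal R \<Longrightarrow> f * h \<in> relation_ideal R"
  using ideal.I_r_closed[OF ideal_relation_ideal, of f R h] by simp

lemma relation_ideal_add: "f \<in> relation_ideal R \<Longrightarrow> g \<in> relation_ideal R \<Longrightarrow> f + g \<in> relation_ideal R"
  using additive_subgroup.a_closed[OF ideal.axioms(1)[OF ideal_relation_ideal], of f R g] by simp

lemma relation_ideal_zero [simp]: "0 \<in> relation_ideal R"
  using additive_subgroup.zero_closed[OF ideal.axioms(1)[OF ideal_relation_ideal], of R] by simp

lemma relation_ideal_uminus: "f \<in> relation_ideal R \<Longrightarrow> - f \<in> relation_ideal R"
  using relation_ideal_mult_left[of f R "- 1"] by simp

lemma relation_ideal_diff: "f \<in> relation_ideal R \<Longrightarrow> g \<in> relation_ideal R \<Longrightarrow> f - g \<in> relation_ideal R"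
  using relation_ideal_add[of f R "- g"] by (simp add: relation_ideal_uminus)

lemma relation_ideal_sum: "(\<And>a. a \<in> A \<Longrightarrow> f a \<in> relation_ideal R) \<Longrightarrow> sum f A \<in> relation_ideal R"
  by (induction A rule: infinite_finite_induct) (auto simp: relation_ideal_add)

lemma relation_ideal_generators: "(R :: ('x, 'k::field) free_algebra set) \<subseteq> relation_ideal R"
proof -
  interpret ring "free_ring :: ('x, 'k) free_algebra ring" by (rule ring_free_ring)
  show ?thesis unfolding relation_ideal_def by (rule genideal_self) simp
qed

text \<open>The universal property of the ideal generated by \<open>R\<close>, free of the record language.\<close>

lemma relation_ideal_minimal:
  fixes J :: "('x, 'k::field) free_algebra set"
  assumes "0 \<in> J" "\<And>f g. f \<in> J \<Longrightarrow> g \<in> J \<Longrightarrow> f + g \<in> J"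
    "\<And>f h. f \<in> J \<Longrightarrow> h * f \<in> J" "\<And>f h. f \<in> J \<Longrightarrow> f * h \<in> J" "R \<subseteq> J"
  shows "relation_ideal R \<subseteq> J"
proof -
  interpret ring "free_ring :: ('x, 'k) free_algebra ring" by (rule ring_free_ring)
  have "- f \<in> J" if "f \<in> J" for f using assms(3)[OF that, of "- 1"] by simp
  then have "subgroup J (add_monoid (free_ring :: ('x, 'k) free_algebra ring))"
    using assms(1,2) by (intro add.subgroupI) (auto simp: a_inv_def[symmetric])
  then have "ideal J (free_ring :: ('x, 'k) free_algebra ring)"
    by (intro idealI ring_free_ring) (use assms in auto)
  then show ?thesis unfolding relation_ideal_def using assms(5) by (rule genideal_minimal)
qed

lemma residue_class_eq: "residue_class R f = {g. g - f \<in> relation_ideal R}"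
  unfolding residue_class_def a_r_coset_def'
  by (auto simp: image_iff intro!: bexI[of _ "_ - f"])

text \<open>Together with the next lemmas this reduces calculations in the presented algebra to membership
in the ideal.\<close>

lemma residue_class_eq_iff: "residue_class R f = residue_class R g \<longleftrightarrow> f - g \<in> relation_ideal R"
proof
  assume "residue_class R f = residue_class R g"
  then have "f \<in> residue_class R g" by (auto simp: residue_class_eq[of R f])
  then show "f - g \<in> relation_ideal R" by (simp add: residue_class_eq)
next
  assume a: "f - g \<in> relation_ideal R"
  have "h - f \<in> relation_ideal R \<longleftrightarrow> h - g \<in> relation_ideal R" for h
    using relation_ideal_add[OF _ a, of "h - f"] relation_ideal_diff[OF _ a, of "h - g"] by auto
  then show "residue_class R f = residue_class R g" by (simp add: residue_class_eq)
qed

lemma carrier_presented_algebra: "carrier (presented_algebra R) = range (residue_class R)"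
  unfolding presented_algebra_def FactRing_def A_RCOSETS_def' residue_class_def
  by (auto simp: ring.defs)

lemma mult_presented_algebra:
  "residue_class R f \<otimes>\<^bsub>presented_algebra R\<^esub> residue_class R g = residue_class R (f * g)"
  using ideal.rcoset_mult_add[OF ideal_relation_ideal, of f g R]
  unfolding presented_algebra_def FactRing_def residue_class_def by (simp add: ring.defs)

lemma add_presented_algebra:
  "residue_class R f \<oplus>\<^bsub>presented_algebra R\<^esub> residue_class R g = residue_class R (f + g)"
proof -
  have "relation_ideal R +>\<^bsub>free_ring\<^esub> f <+>\<^bsub>free_ring\<^esub> (relation_ideal R +>\<^bsub>free_ring\<^esub> g) =
      relation_ideal R +>\<^bsub>free_ring\<^esub> (f \<oplus>\<^bsub>free_ring\<^esub> g)"
    by (rule abelian_subgroup.a_rcos_sum[OF abelian_subgroupI3])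
      (auto simp: ideal.axioms(1)[OF ideal_relation_ideal] ring.is_abelian_group ring_free_ring)
  then show ?thesis
    unfolding presented_algebra_def FactRing_def residue_class_def by (simp add: ring.defs)
qed

lemma one_presented_algebra: "\<one>\<^bsub>presented_algebra R\<^esub> = residue_class R 1"
  unfolding presented_algebra_def FactRing_def residue_class_def by (simp add: ring.defs)

lemma zero_presented_algebra: "\<zero>\<^bsub>presented_algebra R\<^esub> = residue_class R 0"
  unfolding residue_class_eq presented_algebra_def FactRing_def by (simp add: ring.defs)

lemma smult_presented_algebra:
  "c \<odot>\<^bsub>presented_algebra R\<^esub> residue_class R f = residue_class R (scale c f)"
proof -
  have "residue_class R (scale c g) = residue_class R (scale c f)" if "g \<in> residue_class R f" for g
    using that relation_ideal_mult_left[of "g - f" R "single [] c"]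
    by (simp add: residue_class_eq_iff right_diff_distrib) (simp add: residue_class_eq)
  moreover have "f \<in> residue_class R f" by (simp add: residue_class_eq)
  ultimately have "(\<Union>g\<in>residue_class R f. residue_class R (scale c g)) = residue_class R (scale c f)"
    by blast
  then show ?thesis unfolding presented_algebra_def by (simp add: module.defs ring.defs)
qed

lemmas presented_algebra_simps =
  carrier_presented_algebra mult_presented_algebra add_presented_algebra one_presented_algebra
  zero_presented_algebra smult_presented_algebra

lemma assoc_algebra_presented: "assoc_algebra ground_field (presented_algebra (R :: ('x, 'k::field) free_algebra set))"
proof -
  let ?F = "presented_algebra R"
  have ab: "abelian_group ?F"
  proof (rule abelian_groupI)
    fix x assume "x \<in> carrier ?F"
    then obtain f where f: "x = residue_class R f" by (auto simp: presented_algebra_simps)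
    show "\<exists>y\<in>carrier ?F. y \<oplus>\<^bsub>?F\<^esub> x = \<zero>\<^bsub>?F\<^esub>"
      by (rule bexI[of _ "residue_class R (- f)"]) (auto simp: f presented_algebra_simps)
  qed (auto simp: presented_algebra_simps algebra_simps)
  have ring: "ring ?F"
    by (intro ringI ab monoidI) (auto simp: presented_algebra_simps algebra_simps)
  have field: "Ring.field (ground_field :: 'k ring)" by (rule field_from_type_algebra)
  then have cring: "cring (ground_field :: 'k ring)" by (simp add: field_def domain_def)
  have "module ground_field ?F"
    by (intro moduleI cring ab) (auto simp: presented_algebra_simps algebra_simps scale_add_left)
  then show ?thesis
    by (intro assoc_algebra.intro ring field assoc_algebra_axioms.intro)
      (auto simp: presented_algebra_simps scale_central mult.assoc)
qed

lemma finsum_presented_algebra: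
  assumes "finite T"
  shows "(\<Oplus>\<^bsub>presented_algebra R\<^esub>i\<in>T. residue_class R (f i)) = residue_class R (sum f T)"
proof -
  interpret assoc_algebra ground_field "presented_algebra R" by (rule assoc_algebra_presented)
  show ?thesis using assms
    by (induction T) (auto simp: presented_algebra_simps finsum_insert finsum_empty Pi_def)
qed

section \<open>Leading words\<close>

lemma deglex_less_irrefl [simp]: "\<not> deglex_less u u"
  unfolding deglex_less_def by (rule lenlex_irreflexive) auto

lemma deglex_less_trans: "deglex_less u v \<Longrightarrow> deglex_less v w \<Longrightarrow> deglex_less u w"
proof -
  have "trans (lenlex {(x :: 'x::linorder, y). x < y})" by (rule lenlex_transI) (auto simp: trans_def)
  then show "deglex_less u v \<Longrightarrow> deglex_less v w \<Longrightarrow> deglex_less u w"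
    by (auto simp: deglex_less_def dest: transD)
qed

lemma deglex_less_total: "deglex_less u v \<or> u = v \<or> deglex_less v u"
proof -
  have "total (lenlex {(x :: 'x::linorder, y). x < y})" by (rule total_lenlex) (auto simp: total_on_def)
  then show ?thesis by (auto simp: deglex_less_def total_on_def)
qed

lemma lead_wordI:
  assumes "u \<in> keys f" "\<And>v. v \<in> keys f \<Longrightarrow> v \<noteq> u \<Longrightarrow> deglex_less v u"
  shows "lead_word f = u"
  unfolding lead_word_def
proof (rule the_equality)
  fix v assume "v \<in> keys f \<and> (\<forall>w\<in>keys f. w \<noteq> v \<longrightarrow> deglex_less w v)"
  then show "v = u" using assms deglex_less_trans[of u v u] by (metis deglex_less_irrefl)
qed (use assms in blast)

lemma deglex_maximum:
  assumes "finite S" "S \<noteq> {}"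
  shows "\<exists>u\<in>S. \<forall>v\<in>S. v \<noteq> u \<longrightarrow> deglex_less v u"
  using assms
proof (induction S rule: finite_ne_induct)
  case (insert x S)
  then obtain u where u: "u \<in> S" "\<forall>v\<in>S. v \<noteq> u \<longrightarrow> deglex_less v u" by blast
  show ?case
  proof (cases "deglex_less u x")
    case True
    have "deglex_less v x" if "v \<in> S" for v using u that True deglex_less_trans by (cases "v = u") auto
    then show ?thesis by (intro bexI[of _ x]) auto
  next
    case False
    then have "x \<noteq> u \<longrightarrow> deglex_less x u" using deglex_less_total by blast
    then show ?thesis using u by (intro bexI[of _ u]) auto
  qed
qed auto

lemma lead_word_props:
  assumes "f \<noteq> 0"
  shows "lead_word f \<in> keys f"
    "v \<in> keys f \<Longrightarrow> v \<noteq> lead_word f \<Longrightarrow> deglex_less v (lead_word f)"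
proof -
  have "keys f \<noteq> {}" using assms by simp
  then obtain u where u: "u \<in> keys f" "\<forall>v\<in>keys f. v \<noteq> u \<longrightarrow> deglex_less v u"
    using deglex_maximum[of "keys f"] by auto
  then have "lead_word f = u" by (intro lead_wordI) auto
  with u show "lead_word f \<in> keys f"
    "v \<in> keys f \<Longrightarrow> v \<noteq> lead_word f \<Longrightarrow> deglex_less v (lead_word f)" by auto
qed

lemma lead_word_binomial:
  assumes "v = u \<or> deglex_less v u" "v = u \<longrightarrow> c \<noteq> 1"
  shows "lead_word (word_monomial u - single v c) = u"
proof (rule lead_wordI)
  show "u \<in> keys (word_monomial u - single v c)"
    using assms by (auto simp: in_keys_iff lookup_minus lookup_single when_def)
  fix w assume "w \<in> keys (word_monomial u - single v c)" "w \<noteq> u"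
  then show "deglex_less w u"
    using assms by (auto simp: in_keys_iff lookup_minus lookup_single when_def split: if_splits)
qed

section \<open>Reduction modulo the dual relations\<close>

definition dual_relations :: "('x, 'k::field) free_algebra set \<Rightarrow> ('x, 'k) free_algebra set"
  where "dual_relations R = R \<union> {word_monomial [x, x] | x. True}"

text \<open>The coefficients of the relations matter only through being nonzero, so they are left anonymous.\<close>

locale binomial_relations = oriented_swap rk r
  for rk :: "'x::{finite,linorder} \<Rightarrow> int" and r :: "'x \<times> 'x \<Rightarrow> 'x \<times> 'x" +
  fixes R :: "('x, 'k::field) free_algebra set"
  assumes rk_less: "rk x < rk y \<longleftrightarrow> x < y"
    and relation_exists: "y < x \<Longrightarrow>
      \<exists>c. c \<noteq> 0 \<and> word_monomial [x, y] - single [fst (r (x, y)), snd (r (x, y))] c \<in> R"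
begin

lemma sorted_rk [simp]: "sorted (map rk u) \<longleftrightarrow> sorted u"
proof -
  have "rk x \<le> rk y \<longleftrightarrow> x \<le> y" for x y using rk_less[of y x] by (simp add: not_less[symmetric])
  then show ?thesis by (simp add: sorted_map)
qed

lemma lenlex_rk: "(u, v) \<in> lenlex {(x, y). rk x < rk y} \<longleftrightarrow> deglex_less u v"
  by (simp add: deglex_less_def rk_less)

lemma swap_relation:
  "\<exists>c. c \<noteq> 0 \<and> word_monomial [x, y] - single [fst (r (x, y)), snd (r (x, y))] c \<in> relation_ideal R"
proof -
  consider "x = y" | "y < x" | "x < y" by force
  then show ?thesis
  proof cases
    case 1
    then show ?thesis by (intro exI[of _ 1]) (simp add: swap_same)
  next
    case 2
    then show ?thesis using relation_exists relation_ideal_generators by blast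
  next
    case 3
    let ?a = "fst (r (x, y))" and ?b = "snd (r (x, y))"
    have "?b < ?a" using 3 swap_asc[of x y] by (simp add: rk_less)
    then obtain c where c: "c \<noteq> 0" "word_monomial [?a, ?b] - single [x, y] c \<in> R"
      using relation_exists[of ?b ?a] by (auto simp: swap_swap)
    then have "scale (- 1 / c) (word_monomial [?a, ?b] - single [x, y] c) \<in> relation_ideal R"
      using relation_ideal_generators[of R] by (intro relation_ideal_mult_left) blast
    moreover have "scale (- 1 / c) (word_monomial [?a, ?b] - single [x, y] c) =
        word_monomial [x, y] - single [?a, ?b] (1 / c)"
      using c by (intro poly_mapping_eqI) (simp add: lookup_minus lookup_single when_def field_simps)
    ultimately show ?thesis using c by (intro exI[of _ "1 / c"]) simp
  qed
qed

text \<open>Along a chain of swaps the nonzero coefficients of the relations multiply up.\<close>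

lemma equiv_relation:
  "swap_equiv r u v \<Longrightarrow> \<exists>k. k \<noteq> 0 \<and> word_monomial u - single v k \<in> relation_ideal R"
proof (induction rule: rtranclp_induct)
  case base
  show ?case by (intro exI[of _ 1]) simp
next
  case (step v w)
  then obtain k where k: "k \<noteq> 0" "word_monomial u - single v k \<in> relation_ideal R" by blast
  obtain p x y q where vw: "v = p @ x # y # q" "w = p @ fst (r (x, y)) # snd (r (x, y)) # q"
    using step.hyps(2) unfolding swap_step_def by blast
  obtain c where c: "c \<noteq> 0"
    "word_monomial [x, y] - single [fst (r (x, y)), snd (r (x, y))] c \<in> relation_ideal R"
    using swap_relation by blast
  have "single p k * (word_monomial [x, y] - single [fst (r (x, y)), snd (r (x, y))] c)
      * word_monomial q \<in> relation_ideal R"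
    using c by (intro relation_ideal_mult_left relation_ideal_mult_right)
  then have "single v k - single w (k * c) \<in> relation_ideal R"
    by (simp add: algebra_simps single_mult_single vw)
  from relation_ideal_add[OF k(2) this] show ?case using k c by (intro exI[of _ "k * c"]) simp
qed

end

text \<open>Linear independence of the sorted words modulo the ideal is the Groebner property in the form
needed below. It implies uniqueness of sorted words in a class, since two sorted words of the
same class are proportional modulo the ideal.\<close>

locale binomial_algebra = binomial_relations rk r R
  for rk :: "'x::{finite,linorder} \<Rightarrow> int" and r and R :: "('x, 'k::field) free_algebra set" +
  assumes sorted_independent: "f \<in> relation_ideal R \<Longrightarrow> (\<And>u. u \<in> keys f \<Longrightarrow> sorted u) \<Longrightarrow> f = 0"

sublocale binomial_algebra \<subseteq> normal_swap rk r
proof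
  fix u v assume uv: "swap_equiv r u v" "sorted (map rk u)" "sorted (map rk v)"
  then obtain k where k: "k \<noteq> 0" "word_monomial u - single v k \<in> relation_ideal R"
    using equiv_relation by blast
  have "sorted t" if "t \<in> keys (word_monomial u - single v k)" for t
    using that uv by (auto simp: in_keys_iff lookup_minus lookup_single when_def split: if_splits)
  then have "word_monomial u - single v k = 0" using k(2) by (intro sorted_independent)
  then have "lookup (word_monomial u - single v k) v = 0" by simp
  then show "u = v" using k(1) by (simp add: lookup_minus lookup_single when_def split: if_splits)
qed

context binomial_algebra
begin

abbreviation J :: "('x, 'k) free_algebra set" where "J \<equiv> relation_ideal (dual_relations R)"

text \<open>The scalar \<open>k\<close> with \<open>w = k \<cdot> nf w\<close> modulo the ideal.\<close>

definition nf_coeff :: "'x list \<Rightarrow> 'k"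
  where "nf_coeff w = (SOME k. k \<noteq> 0 \<and> word_monomial w - single (nf w) k \<in> relation_ideal R)"

lemma nf_coeff: "nf_coeff w \<noteq> 0" "word_monomial w - single (nf w) (nf_coeff w) \<in> relation_ideal R"
proof -
  have "nf_coeff w \<noteq> 0 \<and> word_monomial w - single (nf w) (nf_coeff w) \<in> relation_ideal R"
    unfolding nf_coeff_def using equiv_relation[OF nf_props(1)[of w]] by (rule someI_ex)
  then show "nf_coeff w \<noteq> 0" "word_monomial w - single (nf w) (nf_coeff w) \<in> relation_ideal R" by auto
qed

lemma nf_coeff_sorted: "sorted w \<Longrightarrow> nf_coeff w = 1"
proof -
  assume w: "sorted w"
  then have nf: "nf w = w" using nf_sorted[of w] by simp
  have "word_monomial w - single w (nf_coeff w) \<in> relation_ideal R" using nf_coeff(2)[of w] nf by simp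
  then have "word_monomial w - single w (nf_coeff w) = 0"
    using w by (rule_tac sorted_independent) (auto simp: in_keys_iff lookup_minus lookup_single when_def split: if_splits)
  then have "lookup (word_monomial w - single w (nf_coeff w)) w = 0" by simp
  then show ?thesis by (simp add: lookup_minus)
qed

definition strict_words :: "'x list set"
  where "strict_words = {u. sorted u \<and> distinct u}"

definition red_word :: "'x list \<Rightarrow> ('x, 'k) free_algebra"
  where "red_word w = (if squarefree_word r w then single (nf w) (nf_coeff w) else 0)"

abbreviation red :: "('x, 'k) free_algebra \<Rightarrow> ('x, 'k) free_algebra"
  where "red \<equiv> lin_ext red_word"

lemma nf_strict: "squarefree_word r w \<longleftrightarrow> nf w \<in> strict_words"
  using nf_props(2)[of w] by (simp add: strict_words_def squarefree_iff_distinct_nf)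

lemma strict_nf: "u \<in> strict_words \<Longrightarrow> nf u = u"
  using nf_sorted[of u] by (simp add: strict_words_def)

lemma strict_squarefree: "u \<in> strict_words \<Longrightarrow> squarefree_word r u"
  by (simp add: nf_strict strict_nf)

lemma red_word_strict: "u \<in> strict_words \<Longrightarrow> red_word u = word_monomial u"
  by (simp add: red_word_def strict_squarefree strict_nf) (simp add: strict_words_def nf_coeff_sorted)

lemma keys_red_word: "keys (red_word w) \<subseteq> {u. u \<in> strict_words \<and> u = nf w}"
  by (auto simp: red_word_def nf_strict split: if_splits)

lemma keys_red: "keys (red f) \<subseteq> strict_words \<inter> nf ` keys f"
  using keys_lin_ext[of red_word f] keys_red_word by fastforce

lemma red_strict: "keys f \<subseteq> strict_words \<Longrightarrow> red f = f"
  using lin_ext_cong[of f red_word word_monomial] red_word_strict lin_ext_id[of f] by auto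

lemma base_ideal_subset: "relation_ideal R \<subseteq> J"
  by (rule relation_ideal_minimal)
    (use relation_ideal_generators[of "dual_relations R"] in
      \<open>auto simp: dual_relations_def relation_ideal_add relation_ideal_mult_left relation_ideal_mult_right\<close>)

text \<open>A word that is not square-free is proportional to a word with a square, which is a multiple of a
dual relation.\<close>

lemma diff_red_word: "word_monomial w - red_word w \<in> J"
proof (cases "squarefree_word r w")
  case True
  then show ?thesis using nf_coeff(2)[of w] base_ideal_subset by (auto simp: red_word_def)
next
  case False
  then obtain p x q where "swap_equiv r w (p @ x # x # q)" unfolding squarefree_word_def by blast
  then obtain k where k: "word_monomial w - single (p @ x # x # q) k \<in> relation_ideal R"
    using equiv_relation by blast
  have "word_monomial [x, x] \<in> J"
    using relation_ideal_generators[of "dual_relations R"] by (auto simp: dual_relations_def)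
  then have "single p k * word_monomial [x, x] * word_monomial q \<in> J"
    by (intro relation_ideal_mult_left relation_ideal_mult_right)
  then have "single (p @ x # x # q) k \<in> J" by (simp add: single_mult_single)
  then have "word_monomial w \<in> J" using k base_ideal_subset relation_ideal_add by fastforce
  then show ?thesis using False by (simp add: red_word_def)
qed

lemma diff_red: "f - red f \<in> J"
proof -
  have "f - red f = (\<Sum>u\<in>keys f. scale (lookup f u) (word_monomial u - red_word u))"
    using lin_ext_id[of f] unfolding lin_ext_def by (simp add: right_diff_distrib sum_subtractf)
  moreover have "\<dots> \<in> J"
    by (intro relation_ideal_sum relation_ideal_mult_left diff_red_word)
  ultimately show ?thesis by simp
qed

text \<open>Replacing words by multiples of their normal forms keeps an element within the ideal, and the
result vanishes by independence of the sorted words. The reduction is obtained from it by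
dropping the sorted words with repeated letters.\<close>

lemma red_base_ideal:
  assumes "f \<in> relation_ideal R" shows "red f = 0"
proof -
  let ?full = "lin_ext (\<lambda>w. single (nf w) (nf_coeff w))"
  \<comment> \<open>Applying \<open>?cut\<close> after \<open>?full\<close> gives the reduction, as a word is square-free exactly if its
    normal form is distinct.\<close>
  let ?cut = "lin_ext (\<lambda>u. if distinct u then word_monomial u else 0)"
  have "f - ?full f = (\<Sum>u\<in>keys f.
      scale (lookup f u) (word_monomial u - single (nf u) (nf_coeff u)))"
    using lin_ext_id[of f] unfolding lin_ext_def by (simp add: right_diff_distrib sum_subtractf)
  moreover have "\<dots> \<in> relation_ideal R"
    by (intro relation_ideal_sum relation_ideal_mult_left nf_coeff(2))
  ultimately have mem: "f - ?full f \<in> relation_ideal R" by simp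
  have "?full f \<in> relation_ideal R" using relation_ideal_diff[OF assms mem] by simp
  moreover have "sorted u" if "u \<in> keys (?full f)" for u
    using that keys_lin_ext[of "\<lambda>w. single (nf w) (nf_coeff w)" f] nf_props(2)
    by (fastforce split: if_splits)
  ultimately have "?full f = 0" by (rule sorted_independent)
  then have "0 = ?cut (?full f)" by simp
  also have "\<dots> = red f"
    unfolding lin_ext_lin_ext by (rule lin_ext_cong) (simp add: red_word_def squarefree_iff_distinct_nf)
  finally show ?thesis by simp
qed

text \<open>The dual ideal is contained in the sum of the ideal of \<open>R\<close> and the span of the words that are
not square-free: this sum is an ideal because prefixes, suffixes and swaps preserve the presence
of a square. The reduction kills both summands.\<close>

theorem dual_ideal_iff: "f \<in> J \<longleftrightarrow> red f = 0"
proof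
  assume "red f = 0"
  then show "f \<in> J" using diff_red[of f] by simp
next
  let ?N = "{h. \<forall>u\<in>keys h. \<not> squarefree_word r u}"
  let ?K = "{g + h | g h. g \<in> relation_ideal R \<and> h \<in> ?N}"
  have N_add: "h + h' \<in> ?N" if "h \<in> ?N" "h' \<in> ?N" for h h'
    using that keys_add[of h h'] by blast
  have N_left: "a * h \<in> ?N" if "h \<in> ?N" for a h
    using that keys_mult_words[of a h] squarefree_word_infix[of r _ _ "[]"] by fastforce
  have N_right: "h * a \<in> ?N" if "h \<in> ?N" for a h
    using that keys_mult_words[of h a] squarefree_word_infix[of r "[]"] by fastforce
  have "J \<subseteq> ?K"
  proof (rule relation_ideal_minimal)
    show "0 \<in> ?K" by (auto intro!: exI[of _ 0])
  next
    fix f g assume "f \<in> ?K" "g \<in> ?K"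
    then obtain f1 f2 g1 g2 where *: "f = f1 + f2" "g = g1 + g2"
      "f1 \<in> relation_ideal R" "g1 \<in> relation_ideal R" "f2 \<in> ?N" "g2 \<in> ?N" by blast
    then have "f + g = (f1 + g1) + (f2 + g2)" by simp
    then show "f + g \<in> ?K" using * relation_ideal_add[of f1 R g1] N_add[of f2 g2] by blast
  next
    fix f a assume "f \<in> ?K"
    then obtain f1 f2 where *: "f = f1 + f2" "f1 \<in> relation_ideal R" "f2 \<in> ?N" by blast
    show "a * f \<in> ?K" "f * a \<in> ?K"
      using * relation_ideal_mult_left[of f1 R a] relation_ideal_mult_right[of f1 R a] N_left[of f2 a] N_right[of f2 a]
      by (auto simp: distrib_left distrib_right)
  next
    show "dual_relations R \<subseteq> ?K"
    proof
      fix g assume "g \<in> dual_relations R"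
      then consider "g \<in> R" | x where "g = word_monomial [x, x]" unfolding dual_relations_def by blast
      then show "g \<in> ?K"
      proof cases
        case 1
        then show ?thesis using relation_ideal_generators[of R] by (intro CollectI exI[of _ g] exI[of _ 0]) auto
      next
        case 2
        have "\<not> squarefree_word r [x, x]" unfolding squarefree_word_def
          by (metis append_Nil rtranclp.rtrancl_refl)
        then show ?thesis using 2 by (intro CollectI exI[of _ 0] exI[of _ g]) auto
      qed
    qed
  qed
  moreover assume "f \<in> J"
  ultimately obtain g h where f: "f = g + h" "g \<in> relation_ideal R" "h \<in> ?N" by blast
  have "red h = lin_ext (\<lambda>_. 0) h" by (rule lin_ext_cong) (use f in \<open>simp add: red_word_def\<close>)
  then have "red h = 0" by (simp add: lin_ext_def)
  then show "red f = 0" using f red_base_ideal[of g] by (simp add: lin_ext_add)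
qed

lemma red_eq_iff: "f - g \<in> J \<longleftrightarrow> red f = red g"
  by (simp add: dual_ideal_iff lin_ext_diff)

lemma red_red [simp]: "red (red f) = red f"
  using diff_red[of f] by (simp add: red_eq_iff)

lemma red_mult_red_left: "red (red f * g) = red (f * g)"
  using relation_ideal_mult_right[OF diff_red[of f], of g] by (metis left_diff_distrib red_eq_iff)

lemma red_mult_red_right: "red (f * red g) = red (f * g)"
  using relation_ideal_mult_left[OF diff_red[of g], of f] by (metis right_diff_distrib red_eq_iff)

text \<open>If the leading word of \<open>f\<close> were strictly ascending, its coefficient would survive the reduction,
for the other words of \<open>f\<close> reduce to smaller words. So it contains a descent or a square of a
letter, and these are the leading words of the dual relations.\<close>

theorem groebner_dual: "groebner_basis (dual_relations R) J"
  unfolding groebner_basis_def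
proof (intro conjI ballI impI)
  show "dual_relations R \<subseteq> J" by (rule relation_ideal_generators)
  fix f assume f: "f \<in> J" "f \<noteq> 0"
  define u where "u = lead_word f"
  note lead = lead_word_props[OF f(2), folded u_def]
  have nf_le': "nf w = w \<or> deglex_less (nf w) w" for w using nf_le[of w] by (simp add: lenlex_rk)
  have "u \<notin> strict_words"
  proof
    assume u: "u \<in> strict_words"
    have "lookup f w * lookup (red_word w) u =
        (if w = u then lookup f u else 0)" if w: "w \<in> keys f" for w
    proof (cases "w = u")
      case True
      then show ?thesis using u by (simp add: red_word_strict)
    next
      case False
      then have "nf w \<noteq> u" using lead(2)[OF w False] nf_le'[of w] deglex_less_trans[of u w u] by auto
      then show ?thesis using False by (simp add: red_word_def lookup_single)
    qed
    then have "lookup (red f) u = lookup f u"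
      unfolding lookup_lin_ext using lead(1) by simp
    then show False using f(1) lead(1) by (simp add: dual_ideal_iff in_keys_iff)
  qed
  then consider "\<not> sorted u" | "sorted u" "\<not> distinct u" by (auto simp: strict_words_def)
  then show "\<exists>g\<in>dual_relations R. g \<noteq> 0 \<and> sublist (lead_word g) (lead_word f)"
  proof cases
    case 1
    then obtain p a b q where w: "u = p @ a # b # q" "rk b < rk a" using not_sorted_descent[of rk u] by auto
    then obtain c where c: "word_monomial [a, b] - single [fst (r (a, b)), snd (r (a, b))] c \<in> R"
      (is "?g \<in> R") using relation_exists[of b a] by (auto simp: rk_less)
    have "deglex_less [fst (r (a, b)), snd (r (a, b))] [a, b]"
      using swap_desc[OF w(2)] lenlex_first_difference[of "fst (r (a, b))" a _ "[snd (r (a, b))]" "[b]" "[]"]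
      by (simp add: deglex_less_def rk_less)
    then have "lead_word ?g = [a, b]" by (intro lead_word_binomial) auto
    moreover have "?g \<noteq> 0"
    proof
      assume "?g = 0"
      then have "lookup ?g [a, b] = 0" by simp
      then show False using swap_fst_neq[of a b] w by (auto simp: lookup_minus lookup_single when_def split: if_splits)
    qed
    ultimately show ?thesis using c w(1) unfolding u_def[symmetric]
      by (intro bexI[of _ ?g]) (auto simp: dual_relations_def sublist_def)
  next
    case 2
    then obtain p a q where w: "u = p @ a # a # q" using sorted_repeat_adjacent[of rk u] inj_rk by auto
    have "lead_word (word_monomial [a, a] :: ('x, 'k) free_algebra) = [a, a]" by (rule lead_wordI) auto
    moreover have "word_monomial [a, a] \<noteq> (0 :: ('x, 'k) free_algebra)"
      using single_zero by (metis lookup_single_eq lookup_zero zero_neq_one)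
    ultimately show ?thesis using w unfolding u_def[symmetric]
      by (intro bexI[of _ "word_monomial [a, a]"]) (auto simp: dual_relations_def sublist_def)
  qed
qed

text \<open>The map \<open>e\<close> adds a letter at either end. By cancellation it sends no other word of the reduced
element to the normal form of \<open>e u\<close>, so the coefficient there is not cancelled.\<close>

lemma red_extended_words_nonzero:
  assumes u: "u \<in> keys (red f)" and square: "squarefree_word r (e u)"
    and cancel: "\<And>v. swap_equiv r (e v) (e u) \<Longrightarrow> swap_equiv r v u"
  shows "lin_ext (\<lambda>v. red_word (e v)) (red f) \<noteq> 0"
proof -
  have "lookup (red f) v * lookup (red_word (e v)) (nf (e u)) =
      (if v = u then lookup (red f) u * nf_coeff (e u) else 0)" if v: "v \<in> keys (red f)" for v
  proof (cases "v = u")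
    case True
    then show ?thesis using square by (simp add: red_word_def)
  next
    case False
    have "u \<in> strict_words" "v \<in> strict_words" using u v keys_red[of f] by auto
    then have "nf (e v) \<noteq> nf (e u)" using False cancel[of v] strict_nf by (metis nf_eq_iff)
    then show ?thesis using False by (simp add: red_word_def lookup_single)
  qed
  then have "lookup (lin_ext (\<lambda>v. red_word (e v)) (red f)) (nf (e u)) =
      lookup (red f) u * nf_coeff (e u)"
    unfolding lookup_lin_ext[of _ "red f"] using u by simp
  then show ?thesis using u nf_coeff(1)[of "e u"] by (auto simp: in_keys_iff)
qed

lemma red_mult_letter_right:
  assumes "red f \<noteq> 0" "\<And>u. u \<in> keys f \<Longrightarrow> length u = d" "d < card (UNIV :: 'x set)"
  shows "\<exists>x. red (f * word_monomial [x]) \<noteq> 0"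
proof -
  obtain u where u: "u \<in> keys (red f)" using lead_word_props(1)[OF assms(1)] by blast
  then have "u \<in> strict_words" "length u = d" using keys_red[of f] assms(2) by auto
  then obtain x where x: "squarefree_word r (u @ [x])"
    using squarefree_extend_right[of u] strict_squarefree assms(3) by auto
  have "red (f * word_monomial [x]) = red (red f * word_monomial [x])" by (simp add: red_mult_red_left)
  also have "\<dots> = lin_ext (\<lambda>v. red_word (v @ [x])) (red f)"
    unfolding mult_lin_ext[of "red f"] lin_ext_lin_ext[of _ _ "red f"] by (simp add: single_mult_single)
  also have "\<dots> \<noteq> 0"
    by (rule red_extended_words_nonzero[where e = "\<lambda>v. v @ [x]", OF u x right_cancel])
  finally show ?thesis ..
qed

lemma red_mult_letter_left:
  assumes "red f \<noteq> 0" "\<And>u. u \<in> keys f \<Longrightarrow> length u = d" "d < card (UNIV :: 'x set)"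
  shows "\<exists>x. red (word_monomial [x] * f) \<noteq> 0"
proof -
  obtain u where u: "u \<in> keys (red f)" using lead_word_props(1)[OF assms(1)] by blast
  then have "u \<in> strict_words" "length u = d" using keys_red[of f] assms(2) by auto
  then obtain x where x: "squarefree_word r (x # u)"
    using squarefree_extend_left[of u] strict_squarefree assms(3) by auto
  have "word_monomial [x] * red f = lin_ext (\<lambda>v. word_monomial (x # v)) (red f)"
    by (subst (1) lin_ext_id[of "red f", symmetric])
      (simp add: lin_ext_def[of _ "red f"] sum_distrib_left scale_central single_mult_single)
  then have "red (word_monomial [x] * f) = lin_ext (\<lambda>v. red_word (x # v)) (red f)"
    by (subst red_mult_red_right[symmetric]) (simp add: lin_ext_lin_ext[of _ _ "red f"])
  also have "\<dots> \<noteq> 0"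
    by (rule red_extended_words_nonzero[where e = "\<lambda>v. x # v", OF u x left_cancel])
  finally show ?thesis ..
qed

text \<open>Multiplication by one letter after the other raises the degree up to the number of letters.\<close>

lemma red_mult_word_right:
  assumes "red f \<noteq> 0" "\<And>u. u \<in> keys f \<Longrightarrow> length u + k = card (UNIV :: 'x set)"
  shows "\<exists>w. length w = k \<and> red (f * word_monomial w) \<noteq> 0"
  using assms
proof (induction k arbitrary: f)
  case 0
  then show ?case by (intro exI[of _ "[]"]) (simp flip: zero_list_def)
next
  case (Suc k)
  have "length u = card (UNIV :: 'x set) - Suc k" if "u \<in> keys f" for u using Suc.prems(2)[OF that] by simp
  moreover obtain u where "u \<in> keys f" using Suc.prems(1) lead_word_props(1)[of f] by fastforce
  then have "card (UNIV :: 'x set) - Suc k < card (UNIV :: 'x set)" using Suc.prems(2) by fastforce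
  ultimately obtain x where x: "red (f * word_monomial [x]) \<noteq> 0"
    using red_mult_letter_right[OF Suc.prems(1)] by blast
  have "length v + k = card (UNIV :: 'x set)" if "v \<in> keys (f * word_monomial [x])" for v
    using that keys_mult_words[of f "word_monomial [x]"] Suc.prems(2) by fastforce
  then obtain w where w: "length w = k" "red (f * word_monomial [x] * word_monomial w) \<noteq> 0"
    using Suc.IH[OF x] by blast
  then show ?case by (intro exI[of _ "x # w"]) (simp add: mult.assoc single_mult_single)
qed

lemma red_mult_word_left:
  assumes "red f \<noteq> 0" "\<And>u. u \<in> keys f \<Longrightarrow> length u + k = card (UNIV :: 'x set)"
  shows "\<exists>w. length w = k \<and> red (word_monomial w * f) \<noteq> 0"
  using assms
proof (induction k arbitrary: f)
  case 0
  then show ?case by (intro exI[of _ "[]"]) simp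
next
  case (Suc k)
  have "length u = card (UNIV :: 'x set) - Suc k" if "u \<in> keys f" for u using Suc.prems(2)[OF that] by simp
  moreover obtain u where "u \<in> keys f" using Suc.prems(1) lead_word_props(1)[of f] by fastforce
  then have "card (UNIV :: 'x set) - Suc k < card (UNIV :: 'x set)" using Suc.prems(2) by fastforce
  ultimately obtain x where x: "red (word_monomial [x] * f) \<noteq> 0"
    using red_mult_letter_left[OF Suc.prems(1)] by blast
  have "length v + k = card (UNIV :: 'x set)" if "v \<in> keys (word_monomial [x] * f)" for v
    using that keys_mult_words[of "word_monomial [x]" f] Suc.prems(2) by fastforce
  then obtain w where w: "length w = k" "red (word_monomial w * (word_monomial [x] * f)) \<noteq> 0"
    using Suc.IH[OF x] by blast
  then show ?case by (intro exI[of _ "w @ [x]"]) (simp add: single_mult_single flip: mult.assoc)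
qed

end

section \<open>Basis, grading and Frobenius duality\<close>

lemma keys_sum_subset: "(\<And>i. i \<in> A \<Longrightarrow> keys (f i) \<subseteq> S) \<Longrightarrow> keys (sum f A) \<subseteq> S"
proof (induction A rule: infinite_finite_induct)
  case (insert a A)
  then show ?case using keys_add[of "f a" "sum f A"] by auto
qed auto

text \<open>A sorted word without repetition is determined by its support, whose indicator is the exponent.\<close>

lemma grassmann_words_eq: "grassmann_words = {u :: 'x::{finite,linorder} list. sorted u \<and> distinct u}"
proof (rule equalityI; rule subsetI)
  fix u :: "'x list" assume "u \<in> grassmann_words"
  then obtain e where u: "u = concat (map (\<lambda>x. replicate (e x) x) (sorted_list_of_set UNIV))" "\<And>x. e x \<le> 1"
    unfolding grassmann_words_def by blast
  have "concat (map (\<lambda>x. replicate (e x) x) xs) = filter (\<lambda>x. e x = 1) xs" for xs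
  proof (induction xs)
    case (Cons x xs)
    have "e x = 0 \<or> e x = 1" using u(2)[of x] by linarith
    then show ?case using Cons by auto
  qed simp
  then show "u \<in> {u. sorted u \<and> distinct u}" using u(1) by (simp add: sorted_wrt_filter)
next
  fix u :: "'x list" assume u: "u \<in> {u. sorted u \<and> distinct u}"
  let ?e = "\<lambda>x. if x \<in> set u then 1 else 0 :: nat"
  have "concat (map (\<lambda>x. replicate (?e x) x) xs) = filter (\<lambda>x. x \<in> set u) xs" for xs
    by (induction xs) auto
  moreover have "filter (\<lambda>x. x \<in> set u) (sorted_list_of_set UNIV) = u"
    using u by (intro sorted_distinct_set_unique) (auto simp: sorted_wrt_filter)
  ultimately show "u \<in> grassmann_words" unfolding grassmann_words_def
    by (intro CollectI exI[of _ ?e]) auto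
qed

definition graded_part :: "nat \<Rightarrow> ('x, 'k::field) free_algebra \<Rightarrow> ('x, 'k) free_algebra"
  where "graded_part i = lin_ext (\<lambda>u. if length u = i then word_monomial u else 0)"

lemma lookup_graded_part:
  "lookup (graded_part i f) u = (if length u = i then lookup f u else 0)"
proof -
  have "lookup (graded_part i f) u =
      (\<Sum>v\<in>keys f. if v = u then (if length u = i then lookup f u else 0) else 0)"
    unfolding graded_part_def lookup_lin_ext
    by (rule sum.cong) (auto simp: lookup_single when_def)
  then show ?thesis by (auto simp: in_keys_iff)
qed

context binomial_algebra
begin

abbreviation \<rho> :: "('x, 'k) free_algebra \<Rightarrow> ('x, 'k) free_algebra set"
  where "\<rho> \<equiv> residue_class (dual_relations R)"

abbreviation F :: "('k, ('x, 'k) free_algebra set) module"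
  where "F \<equiv> presented_algebra (dual_relations R)"

abbreviation G :: "nat \<Rightarrow> ('x, 'k) free_algebra set set"
  where "G \<equiv> length_grading (dual_relations R)"

lemma rho_eq_iff: "\<rho> f = \<rho> g \<longleftrightarrow> red f = red g"
  by (simp add: residue_class_eq_iff red_eq_iff)

lemma rho_red [simp]: "\<rho> (red f) = \<rho> f"
  by (simp add: rho_eq_iff)

lemma rho_eq_0_iff: "\<rho> f = \<rho> 0 \<longleftrightarrow> red f = 0"
  by (simp add: rho_eq_iff)

lemma inj_rho_strict: "inj_on \<rho> {f. keys f \<subseteq> strict_words}"
  by (auto simp: inj_on_def rho_eq_iff red_strict)

lemma inj_words: "inj_on (\<lambda>u. \<rho> (word_monomial u)) strict_words"
proof (rule inj_onI)
  fix u v assume uv: "u \<in> strict_words" "v \<in> strict_words" "\<rho> (word_monomial u) = \<rho> (word_monomial v)"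
  then have "word_monomial u = (word_monomial v :: ('x, 'k) free_algebra)"
    using inj_rho_strict by (auto dest: inj_onD)
  then have "lookup (word_monomial u) v = (lookup (word_monomial v) v :: 'k)" by simp
  then show "u = v" by (simp add: lookup_single when_def split: if_splits)
qed

text \<open>The basis word that represents a residue class.\<close>

definition word_of :: "('x, 'k) free_algebra set \<Rightarrow> 'x list"
  where "word_of = the_inv_into strict_words (\<lambda>u. \<rho> (word_monomial u))"

lemma word_of [simp]: "u \<in> strict_words \<Longrightarrow> word_of (\<rho> (word_monomial u)) = u"
  unfolding word_of_def using inj_words by (rule the_inv_into_f_f)

lemma finsum_words:
  assumes "finite T" "T \<subseteq> (\<lambda>u. \<rho> (word_monomial u)) ` strict_words"
  shows "(\<Oplus>\<^bsub>F\<^esub>v\<in>T. a v \<odot>\<^bsub>F\<^esub> v) = \<rho> (\<Sum>v\<in>T. single (word_of v) (a v))"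
proof -
  interpret assoc_algebra ground_field F by (rule assoc_algebra_presented)
  have "a v \<odot>\<^bsub>F\<^esub> v = \<rho> (single (word_of v) (a v))" if "v \<in> T" for v
    using that assms(2) by (auto simp: presented_algebra_simps)
  then have "(\<Oplus>\<^bsub>F\<^esub>v\<in>T. a v \<odot>\<^bsub>F\<^esub> v) = (\<Oplus>\<^bsub>F\<^esub>v\<in>T. \<rho> (single (word_of v) (a v)))"
    by (intro finsum_cong') (auto simp: presented_algebra_simps)
  then show ?thesis using assms(1) by (simp add: finsum_presented_algebra)
qed

text \<open>Stated for an arbitrary set of strictly ascending words, so that it covers the whole algebra,
its graded pieces, and the augmentation ideal.\<close>

theorem basis_words:
  assumes S: "S \<subseteq> strict_words"
  shows "is_basis ground_field F ((\<lambda>u. \<rho> (word_monomial u)) ` S) (\<rho> ` {f. keys f \<subseteq> S})"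
  unfolding is_basis_def
proof (intro conjI)
  let ?B = "(\<lambda>u. \<rho> (word_monomial u)) ` S"
  have BS: "?B \<subseteq> (\<lambda>u. \<rho> (word_monomial u)) ` strict_words" using S by blast
  show "?B \<subseteq> carrier F" by (auto simp: presented_algebra_simps)
  have inverse: "\<rho> (word_monomial (word_of v)) = v" if v: "v \<in> ?B" for v
  proof -
    obtain u where "u \<in> S" "v = \<rho> (word_monomial u)" using v by blast
    then show ?thesis using S by (simp add: subset_iff)
  qed
  have word_of_in: "word_of v \<in> S" if v: "v \<in> ?B" for v
  proof -
    obtain u where "u \<in> S" "v = \<rho> (word_monomial u)" using v by blast
    then show ?thesis using S by (simp add: subset_iff)
  qed
  have inj: "inj_on word_of T" if "T \<subseteq> ?B" for T
    using that inverse by (intro inj_on_inverseI[of _ "\<lambda>u. \<rho> (word_monomial u)"]) blast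
  show "lin_independent ground_field F ?B"
    unfolding lin_independent_def
  proof (intro allI impI, elim conjE)
    fix a :: "_ \<Rightarrow> 'k" and T
    assume T: "finite T" "T \<subseteq> ?B" "(\<Oplus>\<^bsub>F\<^esub>v\<in>T. a v \<odot>\<^bsub>F\<^esub> v) = \<zero>\<^bsub>F\<^esub>"
    let ?f = "\<Sum>v\<in>T. single (word_of v) (a v)"
    have "keys ?f \<subseteq> strict_words"
      by (rule keys_sum_subset) (use T(2) S word_of_in in \<open>force split: if_splits\<close>)
    moreover have "\<rho> ?f = \<rho> 0" using T finsum_words[of T a] BS by (simp add: presented_algebra_simps)
    ultimately have f: "?f = 0" by (simp add: rho_eq_0_iff red_strict)
    show "\<forall>v\<in>T. a v = \<zero>\<^bsub>ground_field\<^esub>"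
    proof
      fix v assume v: "v \<in> T"
      have "(\<Sum>w\<in>T. lookup (single (word_of w) (a w)) (word_of v)) =
          (\<Sum>w\<in>T. if w = v then a v else 0)"
        using v inj[OF T(2)] by (intro sum.cong) (auto simp: lookup_single when_def dest: inj_onD)
      moreover have "lookup ?f (word_of v) = 0" using f by simp
      ultimately show "a v = \<zero>\<^bsub>ground_field\<^esub>" using v T(1) by (simp add: lookup_sum)
    qed
  qed
  show "lin_span ground_field F ?B = \<rho> ` {f. keys f \<subseteq> S}"
  proof (rule equalityI; rule subsetI)
    fix x assume "x \<in> lin_span ground_field F ?B"
    then obtain a T where T: "x = (\<Oplus>\<^bsub>F\<^esub>v\<in>T. a v \<odot>\<^bsub>F\<^esub> v)" "finite T" "T \<subseteq> ?B"
      unfolding lin_span_def by blast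
    have "keys (\<Sum>v\<in>T. single (word_of v) (a v)) \<subseteq> S"
      by (rule keys_sum_subset) (use T(3) S word_of_in in \<open>force split: if_splits\<close>)
    moreover have "x = \<rho> (\<Sum>v\<in>T. single (word_of v) (a v))"
      using T finsum_words[of T a] BS by simp
    ultimately show "x \<in> \<rho> ` {f. keys f \<subseteq> S}" by blast
  next
    fix x assume "x \<in> \<rho> ` {f. keys f \<subseteq> S}"
    then obtain f where f: "x = \<rho> f" "keys f \<subseteq> S" by blast
    let ?T = "(\<lambda>u. \<rho> (word_monomial u)) ` keys f"
    let ?a = "\<lambda>v. lookup f (word_of v)"
    have TB: "?T \<subseteq> ?B" using f(2) by blast
    have "(\<Oplus>\<^bsub>F\<^esub>v\<in>?T. ?a v \<odot>\<^bsub>F\<^esub> v) = \<rho> (\<Sum>v\<in>?T. single (word_of v) (?a v))"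
      using TB BS by (intro finsum_words) auto
    also have "(\<Sum>v\<in>?T. single (word_of v) (?a v)) =
        (\<Sum>u\<in>keys f. single u (lookup f u))"
      using f(2) S by (subst sum.reindex) (auto intro: inj_on_subset[OF inj_words] intro!: sum.cong simp: subset_iff)
    also have "\<dots> = f" using sum_monomials[of "keys f" f] by simp
    finally have "x = (\<Oplus>\<^bsub>F\<^esub>v\<in>?T. ?a v \<odot>\<^bsub>F\<^esub> v)" using f(1) by simp
    moreover have "?a \<in> ?T \<rightarrow> carrier ground_field" by simp
    ultimately show "x \<in> lin_span ground_field F ?B"
      unfolding lin_span_def using TB by (intro CollectI exI[of _ ?a] exI[of _ ?T] conjI finite_imageI finite_keys)
  qed
qed

definition strict_words_of :: "nat \<Rightarrow> 'x list set"
  where "strict_words_of m = {u \<in> strict_words. length u = m}"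

lemma strict_of_length_subset: "strict_words_of m \<subseteq> strict_words"
  by (auto simp: strict_words_of_def)

text \<open>Reduction preserves the length of words.\<close>

lemma grading_eq: "G m = \<rho> ` {f. keys f \<subseteq> strict_words_of m}"
proof (rule equalityI; rule subsetI)
  fix x assume "x \<in> G m"
  then obtain f where f: "x = \<rho> f" "\<forall>u\<in>keys f. length u = m"
    unfolding length_grading_def by blast
  have "keys (red f) \<subseteq> strict_words_of m"
    using keys_red[of f] f(2) by (auto simp: strict_words_of_def)
  then show "x \<in> \<rho> ` {f. keys f \<subseteq> strict_words_of m}"
    using f(1) by (intro image_eqI[of _ _ "red f"]) auto
qed (auto simp: length_grading_def strict_words_of_def)

lemma carrier_eq: "carrier F = \<rho> ` {f. keys f \<subseteq> strict_words}"
proof (rule equalityI; rule subsetI)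
  fix x assume "x \<in> carrier F"
  then obtain f where f: "x = \<rho> f" by (auto simp: presented_algebra_simps)
  then show "x \<in> \<rho> ` {f. keys f \<subseteq> strict_words}"
    using keys_red[of f] by (intro image_eqI[of _ _ "red f"]) auto
qed (auto simp: presented_algebra_simps)

lemma card_strict_of_length:
  "finite (strict_words_of m)" "card (strict_words_of m) = card (UNIV :: 'x set) choose m"
proof -
  have "bij_betw set (strict_words_of m) {A. A \<subseteq> (UNIV :: 'x set) \<and> card A = m}"
  proof (rule bij_betw_byWitness[where f' = sorted_list_of_set])
    show "\<forall>u\<in>strict_words_of m. sorted_list_of_set (set u) = u"
      unfolding strict_words_of_def strict_words_def
      by (auto intro!: sorted_distinct_set_unique)
    show "set ` strict_words_of m \<subseteq> {A. A \<subseteq> UNIV \<and> card A = m}"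
      unfolding strict_words_of_def strict_words_def by (auto simp: distinct_card)
    show "sorted_list_of_set ` {A. A \<subseteq> UNIV \<and> card A = m} \<subseteq> strict_words_of m"
      unfolding strict_words_of_def strict_words_def by auto
  qed auto
  then show "finite (strict_words_of m)" "card (strict_words_of m) = card (UNIV :: 'x set) choose m"
    using bij_betw_finite n_subsets[of "UNIV :: 'x set" m] bij_betw_same_card by fastforce+
qed

lemma dim_grade: "has_dim ground_field F (G m) (card (UNIV :: 'x set) choose m)"
  unfolding has_dim_def
proof (intro exI conjI)
  let ?B = "(\<lambda>u. \<rho> (word_monomial u)) ` strict_words_of m"
  show "is_basis ground_field F ?B (G m)"
    unfolding grading_eq by (rule basis_words[OF strict_of_length_subset])
  show "finite ?B" using card_strict_of_length by simp
  show "card ?B = card (UNIV :: 'x set) choose m"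
    using card_strict_of_length inj_on_subset[OF inj_words strict_of_length_subset] by (simp add: card_image)
qed

lemma grade_above:
  assumes "card (UNIV :: 'x set) < m" shows "G m = {\<zero>\<^bsub>F\<^esub>}"
proof -
  have "strict_words_of m = {}" using card_strict_of_length[of m] assms by (simp add: binomial_eq_0)
  then show ?thesis by (simp add: grading_eq presented_algebra_simps)
qed

lemma grade_span:
  "G m = lin_span ground_field F ((\<lambda>u. \<rho> (word_monomial u)) ` strict_words_of m)"
  using basis_words[OF strict_of_length_subset, of m] by (simp add: is_basis_def grading_eq)

lemma grade_memI: "(\<And>u. u \<in> keys f \<Longrightarrow> length u = m) \<Longrightarrow> \<rho> f \<in> G m"
  by (auto simp: length_grading_def)

lemma grade_memE:
  assumes "x \<in> G m" obtains f where "x = \<rho> f" "keys f \<subseteq> strict_words_of m"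
  using assms unfolding grading_eq by blast

text \<open>The homogeneous components of a class are those of its reduced representative.\<close>

theorem graded: "graded_algebra ground_field F G"
proof -
  interpret assoc_algebra ground_field F by (rule assoc_algebra_presented)
  show ?thesis
  proof (rule graded_algebra.intro, rule assoc_algebra_presented, rule graded_algebra_axioms.intro)
    fix i
    show "submodule (G i) ground_field F"
    proof (rule submoduleI)
      show "G i \<subseteq> carrier F" by (auto simp: length_grading_def presented_algebra_simps)
      show "\<zero>\<^bsub>F\<^esub> \<in> G i" unfolding presented_algebra_simps by (rule grade_memI) auto
    next
      fix a assume "a \<in> G i"
      then obtain f where f: "a = \<rho> f" "\<forall>u\<in>keys f. length u = i"
        unfolding length_grading_def by blast
      have "\<ominus>\<^bsub>F\<^esub> a = \<rho> (- f)"
        by (rule minus_equality) (auto simp: f presented_algebra_simps)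
      then show "\<ominus>\<^bsub>F\<^esub> a \<in> G i" using f by (auto intro!: grade_memI simp: in_keys_iff)
    next
      fix a b assume "a \<in> G i" "b \<in> G i"
      then obtain f g where fg: "a = \<rho> f" "\<forall>u\<in>keys f. length u = i"
        "b = \<rho> g" "\<forall>u\<in>keys g. length u = i"
        unfolding length_grading_def by blast
      then show "a \<oplus>\<^bsub>F\<^esub> b \<in> G i" using keys_add[of f g]
        by (auto simp: presented_algebra_simps intro!: grade_memI)
    next
      fix c :: 'k and a assume "a \<in> G i"
      then obtain f where f: "a = \<rho> f" "\<forall>u\<in>keys f. length u = i"
        unfolding length_grading_def by blast
      then show "c \<odot>\<^bsub>F\<^esub> a \<in> G i" using keys_scale[of c f]
        by (auto simp: presented_algebra_simps intro!: grade_memI)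
    qed
  next
    show "\<one>\<^bsub>F\<^esub> \<in> G 0" unfolding presented_algebra_simps
      by (rule grade_memI) (simp add: zero_list_def flip: single_one)
  next
    fix x y i j assume "x \<in> G i" "y \<in> G j"
    then obtain f g where fg: "x = \<rho> f" "\<forall>u\<in>keys f. length u = i"
      "y = \<rho> g" "\<forall>u\<in>keys g. length u = j"
      unfolding length_grading_def by blast
    show "x \<otimes>\<^bsub>F\<^esub> y \<in> G (i + j)"
      using fg keys_mult_words[of f g] by (fastforce simp: presented_algebra_simps intro!: grade_memI)
  next
    fix x assume "x \<in> carrier F"
    then obtain f where x: "x = \<rho> f" and f: "keys f \<subseteq> strict_words"
      unfolding carrier_eq by blast
    have part_keys: "keys (graded_part i f) \<subseteq> strict_words_of i" for i
      using f by (auto simp: in_keys_iff lookup_graded_part strict_words_of_def split: if_splits)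
    have part_zero: "\<rho> (graded_part i f) = \<zero>\<^bsub>F\<^esub> \<longleftrightarrow> graded_part i f = 0" for i
      using part_keys[of i] strict_of_length_subset[of i] red_strict[of "graded_part i f"]
      by (auto simp: presented_algebra_simps rho_eq_0_iff)
    let ?h = "\<lambda>i. \<rho> (graded_part i f)"
    show "\<exists>!h. (\<forall>i. h i \<in> G i) \<and> finite {i. h i \<noteq> \<zero>\<^bsub>F\<^esub>} \<and>
        x = (\<Oplus>\<^bsub>F\<^esub>i\<in>{i. h i \<noteq> \<zero>\<^bsub>F\<^esub>}. h i)"
    proof (rule ex1I)
      have sub: "{i. ?h i \<noteq> \<zero>\<^bsub>F\<^esub>} \<subseteq> length ` keys f"
      proof
        fix i assume "i \<in> {i. ?h i \<noteq> \<zero>\<^bsub>F\<^esub>}"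
        then have "graded_part i f \<noteq> 0" by (simp add: part_zero)
        then obtain u where "u \<in> keys (graded_part i f)" using lead_word_props(1) by blast
        then show "i \<in> length ` keys f"
          by (auto simp: in_keys_iff lookup_graded_part split: if_splits)
      qed
      then have fin: "finite {i. ?h i \<noteq> \<zero>\<^bsub>F\<^esub>}" by (rule finite_subset) simp
      have "f = (\<Sum>i\<in>{i. ?h i \<noteq> \<zero>\<^bsub>F\<^esub>}. graded_part i f)"
      proof (rule poly_mapping_eqI)
        fix u
        have "graded_part (length u) f \<noteq> 0" if "u \<in> keys f"
        proof
          assume "graded_part (length u) f = 0"
          then have "lookup (graded_part (length u) f) u = 0" by simp
          then show False using that by (simp add: lookup_graded_part in_keys_iff)
        qed
        then show "lookup f u =
            lookup (\<Sum>i\<in>{i. ?h i \<noteq> \<zero>\<^bsub>F\<^esub>}. graded_part i f) u"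
          using fin by (auto simp: lookup_sum lookup_graded_part part_zero in_keys_iff)
      qed
      then have "x = (\<Oplus>\<^bsub>F\<^esub>i\<in>{i. ?h i \<noteq> \<zero>\<^bsub>F\<^esub>}. ?h i)"
        using x fin by (simp add: finsum_presented_algebra)
      then show "(\<forall>i. ?h i \<in> G i) \<and> finite {i. ?h i \<noteq> \<zero>\<^bsub>F\<^esub>} \<and>
          x = (\<Oplus>\<^bsub>F\<^esub>i\<in>{i. ?h i \<noteq> \<zero>\<^bsub>F\<^esub>}. ?h i)"
        using fin part_keys by (auto simp: grading_eq)
    next
      fix h assume h: "(\<forall>i. h i \<in> G i) \<and> finite {i. h i \<noteq> \<zero>\<^bsub>F\<^esub>} \<and>
          x = (\<Oplus>\<^bsub>F\<^esub>i\<in>{i. h i \<noteq> \<zero>\<^bsub>F\<^esub>}. h i)"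
      have "\<exists>g. h i = \<rho> g \<and> keys g \<subseteq> strict_words_of i" for i
        using h grade_memE[of "h i" i] by metis
      then obtain g where g: "\<And>i. h i = \<rho> (g i)" "\<And>i. keys (g i) \<subseteq> strict_words_of i"
        by metis
      let ?S = "{i. h i \<noteq> \<zero>\<^bsub>F\<^esub>}"
      have "\<rho> f = \<rho> (sum g ?S)" using h x by (simp add: g(1) finsum_presented_algebra)
      moreover have "keys (sum g ?S) \<subseteq> strict_words"
        using g(2) strict_of_length_subset by (intro keys_sum_subset) blast
      ultimately have f_eq: "f = sum g ?S" using f inj_rho_strict by (auto dest: inj_onD)
      have "graded_part i f = (if i \<in> ?S then g i else 0)" for i
      proof (rule poly_mapping_eqI)
        fix u
        have g_zero: "lookup (g j) u = 0" if "length u \<noteq> j" for j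
          using g(2)[of j] that by (auto simp: in_keys_iff strict_words_of_def)
        have "lookup f u = (\<Sum>j\<in>?S. if j = length u then lookup (g j) u else 0)"
          unfolding f_eq lookup_sum by (rule sum.cong) (use g_zero in auto)
        also have "\<dots> = (if length u \<in> ?S then lookup (g (length u)) u else 0)"
          using h by simp
        finally show "lookup (graded_part i f) u = lookup (if i \<in> ?S then g i else 0) u"
          using g_zero[of i] by (auto simp: lookup_graded_part)
      qed
      then show "h = ?h" using g(1) by (auto simp: fun_eq_iff presented_algebra_simps)
    qed
  qed
qed

theorem connected: "connected_grading ground_field F G"
  unfolding connected_grading_def
proof (rule bij_betw_imageI)
  have one: "c \<odot>\<^bsub>F\<^esub> \<one>\<^bsub>F\<^esub> = \<rho> (single [] c)" for c
    by (simp add: presented_algebra_simps)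
  have nil: "[] \<in> strict_words" by (simp add: strict_words_def)
  show "inj_on (\<lambda>c. c \<odot>\<^bsub>F\<^esub> \<one>\<^bsub>F\<^esub>) (carrier ground_field)"
  proof (rule inj_onI)
    fix c d :: 'k assume "c \<odot>\<^bsub>F\<^esub> \<one>\<^bsub>F\<^esub> = d \<odot>\<^bsub>F\<^esub> \<one>\<^bsub>F\<^esub>"
    then have "single ([] :: 'x list) c = single [] d"
      unfolding one using nil by (intro inj_onD[OF inj_rho_strict]) (auto split: if_splits)
    then show "c = d" by (metis lookup_single_eq)
  qed
  show "(\<lambda>c. c \<odot>\<^bsub>F\<^esub> \<one>\<^bsub>F\<^esub>) ` carrier ground_field = G 0"
  proof (rule equalityI; rule subsetI)
    fix x assume "x \<in> G 0"
    then obtain f where f: "x = \<rho> f" "keys f \<subseteq> strict_words_of 0" by (rule grade_memE)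
    then have "keys f \<subseteq> {[]}" by (auto simp: strict_words_of_def)
    then have "f = single [] (lookup f [])" using sum_monomials[of "{[]}" f] by simp
    then show "x \<in> (\<lambda>c. c \<odot>\<^bsub>F\<^esub> \<one>\<^bsub>F\<^esub>) ` carrier ground_field"
      unfolding one using f(1) by (intro image_eqI[of _ _ "lookup f []"]) auto
  qed (auto simp: one intro!: grade_memI split: if_splits)
qed

text \<open>If a homogeneous element is nonzero, it remains nonzero after multiplication by a suitable word
of complementary length.\<close>

theorem frobenius: "frobenius_algebra ground_field F G (card (UNIV :: 'x set))"
  unfolding frobenius_algebra_def
proof (intro conjI allI impI)
  let ?n = "card (UNIV :: 'x set)"
  show "graded_algebra ground_field F G" by (rule graded)
  show "has_dim ground_field F (G ?n) 1" using dim_grade[of ?n] by simp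
  show "G i = {\<zero>\<^bsub>F\<^esub>}" if "?n < i" for i using that by (rule grade_above)
  fix j assume j: "j \<le> ?n"
  show "perfect_pairing ground_field F (G j) (G (?n - j))"
    unfolding perfect_pairing_def
  proof (intro conjI ballI impI)
    show "\<exists>d. has_dim ground_field F (G j) d" "\<exists>d. has_dim ground_field F (G (?n - j)) d"
      using dim_grade by blast+
  next
    fix x assume x: "x \<in> G j" "\<forall>y\<in>G (?n - j). x \<otimes>\<^bsub>F\<^esub> y = \<zero>\<^bsub>F\<^esub>"
    obtain f where f: "x = \<rho> f" "keys f \<subseteq> strict_words_of j" using x(1) by (rule grade_memE)
    then have keys_len: "length u + (?n - j) = ?n" if "u \<in> keys f" for u
      using that j by (auto simp: strict_words_of_def)
    show "x = \<zero>\<^bsub>F\<^esub>"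
    proof (rule ccontr)
      assume "x \<noteq> \<zero>\<^bsub>F\<^esub>"
      then have "red f \<noteq> 0" using f by (simp add: presented_algebra_simps rho_eq_0_iff)
      then obtain w where w: "length w = ?n - j" "red (f * word_monomial w) \<noteq> 0"
        using red_mult_word_right[of f "?n - j"] keys_len by blast
      have "\<rho> (word_monomial w) \<in> G (?n - j)" using w by (intro grade_memI) auto
      then show False using x(2) w f(1) by (auto simp: presented_algebra_simps rho_eq_0_iff)
    qed
  next
    fix x assume x: "x \<in> G (?n - j)" "\<forall>y\<in>G j. y \<otimes>\<^bsub>F\<^esub> x = \<zero>\<^bsub>F\<^esub>"
    obtain f where f: "x = \<rho> f" "keys f \<subseteq> strict_words_of (?n - j)"
      using x(1) by (rule grade_memE)
    then have keys_len: "length u + j = ?n" if "u \<in> keys f" for u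
      using that j by (auto simp: strict_words_of_def)
    show "x = \<zero>\<^bsub>F\<^esub>"
    proof (rule ccontr)
      assume "x \<noteq> \<zero>\<^bsub>F\<^esub>"
      then have "red f \<noteq> 0" using f by (simp add: presented_algebra_simps rho_eq_0_iff)
      then obtain w where w: "length w = j" "red (word_monomial w * f) \<noteq> 0"
        using red_mult_word_left[of f j] keys_len by blast
      have "\<rho> (word_monomial w) \<in> G j" using w by (intro grade_memI) auto
      then show False using x(2) w f(1) by (auto simp: presented_algebra_simps rho_eq_0_iff)
    qed
  qed
qed

end

section \<open>The linear free resolution\<close>

text \<open>On words of a fixed length the degree-lexicographic order is compatible with concatenation on
both sides.\<close>

definition word_le :: "'x::linorder list \<Rightarrow> 'x list \<Rightarrow> bool"
  where "word_le z w \<longleftrightarrow> length z = length w \<and> (z = w \<or> deglex_less z w)"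

lemma word_le_refl [simp]: "word_le w w"
  by (simp add: word_le_def)

lemma word_le_trans: "word_le x y \<Longrightarrow> word_le y z \<Longrightarrow> word_le x z"
  unfolding word_le_def using deglex_less_trans by metis

lemma word_le_antisym: "word_le x y \<Longrightarrow> word_le y x \<Longrightarrow> x = y"
  unfolding word_le_def using deglex_less_trans deglex_less_irrefl by metis

lemma deglex_less_same_length:
  "length z = length w \<Longrightarrow> deglex_less z w \<longleftrightarrow> (z, w) \<in> lex {(x, y). x < y}"
  by (auto simp: deglex_less_def lenlex_conv)

lemma word_le_append: "word_le z w \<Longrightarrow> word_le (p @ z @ q) (p @ w @ q)"
proof -
  have "(p @ z @ q, p @ w @ q) \<in> lex {(x, y). x < y}" if "(z, w) \<in> lex {(x, y). x < y}" "length z = length w"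
    using that by (auto simp: lex_conv) (metis append.assoc append_Cons)
  then show "word_le z w \<Longrightarrow> word_le (p @ z @ q) (p @ w @ q)"
    by (auto simp: word_le_def deglex_less_same_length)
qed

lemma word_le_prepend: "word_le z w \<Longrightarrow> word_le (p @ z) (p @ w)"
  using word_le_append[of z w p "[]"] by simp

lemma word_le_postpend: "word_le z w \<Longrightarrow> word_le (z @ q) (w @ q)"
  using word_le_append[of z w "[]" q] by simp

text \<open>These words index the bases of the free modules in the resolution.\<close>

definition noninc_words :: "nat \<Rightarrow> 'x::linorder list set"
  where "noninc_words i = {c. length c = i \<and> sorted_wrt (\<lambda>x y. y \<le> x) c}"

lemma finite_noninc_words [simp]: "finite (noninc_words i :: 'x::{finite,linorder} list set)"
  unfolding noninc_words_def by (rule finite_subset[OF _ finite_lists_length_eq[of UNIV i]]) auto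

lemma noninc_words_0: "noninc_words 0 = {[]}"
  by (auto simp: noninc_words_def)

lemma noninc_words_SucE:
  assumes "c \<in> noninc_words (Suc i)"
  obtains b c' where "c = b # c'" "c' \<in> noninc_words i" "\<forall>x\<in>set c'. x \<le> b"
  using assms by (cases c) (auto simp: noninc_words_def)

lemma noninc_words_Cons:
  assumes "c \<in> noninc_words i" "c = [] \<or> hd c \<le> a" shows "a # c \<in> noninc_words (Suc i)"
  using assms by (cases c) (auto simp: noninc_words_def)

context binomial_algebra
begin

text \<open>Rows and matrices are indexed by words and have entries in the free algebra. They stand for
their reductions, so that \<open>row_eq\<close> below is equality of rows over the quotient algebra.\<close>

definition row_mult :: "nat \<Rightarrow> ('x list \<Rightarrow> ('x, 'k) free_algebra) \<Rightarrow>
    ('x list \<Rightarrow> 'x list \<Rightarrow> ('x, 'k) free_algebra) \<Rightarrow> 'x list \<Rightarrow> ('x, 'k) free_algebra"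
  where "row_mult i v D c' = (\<Sum>c\<in>noninc_words i. v c * D c c')"

text \<open>The basis word \<open>u\<close> of the entry at \<open>c\<close> is recorded as the concatenation \<open>u @ c\<close>; given the
length of \<open>c\<close> it can be split again. All monomials of a row become comparable in this way.\<close>

definition row_words :: "nat \<Rightarrow> ('x list \<Rightarrow> ('x, 'k) free_algebra) \<Rightarrow> 'x list set"
  where "row_words i v = {u @ c | u c. c \<in> noninc_words i \<and> u \<in> keys (red (v c))}"

definition row_eq :: "nat \<Rightarrow> ('x list \<Rightarrow> ('x, 'k) free_algebra) \<Rightarrow> ('x list \<Rightarrow> ('x, 'k) free_algebra) \<Rightarrow> bool"
  where "row_eq i v w \<longleftrightarrow> (\<forall>c\<in>noninc_words i. red (v c) = red (w c))"

text \<open>The row of the matrix at \<open>c = b # c'\<close> is \<open>b\<close> at position \<open>c'\<close> plus smaller terms, all of them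
linear.\<close>

definition triangular :: "nat \<Rightarrow> ('x list \<Rightarrow> 'x list \<Rightarrow> ('x, 'k) free_algebra) \<Rightarrow> bool"
  where "triangular i D \<longleftrightarrow> (\<forall>c\<in>noninc_words (Suc i).
    (\<forall>c'\<in>noninc_words i. \<forall>u\<in>keys (D c c'). \<exists>x. u = [x] \<and> word_le (x # c') c) \<and>
    lookup (D c (tl c)) [hd c] = 1)"

lemma row_wordsI: "c \<in> noninc_words i \<Longrightarrow> u \<in> keys (red (v c)) \<Longrightarrow> u @ c \<in> row_words i v"
  unfolding row_words_def by blast

lemma row_words_append_iff:
  "c \<in> noninc_words i \<Longrightarrow> u @ c \<in> row_words i v \<longleftrightarrow> u \<in> keys (red (v c))"
  unfolding row_words_def by (auto simp: noninc_words_def)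

lemma finite_row_words: "finite (row_words i v)"
proof -
  have "row_words i v = (\<Union>c\<in>noninc_words i. (\<lambda>u. u @ c) ` keys (red (v c)))"
    unfolding row_words_def by auto
  then show ?thesis by simp
qed

lemma row_words_empty: "row_words i v = {} \<Longrightarrow> c \<in> noninc_words i \<Longrightarrow> red (v c) = 0"
  using row_words_append_iff[of c i _ v] by (metis empty_iff lead_word_props(1))

lemma nf_word_le: "word_le (nf w) w"
  using nf_le[of w] by (auto simp: word_le_def lenlex_rk)

lemma keys_red_mult:
  assumes "t \<in> keys (red (f * g))"
  shows "\<exists>u\<in>keys (red f). \<exists>v\<in>keys g. t = nf (u @ v) \<and> t \<in> strict_words"
  using assms keys_red[of "red f * g"] keys_mult_words[of "red f" g]
  by (fastforce simp: red_mult_red_left)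

lemma lookup_red_mult:
  "lookup (red (f * g)) t = (\<Sum>u\<in>keys (red f). \<Sum>v\<in>keys g.
    lookup (red f) u * lookup g v * lookup (red_word (u @ v)) t)"
proof -
  have "red f * g = (\<Sum>u\<in>keys (red f). \<Sum>v\<in>keys g.
      single (u @ v) (lookup (red f) u * lookup g v))"
    by (subst sum_monomials[of "keys (red f)" "red f"], simp, simp)
      (subst sum_monomials[of "keys g" g],
        simp_all add: sum_product single_mult_single)
  then have "red (red f * g) = (\<Sum>u\<in>keys (red f). \<Sum>v\<in>keys g.
      scale (lookup (red f) u * lookup g v) (red_word (u @ v)))"
    by (simp add: lin_ext_sum)
  then show ?thesis by (simp add: red_mult_red_left lookup_sum)
qed

text \<open>Neither the matrix nor the reduction of products increases the recorded words.\<close>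

lemma row_words_mult_le:
  assumes D: "triangular i D" and z: "z \<in> row_words i (row_mult (Suc i) v D)"
  shows "\<exists>w\<in>row_words (Suc i) v. word_le z w"
proof -
  obtain t c' where t: "z = t @ c'" "c' \<in> noninc_words i" "t \<in> keys (red (row_mult (Suc i) v D c'))"
    using z unfolding row_words_def by blast
  have "red (row_mult (Suc i) v D c') = (\<Sum>c\<in>noninc_words (Suc i). red (v c * D c c'))"
    by (simp add: row_mult_def lin_ext_sum)
  then obtain c where c: "c \<in> noninc_words (Suc i)" "t \<in> keys (red (v c * D c c'))"
    using t(3) keys_sum_subset[of "noninc_words (Suc i)" "\<lambda>c. red (v c * D c c')"
        "\<Union>c\<in>noninc_words (Suc i). keys (red (v c * D c c'))"] by auto
  then obtain u w where uw: "u \<in> keys (red (v c))" "w \<in> keys (D c c')" "t = nf (u @ w)"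
    using keys_red_mult by blast
  then obtain x where x: "w = [x]" "word_le (x # c') c" using D c(1) t(2) unfolding triangular_def by blast
  have "word_le (t @ c') ((u @ [x]) @ c')" unfolding uw(3) x(1) by (intro word_le_postpend nf_word_le)
  also have "(u @ [x]) @ c' = u @ x # c'" by simp
  finally have "word_le z (u @ c)" using word_le_prepend[OF x(2), of u] t(1) word_le_trans by blast
  then show ?thesis using row_wordsI[OF c(1), of u v] uw(1) by blast
qed

lemma strict_prefix: "u @ v \<in> strict_words \<Longrightarrow> u \<in> strict_words"
  by (auto simp: strict_words_def sorted_append)

text \<open>The word \<open>u c\<close> is sent to itself with the first letter of \<open>c\<close> moved over, provided that this
results in a strictly ascending word. If \<open>u c\<close> is maximal in the row, no other monomial of the
row reaches this word.\<close>

lemma leading_coeff_row_mult: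
  assumes D: "triangular i D" and c: "c \<in> noninc_words (Suc i)"
    and u: "u @ [hd c] \<in> strict_words"
    and max: "\<And>w. w \<in> row_words (Suc i) v \<Longrightarrow> word_le (u @ c) w \<Longrightarrow> w = u @ c"
  shows "lookup (red (row_mult (Suc i) v D (tl c))) (u @ [hd c]) = lookup (red (v c)) u"
proof -
  obtain b c' where bc: "c = b # c'" "c' \<in> noninc_words i" using noninc_words_SucE[OF c] by blast
  have only: "c2 = c \<and> u2 = u \<and> w2 = [b]"
    if H: "c2 \<in> noninc_words (Suc i)" "u2 \<in> keys (red (v c2))" "w2 \<in> keys (D c2 c')"
      "nf (u2 @ w2) = u @ [b]" for c2 u2 w2
  proof -
    obtain x where x: "w2 = [x]" "word_le (x # c') c2"
      using D H(1,3) bc(2) unfolding triangular_def by blast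
    have le1: "word_le ((u @ [b]) @ c') ((u2 @ [x]) @ c')"
      unfolding H(4)[symmetric] x(1) by (intro word_le_postpend nf_word_le)
    have le2: "word_le (u2 @ x # c') (u2 @ c2)" by (rule word_le_prepend[OF x(2)])
    have le1': "word_le (u @ c) (u2 @ x # c')" using le1 bc(1) by simp
    have eq: "u2 @ c2 = u @ c" by (rule max[OF row_wordsI[of _ _ _ v, OF H(1,2)] word_le_trans[OF le1' le2]])
    have "u2 @ x # c' = u @ c" by (rule word_le_antisym[OF le2[unfolded eq] le1'])
    moreover have "u2 = u \<and> c2 = c" using eq H(1) c by (simp add: noninc_words_def)
    ultimately show ?thesis using x(1) bc(1) by simp
  qed
  have "lookup (red (row_mult (Suc i) v D c')) (u @ [b]) =
      (\<Sum>c2\<in>noninc_words (Suc i). lookup (red (v c2 * D c2 c')) (u @ [b]))"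
    by (simp add: row_mult_def lin_ext_sum lookup_sum)
  also have "\<dots> = (\<Sum>c2\<in>noninc_words (Suc i). if c2 = c then lookup (red (v c)) u else 0)"
  proof (rule sum.cong[OF refl])
    fix c2 :: "'x list" assume c2: "c2 \<in> noninc_words (Suc i)"
    show "lookup (red (v c2 * D c2 c')) (u @ [b]) =
        (if c2 = c then lookup (red (v c)) u else 0)"
    proof (cases "c2 = c")
      case False
      have "u @ [b] \<notin> keys (red (v c2 * D c2 c'))"
      proof
        assume "u @ [b] \<in> keys (red (v c2 * D c2 c'))"
        then obtain u2 w2 where "u2 \<in> keys (red (v c2))" "w2 \<in> keys (D c2 c')"
          "u @ [b] = nf (u2 @ w2)" using keys_red_mult by blast
        then show False using only[OF c2, of u2 w2] False by simp
      qed
      then show ?thesis using False by (simp add: in_keys_iff)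
    next
      case True
      have one: "lookup (D c c') [b] = 1" using D c bc(1) unfolding triangular_def by fastforce
      have rw: "red_word (u @ [b]) = word_monomial (u @ [b])" using u bc(1) by (simp add: red_word_strict)
      have "lookup (red (v c) ) u2 * lookup (D c c') w2 *
          lookup (red_word (u2 @ w2)) (u @ [b]) =
          (if w2 = [b] then if u2 = u then lookup (red (v c)) u else 0 else 0)"
        if "u2 \<in> keys (red (v c))" "w2 \<in> keys (D c c')" for u2 w2
      proof (cases "nf (u2 @ w2) = u @ [b]")
        case True
        then show ?thesis using only[OF c that] one rw by simp
      next
        case False
        then have "lookup (red_word (u2 @ w2)) (u @ [b]) = 0"
          by (simp add: red_word_def lookup_single)
        moreover have "\<not> (u2 = u \<and> w2 = [b])" using False u bc(1) strict_nf by auto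
        ultimately show ?thesis by auto
      qed
      then have "lookup (red (v c * D c c')) (u @ [b]) =
          (\<Sum>u2\<in>keys (red (v c)). \<Sum>w2\<in>keys (D c c').
            if w2 = [b] then if u2 = u then lookup (red (v c)) u else 0 else 0)"
        unfolding lookup_red_mult by (intro sum.cong refl) auto
      also have "\<dots> = lookup (red (v c)) u"
        using one by (auto simp: in_keys_iff)
      finally show ?thesis using True by simp
    qed
  qed
  also have "\<dots> = lookup (red (v c)) u" using c by simp
  finally show ?thesis using bc(1) by simp
qed

lemma wf_deglex: "wf {(z :: 'x list, w). deglex_less z w}"
  using wf_lenlex[OF wf_letters] by (simp add: deglex_less_def rk_less)

lemma red_add: "red (f + g) = red f + red g" and red_diff: "red (f - g) = red f - red g"
  by (simp_all add: lin_ext_add lin_ext_diff)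

lemma row_mult_add: "row_mult i (\<lambda>c. v c + w c) D c' = row_mult i v D c' + row_mult i w D c'"
  by (simp add: row_mult_def distrib_right sum.distrib)

lemma row_mult_diff: "row_mult i (\<lambda>c. v c - w c) D c' = row_mult i v D c' - row_mult i w D c'"
  by (simp add: row_mult_def left_diff_distrib sum_subtractf)

lemma row_mult_unit: "c \<in> noninc_words i \<Longrightarrow> row_mult i (\<lambda>c2. if c2 = c then s else 0) D c' = s * D c c'"
proof -
  assume c: "c \<in> noninc_words i"
  have "row_mult i (\<lambda>c2. if c2 = c then s else 0) D c' = (\<Sum>c2\<in>noninc_words i. if c2 = c then s * D c c' else 0)"
    unfolding row_mult_def by (rule sum.cong) auto
  then show ?thesis using c by simp
qed

text \<open>The division algorithm. \<open>Ker\<close> is a class of rows, stable under subtraction of multiples of the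
rows of \<open>D\<close>, in which every leading word is that of a multiple of a row of \<open>D\<close>. Subtracting this
multiple lowers the leading word, and the process ends as words are well-ordered. The predicate
\<open>Q\<close> records that no word of the preimage exceeds the words of \<open>v\<close>.\<close>

lemma triangular_preimage:
  assumes D: "triangular i D"
    and K1: "\<And>v s c. Ker v \<Longrightarrow> c \<in> noninc_words (Suc i) \<Longrightarrow> Ker (\<lambda>c'. v c' - s * D c c')"
    and K2: "\<And>v w. Ker v \<Longrightarrow> w \<in> row_words i v \<Longrightarrow> (\<And>z. z \<in> row_words i v \<Longrightarrow> z \<noteq> w \<Longrightarrow> deglex_less z w) \<Longrightarrow>
      \<exists>u c. c \<in> noninc_words (Suc i) \<and> u @ [hd c] \<in> strict_words \<and> w = u @ c"
    and Q: "\<And>w z. Q w \<Longrightarrow> word_le z w \<Longrightarrow> Q z"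
    and v: "Ker v" "\<And>w. w \<in> row_words i v \<Longrightarrow> Q w"
  shows "\<exists>y. row_eq i v (row_mult (Suc i) y D) \<and> (\<forall>w\<in>row_words (Suc i) y. Q w)"
proof -
  let ?goal = "\<lambda>v. \<exists>y. row_eq i v (row_mult (Suc i) y D) \<and> (\<forall>w\<in>row_words (Suc i) y. Q w)"
  have reduce: "?goal v"
    if v: "Ker v" "\<And>w. w \<in> row_words i v \<Longrightarrow> Q w" "w \<in> row_words i v"
      "\<And>z. z \<in> row_words i v \<Longrightarrow> z \<noteq> w \<Longrightarrow> deglex_less z w"
      and smaller: "\<And>v'. Ker v' \<Longrightarrow> (\<And>z. z \<in> row_words i v' \<Longrightarrow> Q z) \<Longrightarrow>
        (\<And>z. z \<in> row_words i v' \<Longrightarrow> deglex_less z w) \<Longrightarrow> ?goal v'" for v w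
  proof -
    obtain u c where uc: "c \<in> noninc_words (Suc i)" "u @ [hd c] \<in> strict_words" "w = u @ c"
      using K2[OF v(1,3,4)] by blast
    obtain b c1 where bc: "c = b # c1" "c1 \<in> noninc_words i" using noninc_words_SucE[OF uc(1)] by blast
    \<comment> \<open>The multiple of the row of \<open>D\<close> at \<open>c\<close> that cancels the leading term.\<close>
    define s where "s = single u (lookup (red (v c1)) (u @ [b]))"
    define y0 where "y0 = (\<lambda>c2. if c2 = c then s else 0)"
    define v' where "v' = (\<lambda>c'. v c' - s * D c c')"
    have u: "u \<in> strict_words" using uc(2) by (rule strict_prefix)
    have red_s: "red s = s" unfolding s_def using u by (intro red_strict) (auto split: if_splits)
    have y0D: "row_mult (Suc i) y0 D = (\<lambda>c'. s * D c c')"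
      unfolding y0_def by (rule ext, rule row_mult_unit[OF uc(1)])
    have supp_y0: "z = w" if "z \<in> row_words (Suc i) y0" for z
      using that red_s unfolding row_words_def y0_def uc(3) s_def by (auto split: if_splits)
    have supp_s: "word_le z w" if "z \<in> row_words i (\<lambda>c'. s * D c c')" for z
      using row_words_mult_le[OF D, of z y0] that supp_y0 unfolding y0D by blast
    have supp_v': "z \<in> row_words i v \<or> z \<in> row_words i (\<lambda>c'. s * D c c')" if "z \<in> row_words i v'" for z
      using that keys_diff unfolding row_words_def v'_def red_diff by fast
    have lead: "lookup (red (s * D c c1)) (u @ [b]) = lookup (red (v c1)) (u @ [b])"
    proof -
      have "lookup (red (row_mult (Suc i) y0 D (tl c))) (u @ [hd c]) = lookup (red (y0 c)) u"
        using supp_y0 uc(3) by (intro leading_coeff_row_mult[OF D uc(1,2)]) auto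
      then show ?thesis using red_s by (simp add: y0D bc(1)) (simp add: y0_def bc(1) s_def)
    qed
    have w_notin: "w \<notin> row_words i v'"
    proof -
      have "w = (u @ [b]) @ c1" using uc(3) bc(1) by simp
      then show ?thesis using bc(2) lead
        by (simp only: row_words_append_iff v'_def red_diff in_keys_iff lookup_minus) simp
    qed
    have "?goal v'"
    proof (rule smaller)
      show "Ker v'" unfolding v'_def by (rule K1[OF v(1) uc(1)])
      fix z assume z: "z \<in> row_words i v'"
      show "Q z" using supp_v'[OF z] v(2) supp_s Q[OF v(2)[OF v(3)]] by blast
      show "deglex_less z w" using supp_v'[OF z] v(4)[of z] supp_s[of z] z w_notin
        unfolding word_le_def by blast
    qed
    then obtain y where y: "row_eq i v' (row_mult (Suc i) y D)" "\<forall>w\<in>row_words (Suc i) y. Q w" by blast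
    have "row_eq i v (row_mult (Suc i) (\<lambda>c. y c + y0 c) D)"
      using y(1) unfolding row_eq_def v'_def by (auto simp: row_mult_add y0D red_add red_diff algebra_simps)
    moreover have "Q z" if "z \<in> row_words (Suc i) (\<lambda>c. y c + y0 c)" for z
    proof -
      have "z \<in> row_words (Suc i) y \<or> z \<in> row_words (Suc i) y0"
        using that keys_add unfolding row_words_def red_add by fast
      then show ?thesis using y(2) supp_y0 v(2,3) by blast
    qed
    ultimately show ?thesis by blast
  qed
  have empty: "?goal v" if "row_words i v = {}" for v
  proof -
    have "row_eq i v (row_mult (Suc i) (\<lambda>_. 0) D)"
      using row_words_empty[OF that] by (simp add: row_eq_def row_mult_def)
    moreover have "row_words (Suc i) (\<lambda>_. 0) = {}" by (simp add: row_words_def)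
    ultimately show ?thesis by blast
  qed
  have bounded: "\<forall>v. Ker v \<longrightarrow> (\<forall>z\<in>row_words i v. Q z) \<longrightarrow> (\<forall>z\<in>row_words i v. deglex_less z w) \<longrightarrow> ?goal v" for w
  proof (induction w rule: wf_induct_rule[OF wf_deglex])
    case (1 w)
    show ?case
    proof (intro allI impI)
      fix v assume v: "Ker v" "\<forall>z\<in>row_words i v. Q z" "\<forall>z\<in>row_words i v. deglex_less z w"
      show "?goal v"
      proof (cases "row_words i v = {}")
        case False
        then obtain w' where w': "w' \<in> row_words i v" "\<forall>z\<in>row_words i v. z \<noteq> w' \<longrightarrow> deglex_less z w'"
          using deglex_maximum[OF finite_row_words] by blast
        then show ?thesis using v 1[of w'] by - (rule reduce[of v w'], auto)
      qed (rule empty)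
    qed
  qed
  show ?thesis
  proof (cases "row_words i v = {}")
    case False
    then obtain w' where w': "w' \<in> row_words i v" "\<forall>z\<in>row_words i v. z \<noteq> w' \<longrightarrow> deglex_less z w'"
      using deglex_maximum[OF finite_row_words] by blast
    then show ?thesis using v bounded[of w'] by - (rule reduce[of v w'], auto)
  qed (rule empty)
qed

text \<open>An element of the image has a preimage that does not use words larger than its own.\<close>

definition lifts_below :: "nat \<Rightarrow> ('x list \<Rightarrow> 'x list \<Rightarrow> ('x, 'k) free_algebra) \<Rightarrow> bool"
  where "lifts_below i D \<longleftrightarrow> (\<forall>Q v y0. (\<forall>w z. Q w \<longrightarrow> word_le z w \<longrightarrow> Q z) \<longrightarrow>
    row_eq i v (row_mult (Suc i) y0 D) \<longrightarrow> (\<forall>w\<in>row_words i v. Q w) \<longrightarrow>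
    (\<exists>y. row_eq i v (row_mult (Suc i) y D) \<and> (\<forall>w\<in>row_words (Suc i) y. Q w)))"

text \<open>For \<open>c = a # c'\<close> start from the unit row at \<open>c'\<close> multiplied by \<open>a\<close>. As \<open>a\<close> is at least the first
letter of \<open>c'\<close>, its image under \<open>D\<close> has only words strictly below \<open>c\<close>. A preimage with words
below \<open>c\<close> exists, and subtracting it gives an element of the kernel with leading word \<open>c\<close>.\<close>

lemma next_matrix:
  assumes D: "triangular i D" and small: "lifts_below i D"
  shows "\<exists>D'. triangular (Suc i) D' \<and>
    (\<forall>c\<in>noninc_words (Suc (Suc i)). row_eq i (row_mult (Suc i) (D' c) D) (\<lambda>_. 0))"
proof -
  have "\<exists>d. row_eq i (row_mult (Suc i) d D) (\<lambda>_. 0) \<and>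
      (\<forall>c'\<in>noninc_words (Suc i). \<forall>u\<in>keys (d c'). \<exists>x. u = [x] \<and> word_le (x # c') c) \<and>
      lookup (d (tl c)) [hd c] = 1" if c: "c \<in> noninc_words (Suc (Suc i))" for c
  proof -
    obtain a c1 where ac: "c = a # c1" "c1 \<in> noninc_words (Suc i)" "\<forall>x\<in>set c1. x \<le> a"
      using noninc_words_SucE[OF c] by blast
    \<comment> \<open>Let \<open>z\<close> be the image of the unit row multiplied by \<open>a\<close>, and \<open>Q\<close> the words strictly below
      \<open>c\<close>.\<close>
    define Q where "Q w \<longleftrightarrow> word_le w c \<and> w \<noteq> c" for w
    define z where "z c' = word_monomial [a] * D c1 c'" for c'
    define y0 where "y0 = (\<lambda>c2. if c2 = c1 then word_monomial [a] else 0 :: ('x, 'k) free_algebra)"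
    have z: "row_eq i z (row_mult (Suc i) y0 D)"
      unfolding row_eq_def y0_def z_def using row_mult_unit[OF ac(2)] by simp
    have a: "red (word_monomial [a]) = word_monomial [a]" by (rule red_strict) (simp add: strict_words_def)
    have "Q w" if w: "w \<in> row_words i z" for w
    proof -
      obtain t c' where t: "w = t @ c'" "c' \<in> noninc_words i" "t \<in> keys (red (z c'))"
        using w unfolding row_words_def by blast
      then obtain v where v: "v \<in> keys (D c1 c')" "t = nf (a # v)" "t \<in> strict_words"
        using keys_red_mult[of t "word_monomial [a]" "D c1 c'", unfolded a] by (auto simp: z_def)
      then obtain x where x: "v = [x]" "word_le (x # c') c1" using D ac(2) t(2) unfolding triangular_def by blast
      have le1: "word_le w ([a, x] @ c')" unfolding t(1) v(2) x(1) by (intro word_le_postpend nf_word_le)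
      have le2: "word_le ([a] @ x # c') ([a] @ c1)" by (rule word_le_prepend[OF x(2)])
      have "w \<noteq> c"
      proof
        assume "w = c"
        then have "c = [a, x] @ c'" using le1 le2 ac(1) by (intro word_le_antisym) auto
        then have "t = [a, x]" "x \<in> set c1" using \<open>w = c\<close> t(1) ac(1) by auto
        then show False using v(3) ac(3) by (auto simp: strict_words_def)
      qed
      then show ?thesis using word_le_trans[of w "[a, x] @ c'" c] le1 le2 ac(1) unfolding Q_def by simp
    qed
    moreover have "Q z'" if "Q w" "word_le z' w" for w z'
      using that word_le_trans word_le_antisym unfolding Q_def by blast
    ultimately obtain y where y: "row_eq i z (row_mult (Suc i) y D)" "\<And>w. w \<in> row_words (Suc i) y \<Longrightarrow> Q w"
      using small z unfolding lifts_below_def by metis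
    define d where "d c' = y0 c' - red (y c')" for c'
    have "row_eq i (row_mult (Suc i) d D) (\<lambda>_. 0)"
      unfolding row_eq_def
    proof
      fix c' :: "'x list" assume c': "c' \<in> noninc_words i"
      have "red (row_mult (Suc i) (\<lambda>c. red (y c)) D c') = red (row_mult (Suc i) y D c')"
        by (simp add: row_mult_def lin_ext_sum red_mult_red_left)
      then show "red (row_mult (Suc i) d D c') = red 0"
        using z y(1) c' unfolding d_def row_mult_diff red_diff row_eq_def by simp
    qed
    moreover have "\<exists>x. u = [x] \<and> word_le (x # c') c"
      if "c' \<in> noninc_words (Suc i)" "u \<in> keys (d c')" for c' u
    proof -
      have "u \<in> keys (y0 c') \<or> u \<in> keys (red (y c'))"
        using that(2) keys_diff[of "y0 c'" "red (y c')"] unfolding d_def by blast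
      then show ?thesis
      proof
        assume "u \<in> keys (y0 c')"
        then show ?thesis using ac(1) by (auto simp: y0_def split: if_splits)
      next
        assume "u \<in> keys (red (y c'))"
        then have "word_le (u @ c') c" using y(2) row_wordsI[OF that(1)] unfolding Q_def by blast
        then show ?thesis using that(1) c
          by (cases u) (auto simp: word_le_def noninc_words_def)
      qed
    qed
    moreover have "lookup (d (tl c)) [hd c] = 1"
    proof -
      have "[a] \<notin> keys (red (y c1))"
        using y(2)[of "[a] @ c1"] row_wordsI[OF ac(2), of "[a]" y] ac(1) unfolding Q_def by auto
      then show ?thesis by (simp add: d_def y0_def ac(1) lookup_minus in_keys_iff)
    qed
    ultimately show ?thesis by blast
  qed
  then obtain D' where "\<And>c. c \<in> noninc_words (Suc (Suc i)) \<Longrightarrow> row_eq i (row_mult (Suc i) (D' c) D) (\<lambda>_. 0) \<and>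
      (\<forall>c'\<in>noninc_words (Suc i). \<forall>u\<in>keys (D' c c'). \<exists>x. u = [x] \<and> word_le (x # c') c) \<and>
      lookup (D' c (tl c)) [hd c] = 1" by metis
  then show ?thesis unfolding triangular_def by (intro exI[of _ D']) blast
qed

text \<open>If \<open>u c\<close> is the leading word of an element of the kernel, then the last letter of \<open>u\<close> is at
least the first letter of \<open>c\<close>, for otherwise the leading coefficient would survive the
multiplication by \<open>D\<close>. So this letter can be moved to \<open>c\<close>, keeping \<open>c\<close> nonincreasing, and
\<open>triangular_preimage\<close> applies.\<close>

lemma next_exact:
  assumes D: "triangular i D" and D': "triangular (Suc i) D'"
    and zero: "\<And>c. c \<in> noninc_words (Suc (Suc i)) \<Longrightarrow> row_eq i (row_mult (Suc i) (D' c) D) (\<lambda>_. 0)"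
    and Q: "\<And>w z. Q w \<Longrightarrow> word_le z w \<Longrightarrow> Q z"
    and v: "row_eq i (row_mult (Suc i) v D) (\<lambda>_. 0)" "\<And>w. w \<in> row_words (Suc i) v \<Longrightarrow> Q w"
  shows "\<exists>y. row_eq (Suc i) v (row_mult (Suc (Suc i)) y D') \<and> (\<forall>w\<in>row_words (Suc (Suc i)) y. Q w)"
proof (rule triangular_preimage[where Ker = "\<lambda>v. row_eq i (row_mult (Suc i) v D) (\<lambda>_. 0)"
      and D = D' and i = "Suc i" and v = v and Q = Q])
  fix v s and c :: "'x list" assume v: "row_eq i (row_mult (Suc i) v D) (\<lambda>_. 0)" and c: "c \<in> noninc_words (Suc (Suc i))"
  have "row_mult (Suc i) (\<lambda>c'. s * D' c c') D c'' = s * row_mult (Suc i) (D' c) D c''" for c''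
    by (simp add: row_mult_def sum_distrib_left mult.assoc)
  moreover have "red (s * row_mult (Suc i) (D' c) D c'') = 0" if "c'' \<in> noninc_words i" for c''
    using zero[OF c] that red_mult_red_right[of s "row_mult (Suc i) (D' c) D c''"] by (simp add: row_eq_def)
  ultimately show "row_eq i (row_mult (Suc i) (\<lambda>c'. v c' - s * D' c c') D) (\<lambda>_. 0)"
    using v by (simp add: row_eq_def row_mult_diff red_diff)
next
  fix v w assume v: "row_eq i (row_mult (Suc i) v D) (\<lambda>_. 0)" and w: "w \<in> row_words (Suc i) v"
    and max: "\<And>z. z \<in> row_words (Suc i) v \<Longrightarrow> z \<noteq> w \<Longrightarrow> deglex_less z w"
  obtain u c where uc: "w = u @ c" "c \<in> noninc_words (Suc i)" "u \<in> keys (red (v c))"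
    using w unfolding row_words_def by blast
  obtain b c' where bc: "c = b # c'" "c' \<in> noninc_words i" using noninc_words_SucE[OF uc(2)] by blast
  have u: "u \<in> strict_words" using uc(3) keys_red by blast
  have not_strict: "u @ [hd c] \<notin> strict_words"
  proof
    assume s: "u @ [hd c] \<in> strict_words"
    have "lookup (red (row_mult (Suc i) v D (tl c))) (u @ [hd c]) = lookup (red (v c)) u"
    proof (rule leading_coeff_row_mult[OF D uc(2) s])
      fix z assume "z \<in> row_words (Suc i) v" "word_le (u @ c) z"
      then show "z = u @ c" using max[of z] uc(1) deglex_less_trans[of z w z]
        unfolding word_le_def by auto
    qed
    moreover have "red (row_mult (Suc i) v D c') = 0" using v bc(2) by (simp add: row_eq_def)
    ultimately show False using uc(3) bc(1) by (simp add: in_keys_iff)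
  qed
  then have "u \<noteq> []" using bc(1) by (auto simp: strict_words_def)
  then obtain u0 a where u0: "u = u0 @ [a]" by (metis rev_exhaust)
  have "b \<le> a"
  proof (rule ccontr)
    assume "\<not> b \<le> a"
    then have "u @ [b] \<in> strict_words" using u unfolding u0 by (fastforce simp: strict_words_def sorted_append)
    then show False using not_strict bc(1) by simp
  qed
  then have "a # c \<in> noninc_words (Suc (Suc i))" using uc(2) bc(1) by (intro noninc_words_Cons) auto
  then show "\<exists>u c. c \<in> noninc_words (Suc (Suc i)) \<and> u @ [hd c] \<in> strict_words \<and> w = u @ c"
    using u uc(1) unfolding u0 by (intro exI[of _ u0] exI[of _ "a # c"]) simp
qed (use D' Q v in auto)

lemma row_mult_image_in_kernel:
  assumes zero: "\<And>c. c \<in> noninc_words (Suc (Suc i)) \<Longrightarrow> row_eq i (row_mult (Suc i) (D' c) D) (\<lambda>_. 0)"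
    and v: "row_eq (Suc i) v (row_mult (Suc (Suc i)) y D')"
  shows "row_eq i (row_mult (Suc i) v D) (\<lambda>_. 0)"
  unfolding row_eq_def
proof
  fix c'' :: "'x list" assume c'': "c'' \<in> noninc_words i"
  have "red (row_mult (Suc i) v D c'') = (\<Sum>c'\<in>noninc_words (Suc i). red (red (v c') * D c' c''))"
    by (simp add: row_mult_def lin_ext_sum red_mult_red_left)
  also have "\<dots> = (\<Sum>c'\<in>noninc_words (Suc i). red (row_mult (Suc (Suc i)) y D' c' * D c' c''))"
    using v by (intro sum.cong refl) (simp add: row_eq_def red_mult_red_left)
  also have "\<dots> = red (\<Sum>c'\<in>noninc_words (Suc i). \<Sum>c\<in>noninc_words (Suc (Suc i)). y c * (D' c c' * D c' c''))"
    by (simp add: row_mult_def lin_ext_sum sum_distrib_right mult.assoc)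
  also have "\<dots> = red (\<Sum>c\<in>noninc_words (Suc (Suc i)). y c * row_mult (Suc i) (D' c) D c'')"
    by (subst sum.swap) (simp add: row_mult_def sum_distrib_left)
  also have "\<dots> = (\<Sum>c\<in>noninc_words (Suc (Suc i)). red (y c * red (row_mult (Suc i) (D' c) D c'')))"
    by (simp add: lin_ext_sum red_mult_red_right)
  also have "\<dots> = 0" using zero c'' by (intro sum.neutral) (simp add: row_eq_def)
  finally show "red (row_mult (Suc i) v D c'') = red 0" by simp
qed

lemma next_lifts_below:
  assumes "triangular i D" "triangular (Suc i) D'"
    "\<And>c. c \<in> noninc_words (Suc (Suc i)) \<Longrightarrow> row_eq i (row_mult (Suc i) (D' c) D) (\<lambda>_. 0)"
  shows "lifts_below (Suc i) D'"
  unfolding lifts_below_def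
proof (intro allI impI)
  fix Q v y0
  assume Q: "\<forall>w z. Q w \<longrightarrow> word_le z w \<longrightarrow> Q z" and v: "row_eq (Suc i) v (row_mult (Suc (Suc i)) y0 D')"
    "\<forall>w\<in>row_words (Suc i) v. Q w"
  have "row_eq i (row_mult (Suc i) v D) (\<lambda>_. 0)" by (rule row_mult_image_in_kernel[OF assms(3) v(1)])
  then show "\<exists>y. row_eq (Suc i) v (row_mult (Suc (Suc i)) y D') \<and> (\<forall>w\<in>row_words (Suc (Suc i)) y. Q w)"
    using Q v(2) by (intro next_exact[OF assms]) auto
qed

definition first_matrix :: "'x list \<Rightarrow> 'x list \<Rightarrow> ('x, 'k) free_algebra"
  where "first_matrix c c' = word_monomial c"

lemma triangular_first: "triangular 0 first_matrix"
  unfolding triangular_def first_matrix_def by (auto simp: noninc_words_0 elim!: noninc_words_SucE)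

text \<open>A nonempty strictly ascending word can always give its last letter to the empty word.\<close>

lemma first_exact:
  assumes Q: "\<And>w z. Q w \<Longrightarrow> word_le z w \<Longrightarrow> Q z"
    and v: "[] \<notin> keys (red (v []))" "\<And>w. w \<in> row_words 0 v \<Longrightarrow> Q w"
  shows "\<exists>y. row_eq 0 v (row_mult (Suc 0) y first_matrix) \<and> (\<forall>w\<in>row_words (Suc 0) y. Q w)"
proof (rule triangular_preimage[where Ker = "\<lambda>v. [] \<notin> keys (red (v []))"
      and D = first_matrix and i = 0 and v = v and Q = Q])
  fix v s and c :: "'x list"
  assume v: "[] \<notin> keys (red (v []))" and c: "c \<in> noninc_words (Suc 0)"
  have "[] \<notin> keys (red (s * first_matrix c []))"
  proof
    assume "[] \<in> keys (red (s * first_matrix c []))"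
    then obtain u where "nf (u @ c) = []"
      using keys_red_mult[of "[]" s "first_matrix c []"] by (auto simp: first_matrix_def eq_commute[of "[]"])
    then show False using length_nf[of "u @ c"] c by (auto simp: noninc_words_def)
  qed
  then show "[] \<notin> keys (red (v [] - s * first_matrix c []))"
    using v by (simp add: red_diff in_keys_iff lookup_minus)
next
  fix v w assume v: "[] \<notin> keys (red (v []))" and w: "w \<in> row_words 0 v"
  have w': "w \<in> keys (red (v []))" using w by (auto simp: row_words_def noninc_words_0)
  then have "w \<noteq> []" using v by auto
  then obtain u a where "w = u @ [a]" by (metis rev_exhaust)
  moreover have "w \<in> strict_words" using w' keys_red by blast
  ultimately show "\<exists>u c. c \<in> noninc_words (Suc 0) \<and> u @ [hd c] \<in> strict_words \<and> w = u @ c"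
    by (intro exI[of _ u] exI[of _ "[a]"]) (auto simp: noninc_words_def)
qed (use triangular_first Q v in auto)

lemma image_first:
  assumes "row_eq 0 v (row_mult (Suc 0) y first_matrix)" shows "[] \<notin> keys (red (v []))"
proof
  assume "[] \<in> keys (red (v []))"
  then have "[] \<in> row_words 0 (row_mult (Suc 0) y first_matrix)"
    using assms by (auto simp: row_words_def row_eq_def noninc_words_0)
  from row_words_mult_le[OF triangular_first this] show False
    by (auto simp: row_words_def word_le_def noninc_words_def)
qed

theorem linear_resolution:
  "\<exists>D. D 0 = first_matrix \<and> (\<forall>i. triangular i (D i) \<and>
    (\<forall>v. row_eq i (row_mult (Suc i) v (D i)) (\<lambda>_. 0) \<longleftrightarrow>
      (\<exists>y. row_eq (Suc i) v (row_mult (Suc (Suc i)) y (D (Suc i))))))"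
proof -
  have "lifts_below 0 first_matrix"
    unfolding lifts_below_def using image_first first_exact by blast
  then have "\<exists>D. \<forall>i. (triangular i (D i) \<and> lifts_below i (D i) \<and> (i = 0 \<longrightarrow> D i = first_matrix)) \<and>
      (\<forall>c\<in>noninc_words (Suc (Suc i)). row_eq i (row_mult (Suc i) (D (Suc i) c) (D i)) (\<lambda>_. 0))"
    using triangular_first next_matrix next_lifts_below
    by (intro dependent_nat_choice) (blast, metis nat.distinct(1))
  then obtain D where D: "\<And>i. triangular i (D i)" "D 0 = first_matrix"
    "\<And>i c. c \<in> noninc_words (Suc (Suc i)) \<Longrightarrow> row_eq i (row_mult (Suc i) (D (Suc i) c) (D i)) (\<lambda>_. 0)" by blast
  have "row_eq i (row_mult (Suc i) v (D i)) (\<lambda>_. 0) \<longleftrightarrow>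
      (\<exists>y. row_eq (Suc i) v (row_mult (Suc (Suc i)) y (D (Suc i))))" for i v
  proof
    assume "row_eq i (row_mult (Suc i) v (D i)) (\<lambda>_. 0)"
    then show "\<exists>y. row_eq (Suc i) v (row_mult (Suc (Suc i)) y (D (Suc i)))"
      using next_exact[OF D(1) D(1) D(3), of i "\<lambda>_. True" v] by blast
  next
    assume "\<exists>y. row_eq (Suc i) v (row_mult (Suc (Suc i)) y (D (Suc i)))"
    then obtain y where y: "row_eq (Suc i) v (row_mult (Suc (Suc i)) y (D (Suc i)))" by blast
    show "row_eq i (row_mult (Suc i) v (D i)) (\<lambda>_. 0)"
      by (rule row_mult_image_in_kernel[OF _ y]) (rule D(3))
  qed
  then show ?thesis using D by blast
qed

end

section \<open>Koszulness\<close>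

lemma lin_span_mono:
  assumes "S \<subseteq> S'" shows "lin_span K M S \<subseteq> lin_span K M S'"
proof
  fix x assume "x \<in> lin_span K M S"
  then obtain a T where "x = (\<Oplus>\<^bsub>M\<^esub>v\<in>T. a v \<odot>\<^bsub>M\<^esub> v)" "finite T" "T \<subseteq> S" "a \<in> T \<rightarrow> carrier K"
    unfolding lin_span_def by blast
  moreover have "T \<subseteq> S'" using \<open>T \<subseteq> S\<close> assms by (rule subset_trans)
  ultimately show "x \<in> lin_span K M S'" unfolding lin_span_def by (intro CollectI exI conjI)
qed

context binomial_algebra
begin

text \<open>The constant coefficient of the reduction is the component of degree zero.\<close>

lemma augmentation_ideal_iff:
  "\<rho> f \<in> augmentation_ideal ground_field F G \<longleftrightarrow> [] \<notin> keys (red f)"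
proof
  interpret assoc_algebra ground_field F by (rule assoc_algebra_presented)
  assume "\<rho> f \<in> augmentation_ideal ground_field F G"
  then obtain a T where T: "finite T" "T \<subseteq> (\<Union>i\<in>{1..}. G i)" "\<rho> f = (\<Oplus>\<^bsub>F\<^esub>v\<in>T. a v \<odot>\<^bsub>F\<^esub> v)"
    unfolding augmentation_ideal_def lin_span_def by blast
  have "\<exists>g. v = \<rho> g \<and> [] \<notin> keys g" if "v \<in> T" for v
  proof -
    obtain i where "1 \<le> i" "v \<in> G i" using T(2) \<open>v \<in> T\<close> by auto
    then show ?thesis unfolding length_grading_def by force
  qed
  then obtain g where g: "\<And>v. v \<in> T \<Longrightarrow> v = \<rho> (g v)" "\<And>v. v \<in> T \<Longrightarrow> [] \<notin> keys (g v)" by metis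
  have "a v \<odot>\<^bsub>F\<^esub> v = \<rho> (scale (a v) (g v))" if "v \<in> T" for v
    by (subst g(1)[OF that]) (simp add: presented_algebra_simps)
  then have "\<rho> f = (\<Oplus>\<^bsub>F\<^esub>v\<in>T. \<rho> (scale (a v) (g v)))"
    unfolding T(3) by (intro finsum_cong') (auto simp: presented_algebra_simps)
  also have "\<dots> = \<rho> (\<Sum>v\<in>T. scale (a v) (g v))" using T(1) by (rule finsum_presented_algebra)
  finally have eq: "red f = red (\<Sum>v\<in>T. scale (a v) (g v))" by (simp add: rho_eq_iff)
  have no_constant: "[] \<notin> keys (\<Sum>v\<in>T. scale (a v) (g v))"
    using g(2) by (simp add: in_keys_iff lookup_sum)
  show "[] \<notin> keys (red f)"
  proof
    assume "[] \<in> keys (red f)"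
    then obtain w where "w \<in> keys (\<Sum>v\<in>T. scale (a v) (g v))" "nf w = []"
      unfolding eq using keys_red[of "\<Sum>v\<in>T. scale (a v) (g v)"] by auto
    then show False using no_constant length_nf[of w] by auto
  qed
next
  let ?S = "strict_words - {[]}"
  assume "[] \<notin> keys (red f)"
  then have "keys (red f) \<subseteq> ?S" using keys_red[of f] by blast
  then have "\<rho> f \<in> \<rho> ` {f. keys f \<subseteq> ?S}" using rho_red[of f] by (intro image_eqI[of _ _ "red f"]) auto
  also have "\<dots> = lin_span ground_field F ((\<lambda>u. \<rho> (word_monomial u)) ` ?S)"
    using basis_words[of ?S] by (simp add: is_basis_def)
  also have "\<dots> \<subseteq> lin_span ground_field F (\<Union>i\<in>{1..}. G i)"
  proof -
    have "\<rho> (word_monomial u) \<in> (\<Union>i\<in>{1..}. G i)" if "u \<in> ?S" for u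
      using that by (intro UN_I[of "length u"]) (auto simp: Suc_le_eq intro!: grade_memI)
    then have "(\<lambda>u. \<rho> (word_monomial u)) ` ?S \<subseteq> (\<Union>i\<in>{1..}. G i)" by (rule image_subsetI)
    then show ?thesis by (rule lin_span_mono)
  qed
  finally show "\<rho> f \<in> augmentation_ideal ground_field F G" by (simp add: augmentation_ideal_def)
qed

text \<open>Enumerating the nonincreasing words turns rows and matrices indexed by words into tuples and
matrices over the quotient algebra.\<close>

theorem koszul: "koszul ground_field F G"
proof -
  interpret assoc_algebra ground_field F by (rule assoc_algebra_presented)
  obtain D where D: "D 0 = first_matrix" "\<And>i. triangular i (D i)"
    "\<And>i v. row_eq i (row_mult (Suc i) v (D i)) (\<lambda>_. 0) \<longleftrightarrow>
      (\<exists>y. row_eq (Suc i) v (row_mult (Suc (Suc i)) y (D (Suc i))))"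
    using linear_resolution by blast
  define b where "b i = card (noninc_words i :: 'x list set)" for i
  have "\<exists>e. bij_betw e {..<b i} (noninc_words i :: 'x list set)" for i
    using ex_bij_betw_nat_finite[OF finite_noninc_words, of i] by (simp add: b_def lessThan_atLeast0)
  then obtain en where en: "\<And>i. bij_betw (en i) {..<b i} (noninc_words i :: 'x list set)" by metis
  have en_mem: "en i s \<in> noninc_words i" if "s < b i" for i s
    using bij_betwE[OF en[of i]] that by blast
  \<comment> \<open>Every tuple over the quotient algebra is represented by a row indexed by words.\<close>
  define vec where "vec i w = (\<lambda>s\<in>{..<b i}. \<rho> (w (en i s)))" for i and w :: "'x list \<Rightarrow> ('x, 'k) free_algebra"
  define M where "M i p s = \<rho> (D i (en (Suc i) p) (en i s))" for i p s
  have module: "free_left_module F (b i) = range (vec i)" for i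
  proof (rule equalityI; rule subsetI)
    fix v assume v: "v \<in> free_left_module F (b i)"
    then have "\<exists>f. v s = \<rho> f" if "s < b i" for s
      using that by (auto simp: free_left_module_def presented_algebra_simps PiE_iff)
    then obtain f where f: "\<And>s. s < b i \<Longrightarrow> v s = \<rho> (f s)" by metis
    have "v = vec i (\<lambda>c. f (the_inv_into {..<b i} (en i) c))"
    proof
      fix s
      show "v s = vec i (\<lambda>c. f (the_inv_into {..<b i} (en i) c)) s"
        using v f en[of i]
        by (auto simp: vec_def free_left_module_def PiE_iff extensional_def the_inv_into_f_f bij_betw_def)
    qed
    then show "v \<in> range (vec i)" by blast
  qed (auto simp: vec_def free_left_module_def presented_algebra_simps)
  have row_eq: "vec i v = vec i w \<longleftrightarrow> row_eq i v w" for i v w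
  proof -
    have "vec i v = vec i w \<longleftrightarrow> (\<forall>s<b i. \<rho> (v (en i s)) = \<rho> (w (en i s)))"
      unfolding vec_def by (auto simp: fun_eq_iff restrict_def)
    also have "\<dots> \<longleftrightarrow> (\<forall>c\<in>en i ` {..<b i}. red (v c) = red (w c))" by (auto simp: rho_eq_iff)
    finally show ?thesis unfolding row_eq_def bij_betw_imp_surj_on[OF en] .
  qed
  have mult: "row_times_matrix F (b (Suc i)) (b i) (M i) (vec (Suc i) v) = vec i (row_mult (Suc i) v (D i))" for i v
    unfolding row_times_matrix_def vec_def[of i]
  proof (rule restrict_ext)
    fix s assume s: "s \<in> {..<b i}"
    let ?f = "\<lambda>c. v c * D i c (en i s)"
    have "(\<Oplus>\<^bsub>F\<^esub>p\<in>{..<b (Suc i)}. vec (Suc i) v p \<otimes>\<^bsub>F\<^esub> M i p s) = (\<Oplus>\<^bsub>F\<^esub>p\<in>{..<b (Suc i)}. \<rho> (?f (en (Suc i) p)))"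
      by (intro finsum_cong') (auto simp: vec_def M_def presented_algebra_simps)
    also have "\<dots> = \<rho> (\<Sum>p\<in>{..<b (Suc i)}. ?f (en (Suc i) p))" by (rule finsum_presented_algebra) simp
    also have "(\<Sum>p\<in>{..<b (Suc i)}. ?f (en (Suc i) p)) = row_mult (Suc i) v (D i) (en i s)"
      unfolding row_mult_def by (rule sum.reindex_bij_betw[OF en])
    finally show "(\<Oplus>\<^bsub>F\<^esub>p\<in>{..<b (Suc i)}. vec (Suc i) v p \<otimes>\<^bsub>F\<^esub> M i p s) = \<rho> (row_mult (Suc i) v (D i) (en i s))" .
  qed
  have vec_0: "vec i (\<lambda>_. 0) = (\<lambda>s\<in>{..<b i}. \<zero>\<^bsub>F\<^esub>)" for i
    by (simp add: vec_def presented_algebra_simps)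
  have linear: "M i p s \<in> G 1" if "p < b (Suc i)" "s < b i" for i p s
    unfolding M_def using D(2)[of i] en_mem[OF that(1)] en_mem[OF that(2)]
    by (intro grade_memI) (fastforce simp: triangular_def)
  have b0: "b 0 = 1" by (simp add: b_def noninc_words_0)
  then have "en 0 0 = []" using en_mem[of 0 0] by (simp add: noninc_words_0)
  then have augmentation: "vec 0 v 0 \<in> augmentation_ideal ground_field F G \<longleftrightarrow> [] \<notin> keys (red (v []))" for v
    using b0 by (simp add: vec_def augmentation_ideal_iff)
  have start: "row_times_matrix F (b 1) (b 0) (M 0) ` free_left_module F (b 1)
      = {v \<in> free_left_module F (b 0). v 0 \<in> augmentation_ideal ground_field F G}"
  proof -
    have "(\<exists>y. row_eq 0 v (row_mult (Suc 0) y (D 0))) \<longleftrightarrow> [] \<notin> keys (red (v []))" for v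
      using first_exact[of "\<lambda>_. True" v] image_first[of v] by (auto simp: D(1))
    then have "{vec 0 v | v. vec 0 v 0 \<in> augmentation_ideal ground_field F G} = {vec 0 v | v. \<exists>y. vec 0 v = vec 0 (row_mult (Suc 0) y (D 0))}"
      by (simp add: augmentation row_eq)
    also have "\<dots> = (\<lambda>y. vec 0 (row_mult (Suc 0) y (D 0))) ` UNIV" by blast
    also have "\<dots> = row_times_matrix F (b 1) (b 0) (M 0) ` free_left_module F (b 1)"
      using mult[of 0] by (simp add: module image_image)
    finally have image: "row_times_matrix F (b 1) (b 0) (M 0) ` free_left_module F (b 1) =
        {vec 0 v | v. vec 0 v 0 \<in> augmentation_ideal ground_field F G}" by (rule sym)
    show ?thesis unfolding image module[of 0] by blast
  qed
  have exact: "row_times_matrix F (b (i + 2)) (b (i + 1)) (M (i + 1)) ` free_left_module F (b (i + 2))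
      = {v \<in> free_left_module F (b (i + 1)).
          row_times_matrix F (b (i + 1)) (b i) (M i) v = (\<lambda>s\<in>{..<b i}. \<zero>\<^bsub>F\<^esub>)}" for i
  proof -
    have "{vec (Suc i) v | v. vec i (row_mult (Suc i) v (D i)) = vec i (\<lambda>_. 0)} =
        {vec (Suc i) v | v. \<exists>y. vec (Suc i) v = vec (Suc i) (row_mult (Suc (Suc i)) y (D (Suc i)))}"
      by (simp add: row_eq D(3))
    also have "\<dots> = (\<lambda>y. vec (Suc i) (row_mult (Suc (Suc i)) y (D (Suc i)))) ` UNIV" by blast
    also have "\<dots> = row_times_matrix F (b (i + 2)) (b (i + 1)) (M (i + 1)) ` free_left_module F (b (i + 2))"
      using mult[of "Suc i"] by (simp add: module image_image)
    finally have image: "row_times_matrix F (b (i + 2)) (b (i + 1)) (M (i + 1)) ` free_left_module F (b (i + 2)) =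
        {vec (Suc i) v | v. vec i (row_mult (Suc i) v (D i)) = vec i (\<lambda>_. 0)}" by (rule sym)
    have "{v \<in> range (vec (Suc i)). row_times_matrix F (b (Suc i)) (b i) (M i) v = vec i (\<lambda>_. 0)} =
        {vec (Suc i) v | v. row_times_matrix F (b (Suc i)) (b i) (M i) (vec (Suc i) v) = vec i (\<lambda>_. 0)}" by blast
    then show ?thesis unfolding image using mult[of i] by (simp add: module vec_0[symmetric])
  qed
  show ?thesis unfolding koszul_def
    by (rule conjI[OF graded conjI[OF connected]], rule exI[of _ b], rule exI[of _ M],
      intro conjI allI impI b0 linear start exact)
qed

end

section \<open>From relations of skew-polynomial type to swaps\<close>

lemma sorted_sublist_pair: "sublist [a, b] u \<Longrightarrow> sorted u \<Longrightarrow> a \<le> b"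
  by (auto simp: sublist_def sorted_append)

text \<open>The map from descents to ascents given by the relations is onto, as every ascent occurs on a
right-hand side, and there are as many descents as ascents. So it is a bijection, and \<open>r\<close> is
this map together with its inverse and the identity on squares. The sorted words are independent
because a nonzero element of the ideal has a leading word with a descent.\<close>

lemma skew_polynomial_binomial_algebra:
  fixes R :: "('x::{finite,linorder}, 'k::field) free_algebra set"
  assumes skew: "skew_polynomial_type R" and groebner: "groebner_basis R (relation_ideal R)"
  shows "\<exists>rk r. binomial_algebra rk r R"
proof -
  obtain c p q where R: "R = {word_monomial [j, i] - single [p i j, q i j] (c i j) | i j. i < j}"
    and c: "\<And>i j. i < j \<Longrightarrow> c i j \<noteq> 0" and p: "\<And>i j. i < j \<Longrightarrow> p i j < j"
    and onto: "\<And>i j. i < j \<Longrightarrow> \<exists>k l. k < l \<and> p k l = i \<and> q k l = j"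
    using skew unfolding skew_polynomial_type_def by blast
  define A where "A = {(j :: 'x, i). i < j}"
  define B where "B = {(i :: 'x, j). i < j}"
  define f where "f = (\<lambda>(j, i). (p i j, q i j))"
  have "B = prod.swap ` A" by (auto simp: A_def B_def image_iff)
  then have card: "card A = card B" by (simp add: card_image)
  have "B \<subseteq> f ` A"
  proof
    fix z assume "z \<in> B"
    then obtain k l where "k < l" "z = (p k l, q k l)" using onto unfolding B_def by fastforce
    then show "z \<in> f ` A" by (intro image_eqI[of _ _ "(l, k)"]) (auto simp: A_def f_def)
  qed
  then have image: "f ` A = B" using card_image_le[of A f] card by (intro card_seteq[symmetric]) simp_all
  then have inj: "inj_on f A" using card by (intro eq_card_imp_inj_on) simp_all
  define g where "g = the_inv_into A f"
  have gf: "g (f z) = z" if "z \<in> A" for z unfolding g_def using inj that by (rule the_inv_into_f_f)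
  have fg: "f (g z) = z" if "z \<in> B" for z unfolding g_def using inj that image by (intro f_the_inv_into_f) auto
  have gA: "g z \<in> A" if "z \<in> B" for z unfolding g_def using inj that image by (intro the_inv_into_into) auto
  have fB: "f z \<in> B" if "z \<in> A" for z using that image by blast
  define r where "r z = (if z \<in> A then f z else if z \<in> B then g z else z)" for z
  define rk where "rk x = int (card {z. z < x})" for x :: 'x
  have disjoint: "z \<notin> A \<or> z \<notin> B" for z by (auto simp: A_def B_def)
  have mono: "rk x < rk y" if "x < y" for x y
    unfolding rk_def using that by (auto intro!: psubset_card_mono)
  have rk: "rk x < rk y \<longleftrightarrow> x < y" for x y
    using mono[of x y] mono[of y x] by (cases x y rule: linorder_cases) auto
  have desc: "r (y, x) = (p x y, q x y)" "p x y < q x y" if "x < y" for x y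
    using that fB[of "(y, x)"] by (auto simp: r_def A_def B_def f_def)
  have "binomial_relations rk r R"
  proof
    show "inj rk" using rk by (metis injI less_irrefl linorder_neqE)
    show "r (x, x) = (x, x)" for x by (simp add: r_def A_def B_def)
    show "r (r z) = z" for z
      unfolding r_def[of z] using disjoint[of z] disjoint[of "f z"] disjoint[of "g z"] fB[of z] gA[of z] gf[of z] fg[of z]
      by (auto simp: r_def)
    show "rk (fst (r (y, x))) < rk (snd (r (y, x))) \<and> rk (fst (r (y, x))) < rk y" if "rk x < rk y" for x y
      using that desc[of x y] p[of x y] by (simp add: rk)
    show "rk (snd (r (x, y))) < rk (fst (r (x, y))) \<and> rk x < rk (fst (r (x, y)))" if "rk x < rk y" for x y
    proof -
      have xy: "(x, y) \<in> B" using that by (simp add: B_def rk)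
      obtain j i where ji: "r (x, y) = (j, i)" "(j, i) \<in> A" "f (j, i) = (x, y)"
        using gA[OF xy] fg[OF xy] disjoint[of "(x, y)"] xy by (metis prod.collapse r_def)
      then show ?thesis using p[of i j] by (auto simp: A_def f_def rk)
    qed
    show "rk x < rk y \<longleftrightarrow> x < y" for x y by (rule rk)
    show "\<exists>c. c \<noteq> 0 \<and> word_monomial [x, y] - single [fst (r (x, y)), snd (r (x, y))] c \<in> R"
      if "y < x" for x y
      using that c[OF that] desc(1)[OF that] unfolding R by auto
  qed
  moreover have "h = 0" if h: "h \<in> relation_ideal R" "\<And>u. u \<in> keys h \<Longrightarrow> sorted u" for h
  proof (rule ccontr)
    assume "h \<noteq> 0"
    then obtain i j where ij: "i < j" "sublist
        (lead_word (word_monomial [j, i] - single [p i j, q i j] (c i j))) (lead_word h)"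
      using groebner h(1) unfolding groebner_basis_def R by blast
    have "([p i j, q i j], [j, i]) \<in> lenlex {(x, y). x < y}"
      using lenlex_first_difference[of "p i j" j "{(x, y). x < y}" "[q i j]" "[i]" "[]"] p[OF ij(1)] by simp
    then have "lead_word (word_monomial [j, i] - single [p i j, q i j] (c i j)) = [j, i]"
      using p[OF ij(1)] by (intro lead_word_binomial) (auto simp: deglex_less_def)
    then have "j \<le> i"
      using ij(2) h(2)[OF lead_word_props(1)[OF \<open>h \<noteq> 0\<close>]] by (auto intro: sorted_sublist_pair)
    then show False using ij(1) by simp
  qed
  ultimately have "binomial_algebra rk r R"
    by (simp add: binomial_algebra_def binomial_algebra_axioms_def)
  then show ?thesis by blast
qed

theorem theoremA:
  fixes R R_dual :: "('x::{finite,linorder}, 'k::field) free_algebra set"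
    and F :: "('k, ('x, 'k) free_algebra set) module"
    and F_grade :: "nat \<Rightarrow> ('x, 'k) free_algebra set set"
    and n :: nat
  assumes n: "n = card (UNIV :: 'x set)"
    and skew: "skew_polynomial_type R"
    and groebner: "groebner_basis R (relation_ideal R)"
    and R_dual: "R_dual = R \<union> {word_monomial [x, x] | x. True}"
    and F: "F = presented_algebra R_dual"
    and F_grade: "F_grade = length_grading R_dual"
  shows
    "groebner_basis R_dual (relation_ideal R_dual) \<and>
     inj_on (\<lambda>u. residue_class R_dual (word_monomial u)) grassmann_words \<and>
     is_basis ground_field F
       ((\<lambda>u. residue_class R_dual (word_monomial u)) ` grassmann_words) (carrier F) \<and>
     koszul ground_field F F_grade \<and>
     frobenius_algebra ground_field F F_grade n \<and>
     graded_algebra ground_field F F_grade \<and>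
     connected_grading ground_field F F_grade \<and>
     (\<forall>i\<in>{1..n}. F_grade i = lin_span ground_field F
       ((\<lambda>u. residue_class R_dual (word_monomial u)) ` {u \<in> grassmann_words. length u = i})) \<and>
     F_grade n = lin_span ground_field F
       {residue_class R_dual (word_monomial (sorted_list_of_set UNIV))} \<and>
     (\<forall>j\<ge>1. F_grade (n + j) = {\<zero>\<^bsub>F\<^esub>}) \<and>
     quantum_grassmann_algebra ground_field F F_grade n \<and>
     (\<forall>i\<in>{1..n}. has_dim ground_field F (F_grade i) (n choose i))"
proof -
  obtain rk r where "binomial_algebra rk r R"
    using skew_polynomial_binomial_algebra[OF skew groebner] by blast
  then interpret B: binomial_algebra rk r R .
  have dual: "R_dual = dual_relations R" unfolding R_dual dual_relations_def ..
  have words: "grassmann_words = (B.strict_words :: 'x list set)"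
    by (simp add: grassmann_words_eq B.strict_words_def)
  have words_of_length: "{u \<in> B.strict_words. length u = i} = B.strict_words_of i" for i
    by (auto simp: B.strict_words_of_def)
  have top: "B.strict_words_of n = {sorted_list_of_set UNIV}"
  proof -
    have "card (B.strict_words_of n) = 1" using B.card_strict_of_length(2)[of n] n by simp
    moreover have "sorted_list_of_set UNIV \<in> B.strict_words_of n"
      by (simp add: B.strict_words_of_def B.strict_words_def n)
    ultimately show ?thesis by (metis card_1_singletonE singletonD)
  qed
  have frobenius: "frobenius_algebra ground_field F F_grade n"
    unfolding F F_grade dual n by (rule B.frobenius)
  have dim: "has_dim ground_field F (F_grade i) (n choose i)" for i
    unfolding F F_grade dual n by (rule B.dim_grade)
  have span: "F_grade i = lin_span ground_field F
      ((\<lambda>u. residue_class R_dual (word_monomial u)) ` B.strict_words_of i)" for i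
    unfolding F F_grade dual by (rule B.grade_span)
  show ?thesis
  proof (intro conjI ballI allI impI)
    show "groebner_basis R_dual (relation_ideal R_dual)" unfolding dual by (rule B.groebner_dual)
    show "inj_on (\<lambda>u. residue_class R_dual (word_monomial u)) grassmann_words"
      unfolding dual words by (rule B.inj_words)
    show "is_basis ground_field F
        ((\<lambda>u. residue_class R_dual (word_monomial u)) ` grassmann_words) (carrier F)"
      unfolding F dual words using B.basis_words[OF order_refl] by (simp add: B.carrier_eq)
    show "koszul ground_field F F_grade" unfolding F F_grade dual by (rule B.koszul)
    show "frobenius_algebra ground_field F F_grade n" by (rule frobenius)
    show "graded_algebra ground_field F F_grade" unfolding F F_grade dual by (rule B.graded)
    show "connected_grading ground_field F F_grade" unfolding F F_grade dual by (rule B.connected)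
    show "F_grade i = lin_span ground_field F
       ((\<lambda>u. residue_class R_dual (word_monomial u)) ` {u \<in> grassmann_words. length u = i})" for i
      unfolding words words_of_length by (rule span)
    show "F_grade n = lin_span ground_field F
       {residue_class R_dual (word_monomial (sorted_list_of_set UNIV))}"
      using span[of n] by (simp add: top)
    show "F_grade (n + j) = {\<zero>\<^bsub>F\<^esub>}" if "1 \<le> j" for j
      unfolding F F_grade dual n using that by (intro B.grade_above) simp
    show "quantum_grassmann_algebra ground_field F F_grade n"
      unfolding quantum_grassmann_algebra_def using frobenius dim by blast
    show "has_dim ground_field F (F_grade i) (n choose i)" for i by (rule dim)
  qed
qed

end
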